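(* Let $\ell,k\ge1$ be integers and $a\in\mathbb C^*$. Then $V(T^e_a)$ is an irreducible extremal loop weight $\mathcal U_q(\hat{sl}_\infty)$-module of $\ell$-weight $$m_{T^e}=Y_{\ell,aq^{-\ell+1}}Y_{\ell,aq^{-\ell+3}}\cdots Y_{\ell,aq^{-\ell+1+2(k-1)}}\,Y_{0,aq}^{-1}Y_{0,aq^3}^{-1}\cdots Y_{0,aq^{1+2(k-1)}}^{-1}.$$
   Context: Algebra. Fix $t\in\mathbb C$ such that $q=e^{t}$ is not a root of unity, and put $q^{r}=e^{tr}$ for $r\in\mathbb Q$. For $i,j\in\mathbb Z$ let $C_{ii}=2$, $C_{i,i\pm1}=-1$, $C_{ij}=0$ otherwise; $\mathfrak h=\bigoplus_{i\in\mathbb Z}\mathbb Q h_i$; $\Lambda_i\in\mathfrak h^*$ with $\Lambda_i(h_j)=\delta_{ij}$; $\alpha_i=2\Lambda_i-\Lambda_{i-1}-\Lambda_{i+1}$; $P=\bigoplus_i\mathbb Z\Lambda_i$. The algebra $\mathcal U_q(\hat{sl}_\infty)$ is the $\mathbb C$-algebra generated by $x_{i,r}^{\pm}$ ($i,r\in\mathbb Z$), $k_h$ ($h\in\mathfrak h$), $h_{i,m}$ ($i\in\mathbb Z$, $m\in\mathbb Z\setminus\{0\}$). With $x_i^\pm(z)=\sum_{r}x_{i,r}^\pm z^r$, $\phi_i^\pm(z)=\sum_{m\ge0}\phi^\pm_{i,\pm m}z^{\pm m}=k_{\pm h_i}\exp(\pm(q-q^{-1})\sum_{m\ge1}h_{i,\pm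 m}z^{\pm m})$, $\delta(z)=\sum_{s\in\mathbb Z}z^s$, the relations are: $k_hk_{h'}=k_{h+h'}$, $k_0=1$; all $k_h$ and all coefficients of the $\phi_i^\pm(z)$ commute; $k_hx_j^\pm(z)k_{-h}=q^{\pm\alpha_j(h)}x_j^\pm(z)$; for $\epsilon\in\{+,-\}$, $(w-q^{\pm C_{ij}}z)\phi_i^{\epsilon}(z)x_j^\pm(w)=(q^{\pm C_{ij}}w-z)x_j^\pm(w)\phi_i^{\epsilon}(z)$; $[x_i^+(z),x_j^-(w)]=\frac{\delta_{ij}}{q-q^{-1}}\big(\delta(w/z)\phi_i^+(w)-\delta(z/w)\phi_i^-(z)\big)$; $(w-q^{\pm C_{ij}}z)x_i^\pm(z)x_j^\pm(w)=(q^{\pm C_{ij}}w-z)x_j^\pm(w)x_i^\pm(z)$; for $|i-j|=1$, $x_i^\pm(z_1)x_i^\pm(z_2)x_j^\pm(w)-(q+q^{-1})x_i^\pm(z_1)x_j^\pm(w)x_i^\pm(z_2)+x_j^\pm(w)x_i^\pm(z_1)x_i^\pm(z_2)+(z_1\leftrightarrow z_2)=0$; and $[x_i^\pm(z),x_j^\pm(w)]=0$ for $|i-j|\ge2$. $\mathcal U_q^h(\hat{sl}_\infty)$ is the subalgebra generated by all $x_{i,0}^\pm$ and $k_h$. For a finite interval $J=[c,d]\subset\mathbb Z$, $\mathcal U_q(\hat{sl}_\infty)_J$ is the subalgebra generated by $x_{i,r}^\pm$, $h_{i,m}$ ($i\in J$) and $k_h$ ($h\in\bigoplus_{j\in J}\mathbb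 Qh_j$). Vector representation. Put $\psi(z)=\frac{q-q^{-1}z}{1-z}$. For $b\in\mathbb C^*$, $V(\boxed{1}_b)$ has basis $\boxed{j}_b$, $j\in\mathbb Z$, with $x_i^+(z)\boxed{j}_b=\delta_{i,j-1}\delta(bq^{j-1}z)\boxed{j-1}_b$, $x_i^-(z)\boxed{j}_b=\delta_{i,j}\delta(bq^jz)\boxed{j+1}_b$, and $\phi_i^\pm(z)\boxed{j}_b=\psi(bq^jz)\boxed{j}_b$ if $i=j$, $\psi(bq^{j+1}z)^{-1}\boxed{j}_b$ if $i=j-1$, $\boxed{j}_b$ otherwise (rational functions expanded in $z^{\pm1}$ for $\phi_i^\pm$). The module $V(T^e_a)$. Let $\mathcal T_{[1,\ell]\times[1,k]}$ be the set of arrays $T=(T_{i,j})_{1\le i\le\ell,1\le j\le k}$ of integers, weakly increasing in $j$ and strictly increasing in $i$. To $T$ associate the vector $$T_a=\boxed{T_{1,1}}_a\otimes\cdots\otimes\boxed{T_{\ell,1}}_{aq^{-2(\ell-1)}}\otimes\cdots\otimes\boxed{T_{1,k}}_{aq^{-2(1-k)}}\otimes\cdots\otimes\boxed{T_{\ell,k}}_{aq^{-2(\ell-k)}}$$ (columns read from left to right, each from top to bottom; the box $(i,j)$ has parameter $aq^{-2(i-j)}$) in the corresponding tensor product of vector representations. $T^e$ is the array with $T^e_{i,j}=i$. $V(T^e_a)$ is the span of all $T_a$, $T\in\mathcal T_{[1,\ell]\times[1,k]}$; it is a $\mathcal U_q(\hat{sl}_\infty)$-module via the iterated Drinfeld coproduct: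 on $v_1\otimes\cdots\otimes v_N$, $x_i^+(z)$ acts by $\sum_r\phi_i^-(z)^{\otimes(r-1)}\otimes x_i^+(z)\otimes1^{\otimes(N-r)}$, $x_i^-(z)$ by $\sum_r1^{\otimes(r-1)}\otimes x_i^-(z)\otimes\phi_i^+(z)^{\otimes(N-r)}$, $\phi_i^\pm(z)$ by $\phi_i^\pm(z)^{\otimes N}$, where the product of the total rational function $f(z)$ (product of the eigenvalues, simplified) with $\delta(cz)$ is understood as $f(c^{-1})\delta(cz)$. Definitions. A module $V$ is integrable if $V=\bigoplus_{\nu\in P}V_\nu$, $V_\nu=\{v:k_{h_i}v=q^{\nu(h_i)}v\ \forall i\}$, and all $x_{i,0}^\pm$ are locally nilpotent. For a monomial $m=\prod Y_{i,b}^{u_{i,b}}$ (finite product), $V_m$ is the simultaneous generalized eigenspace on which $\phi_i^\pm(z)$ has generalized eigenvalue the expansion in $z^{\pm1}$ of $\prod_b\psi(bqz)^{u_{i,b}}$ for every $i$. For an integrable module and $v\in V_\lambda$, $v$ is $i$-extremal if $x_{i,0}^+v=0$ (and then $S_i(v)=(x_{i,0}^-)^{(\lambda(h_i))}v$) or $x_{i,0}^-v=0$ (and then $S_i(v)=(x_{i,0}^+)^{(-\lambda(h_i))}v$), where $x^{(r)}=x^r/[r]_q!$; $v$ is extremal if $v$ and all $S_{i_1}\cdots S_{i_l}(v)$ are $i$-extremal for all $i,i_1,\dots,i_l\in\mathbb Z$. An extremal loop weight module of $\ell$-weight $m$ is an integrable module $V$ having a vector $v\in V_m$ such that (i) $\mathcal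 U_q(\hat{sl}_\infty)v=V$; (ii) $v$ is extremal for $\mathcal U_q^h(\hat{sl}_\infty)$; (iii) $\mathcal U_q(\hat{sl}_\infty)_J\,w$ is finite-dimensional for all $w\in V$ and all finite intervals $J\subset\mathbb Z$. *)

theory Defs
  imports
    Complex_Main
    "HOL-Library.Poly_Mapping"
    "HOL-Computational_Algebra.Computational_Algebra"
    "HOL-Computational_Algebra.Field_as_Ring"
    "HOL-Algebra.Generated_Rings"
begin

section \<open>The quantum affinization of \<open>sl\<^sub>\<infinity>\<close> by generators and relations\<close>

datatype sgn = Pos | Neg

fun sg :: "sgn \<Rightarrow> int" where
  "sg Pos = 1"
| "sg Neg = -1"

text \<open>
  The space \<open>\<hh>\<close> is the type \<open>int \<Rightarrow>\<^sub>0 rat\<close>, and the fundamental weight \<open>\<Lambda>\<^sub>i\<close> is the coordinate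
  \<open>h \<mapsto> Poly_Mapping.lookup h i\<close>.
\<close>

type_synonym cartan = "int \<Rightarrow>\<^sub>0 rat"

text \<open>\<open>X \<epsilon> i r\<close>, \<open>K h\<close>, \<open>H i m\<close> stand for \<open>x\<^sup>\<epsilon>\<^bsub>i,r\<^esub>\<close>, \<open>k\<^sub>h\<close>, \<open>h\<^bsub>i,m\<^esub>\<close>. The symbols \<open>H i 0\<close> are not generators
  of the algebra; they are set to zero by one of the relators below.\<close>

datatype gen = X sgn int int | K cartan | H int int

datatype gword = GWord (letters: "gen list")

instantiation gword :: monoid_add
begin
definition zero_gword :: gword where "zero_gword = GWord []"
definition plus_gword :: "gword \<Rightarrow> gword \<Rightarrow> gword" where
  "plus_gword u v = GWord (letters u @ letters v)"
instance by standard (auto simp: zero_gword_def plus_gword_def)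
end

text \<open>The free associative algebra: the monoid algebra of the free monoid on \<open>gen\<close>.
  Its multiplication is the convolution product of \<open>Poly_Mapping\<close>.\<close>

type_synonym falg = "gword \<Rightarrow>\<^sub>0 complex"

definition scal :: "complex \<Rightarrow> falg" where
  "scal c = Poly_Mapping.single 0 c"

definition gn :: "gen \<Rightarrow> falg" where
  "gn g = Poly_Mapping.single (GWord [g]) 1"

definition qpow :: "complex \<Rightarrow> rat \<Rightarrow> complex" where
  "qpow t r = exp (t * of_rat r)"

definition cart :: "int \<Rightarrow> int \<Rightarrow> int" where
  "cart i j = (if i = j then 2 else if \<bar>i - j\<bar> = 1 then -1 else 0)"

definition alpha :: "int \<Rightarrow> cartan \<Rightarrow> rat" where
  "alpha j h = 2 * Poly_Mapping.lookup h j - Poly_Mapping.lookup h (j - 1) - Poly_Mapping.lookup h (j + 1)"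

text \<open>\<open>exp (\<plusminus>(q - q\<^sup>-\<^sup>1) \<Sum>\<^bsub>m\<ge>1\<^esub> h\<^bsub>i,\<plusminus>m\<^esub> z\<^sup>m)\<close>, as a power series in \<open>z\<^sup>\<plusminus>\<^sup>1\<close> over the free algebra\<close>

definition exp_h :: "complex \<Rightarrow> sgn \<Rightarrow> int \<Rightarrow> falg fps" where
  "exp_h t \<epsilon> i =
     fps_compose (Abs_fps (\<lambda>n. scal (1 / fact n)))
       (Abs_fps (\<lambda>m. if m = 0 then 0
          else scal (of_int (sg \<epsilon>) * (exp t - inverse (exp t))) * gn (H i (sg \<epsilon> * int m))))"

text \<open>\<open>phi t \<epsilon> i m\<close> is the coefficient of \<open>z\<^sup>m\<close> in \<open>\<phi>\<^sub>i\<^sup>\<epsilon>(z)\<close>.\<close>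

definition phi :: "complex \<Rightarrow> sgn \<Rightarrow> int \<Rightarrow> int \<Rightarrow> falg" where
  "phi t \<epsilon> i m =
     (if 0 \<le> sg \<epsilon> * m
      then gn (K (Poly_Mapping.single i (of_int (sg \<epsilon>)))) * fps_nth (exp_h t \<epsilon> i) (nat \<bar>m\<bar>)
      else 0)"

definition cartan_elems :: "complex \<Rightarrow> falg set" where
  "cartan_elems t = {gn (K h) | h. True} \<union> {phi t \<epsilon> i m | \<epsilon> i m. True}"

definition serre :: "complex \<Rightarrow> sgn \<Rightarrow> int \<Rightarrow> int \<Rightarrow> int \<Rightarrow> int \<Rightarrow> int \<Rightarrow> falg" where
  "serre t \<epsilon> i j r1 r2 s =
     gn (X \<epsilon> i r1) * gn (X \<epsilon> i r2) * gn (X \<epsilon> j s)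
     - scal (exp t + inverse (exp t)) * gn (X \<epsilon> i r1) * gn (X \<epsilon> j s) * gn (X \<epsilon> i r2)
     + gn (X \<epsilon> j s) * gn (X \<epsilon> i r1) * gn (X \<epsilon> i r2)"

text \<open>
  Each relator is the difference of the two sides of a relation. The relations between formal
  series are written coefficientwise: \<open>phi_x\<close> is the coefficient of \<open>z\<^sup>m w\<^sup>r\<close>, \<open>x_x\<close>, \<open>x_pm\<close> and
  \<open>x_far\<close> the coefficient of \<open>z\<^sup>r w\<^sup>s\<close>, and \<open>x_serre\<close> the coefficient of \<open>z\<^sub>1\<^sup>r\<^sup>1 z\<^sub>2\<^sup>r\<^sup>2 w\<^sup>s\<close>.
\<close>

inductive_set relators :: "complex \<Rightarrow> falg set" for t :: complex where
  H_zero: "gn (H i 0) \<in> relators t"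
| K_add: "gn (K h) * gn (K h') - gn (K (h + h')) \<in> relators t"
| K_zero: "gn (K 0) - 1 \<in> relators t"
| commute: "u \<in> cartan_elems t \<Longrightarrow> v \<in> cartan_elems t \<Longrightarrow> u * v - v * u \<in> relators t"
| K_x: "gn (K h) * gn (X \<epsilon> j r) * gn (K (- h))
        - scal (qpow t (of_int (sg \<epsilon>) * alpha j h)) * gn (X \<epsilon> j r) \<in> relators t"
| phi_x: "Q = scal (exp t powi (sg \<epsilon> * cart i j)) \<Longrightarrow>
    (phi t \<eta> i m * gn (X \<epsilon> j (r - 1)) - Q * phi t \<eta> i (m - 1) * gn (X \<epsilon> j r))
    - (Q * gn (X \<epsilon> j (r - 1)) * phi t \<eta> i m - gn (X \<epsilon> j r) * phi t \<eta> i (m - 1)) \<in> relators t"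
| x_pm: "(gn (X Pos i r) * gn (X Neg j s) - gn (X Neg j s) * gn (X Pos i r))
    - (if i = j then scal (1 / (exp t - inverse (exp t))) * (phi t Pos i (r + s) - phi t Neg i (r + s))
       else 0) \<in> relators t"
| x_x: "Q = scal (exp t powi (sg \<epsilon> * cart i j)) \<Longrightarrow>
    (gn (X \<epsilon> i r) * gn (X \<epsilon> j (s - 1)) - Q * gn (X \<epsilon> i (r - 1)) * gn (X \<epsilon> j s))
    - (Q * gn (X \<epsilon> j (s - 1)) * gn (X \<epsilon> i r) - gn (X \<epsilon> j s) * gn (X \<epsilon> i (r - 1))) \<in> relators t"
| x_serre: "\<bar>i - j\<bar> = 1 \<Longrightarrow> serre t \<epsilon> i j r1 r2 s + serre t \<epsilon> i j r2 r1 s \<in> relators t"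
| x_far: "\<bar>i - j\<bar> \<ge> 2 \<Longrightarrow>
    gn (X \<epsilon> i r) * gn (X \<epsilon> j s) - gn (X \<epsilon> j s) * gn (X \<epsilon> i r) \<in> relators t"

definition free_alg :: "falg ring" where
  "free_alg = \<lparr>carrier = UNIV, monoid.mult = (*), one = 1, zero = 0, add = (+)\<rparr>"

definition rel_ideal :: "complex \<Rightarrow> falg set" where
  "rel_ideal t = genideal free_alg (relators t)"

definition Uq :: "complex \<Rightarrow> falg set ring" where
  "Uq t = free_alg Quot rel_ideal t"

definition cls :: "complex \<Rightarrow> falg \<Rightarrow> falg set" where
  "cls t p = rel_ideal t +>\<^bsub>free_alg\<^esub> p"

text \<open>The subalgebra \<open>\<U>\<^sub>q\<^sub>,\<^sub>J\<close> for \<open>J = [c,d]\<close>. Including the scalars among the generators turns the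
  generated subring into the generated \<open>\<complex>\<close>-subalgebra.\<close>

definition Uq_J :: "complex \<Rightarrow> int \<Rightarrow> int \<Rightarrow> falg set set" where
  "Uq_J t c d = generate_ring (Uq t) (cls t `
     ({scal z | z. True}
      \<union> {gn (X \<epsilon> i r) | \<epsilon> i r. i \<in> {c..d}}
      \<union> {gn (H i m) | i m. i \<in> {c..d} \<and> m \<noteq> 0}
      \<union> {gn (K h) | h. Poly_Mapping.keys h \<subseteq> {c..d}}))"


section \<open>Modules\<close>

text \<open>A module is a subspace \<open>V\<close> of an ambient complex vector space with scalar multiplication \<open>sc\<close>,
  on which the algebra acts through \<open>act\<close>.\<close>

definition uq_module ::
  "complex \<Rightarrow> (complex \<Rightarrow> 'v::ab_group_add \<Rightarrow> 'v) \<Rightarrow> 'v set \<Rightarrow> (falg set \<Rightarrow> 'v \<Rightarrow> 'v) \<Rightarrow> bool" where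
  "uq_module t sc V act \<longleftrightarrow>
     vector_space sc \<and> Modules.module.subspace sc V \<and>
     (\<forall>u\<in>carrier (Uq t). \<forall>v\<in>V. act u v \<in> V) \<and>
     (\<forall>u\<in>carrier (Uq t). \<forall>v\<in>V. \<forall>w\<in>V. act u (v + w) = act u v + act u w) \<and>
     (\<forall>u\<in>carrier (Uq t). \<forall>u'\<in>carrier (Uq t). \<forall>v\<in>V.
        act (u \<oplus>\<^bsub>Uq t\<^esub> u') v = act u v + act u' v \<and>
        act (u \<otimes>\<^bsub>Uq t\<^esub> u') v = act u (act u' v)) \<and>
     (\<forall>c. \<forall>v\<in>V. act (cls t (scal c)) v = sc c v)"

definition irreducible_module ::
  "complex \<Rightarrow> (complex \<Rightarrow> 'v::ab_group_add \<Rightarrow> 'v) \<Rightarrow> 'v set \<Rightarrow> (falg set \<Rightarrow> 'v \<Rightarrow> 'v) \<Rightarrow> bool" where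
  "irreducible_module t sc V act \<longleftrightarrow>
     uq_module t sc V act \<and> V \<noteq> {0} \<and>
     (\<forall>W. W \<subseteq> V \<and> uq_module t sc W act \<longrightarrow> W = {0} \<or> W = V)"

text \<open>A weight \<open>\<nu>\<close> in the lattice \<open>P\<close> is encoded by its coordinates: \<open>Poly_Mapping.lookup \<nu> i = \<nu>(h\<^sub>i)\<close>.\<close>

definition weight_space ::
  "complex \<Rightarrow> (complex \<Rightarrow> 'v::ab_group_add \<Rightarrow> 'v) \<Rightarrow> 'v set \<Rightarrow> (falg set \<Rightarrow> 'v \<Rightarrow> 'v) \<Rightarrow>
   (int \<Rightarrow>\<^sub>0 int) \<Rightarrow> 'v set" where
  "weight_space t sc V act \<nu> =
     {v \<in> V. \<forall>i. act (cls t (gn (K (Poly_Mapping.single i 1)))) v = sc (exp t powi Poly_Mapping.lookup \<nu> i) v}"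

definition integrable ::
  "complex \<Rightarrow> (complex \<Rightarrow> 'v::ab_group_add \<Rightarrow> 'v) \<Rightarrow> 'v set \<Rightarrow> (falg set \<Rightarrow> 'v \<Rightarrow> 'v) \<Rightarrow> bool" where
  "integrable t sc V act \<longleftrightarrow>
     uq_module t sc V act \<and>
     (\<forall>v\<in>V. \<exists>!f :: (int \<Rightarrow>\<^sub>0 int) \<Rightarrow>\<^sub>0 'v.
        (\<forall>\<nu>. Poly_Mapping.lookup f \<nu> \<in> weight_space t sc V act \<nu>) \<and> v = (\<Sum>\<nu>\<in>Poly_Mapping.keys f. Poly_Mapping.lookup f \<nu>)) \<and>
     (\<forall>\<epsilon> i. \<forall>v\<in>V. \<exists>n. (act (cls t (gn (X \<epsilon> i 0))) ^^ n) v = 0)"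

definition qfact :: "complex \<Rightarrow> nat \<Rightarrow> complex" where
  "qfact t n = (\<Prod>s=1..n. (exp t powi int s - exp t powi (- int s)) / (exp t - inverse (exp t)))"

definition divided_power ::
  "complex \<Rightarrow> (complex \<Rightarrow> 'v::ab_group_add \<Rightarrow> 'v) \<Rightarrow> (falg set \<Rightarrow> 'v \<Rightarrow> 'v) \<Rightarrow> sgn \<Rightarrow> int \<Rightarrow> nat \<Rightarrow> 'v \<Rightarrow> 'v" where
  "divided_power t sc act \<epsilon> i n v =
     sc (inverse (qfact t n)) ((act (cls t (gn (X \<epsilon> i 0))) ^^ n) v)"

definition i_extremal ::
  "complex \<Rightarrow> (falg set \<Rightarrow> 'v::ab_group_add \<Rightarrow> 'v) \<Rightarrow> int \<Rightarrow> 'v \<Rightarrow> bool" where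
  "i_extremal t act i v \<longleftrightarrow>
     act (cls t (gn (X Pos i 0))) v = 0 \<or> act (cls t (gn (X Neg i 0))) v = 0"

text \<open>
  The vectors \<open>S\<^bsub>i1\<^esub> \<cdots> S\<^bsub>il\<^esub> v\<close>. For a nonzero weight vector of an integrable module,
  \<open>x\<^sup>+\<^bsub>i,0\<^esub> w = 0\<close> forces \<open>\<lambda>(h\<^sub>i) \<ge> 0\<close> and \<open>x\<^sup>-\<^bsub>i,0\<^esub> w = 0\<close> forces \<open>\<lambda>(h\<^sub>i) \<le> 0\<close>, so \<open>nat\<close> truncates nothing,
  and the two rules agree when both apply.
\<close>

inductive_set S_orbit ::
  "complex \<Rightarrow> (complex \<Rightarrow> 'v::ab_group_add \<Rightarrow> 'v) \<Rightarrow> 'v set \<Rightarrow> (falg set \<Rightarrow> 'v \<Rightarrow> 'v) \<Rightarrow> 'v \<Rightarrow> 'v set"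
  for t sc V act v where
  base: "v \<in> S_orbit t sc V act v"
| S_highest: "w \<in> S_orbit t sc V act v \<Longrightarrow> w \<in> weight_space t sc V act \<nu> \<Longrightarrow>
    act (cls t (gn (X Pos i 0))) w = 0 \<Longrightarrow>
    divided_power t sc act Neg i (nat (Poly_Mapping.lookup \<nu> i)) w \<in> S_orbit t sc V act v"
| S_lowest: "w \<in> S_orbit t sc V act v \<Longrightarrow> w \<in> weight_space t sc V act \<nu> \<Longrightarrow>
    act (cls t (gn (X Neg i 0))) w = 0 \<Longrightarrow>
    divided_power t sc act Pos i (nat (- Poly_Mapping.lookup \<nu> i)) w \<in> S_orbit t sc V act v"

text \<open>Extremality only involves the elements \<open>x\<^sup>\<plusminus>\<^bsub>i,0\<^esub>\<close> and \<open>k\<^bsub>h\<^esub>\<close>, that is, the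
  horizontal subalgebra \<open>\<U>\<^sub>q\<^sup>h\<close>.\<close>

definition extremal ::
  "complex \<Rightarrow> (complex \<Rightarrow> 'v::ab_group_add \<Rightarrow> 'v) \<Rightarrow> 'v set \<Rightarrow> (falg set \<Rightarrow> 'v \<Rightarrow> 'v) \<Rightarrow> 'v \<Rightarrow> bool" where
  "extremal t sc V act v \<longleftrightarrow>
     (\<exists>\<nu>. v \<in> weight_space t sc V act \<nu>) \<and>
     (\<forall>w\<in>S_orbit t sc V act v. \<forall>i. i_extremal t act i w)"


section \<open>Rational functions and their expansions\<close>

type_synonym ratfun = "complex poly fract"

text \<open>\<open>psi t c\<close> is the rational function \<open>z \<mapsto> \<psi>(c z) = (q - q\<^sup>-\<^sup>1 c z) / (1 - c z)\<close>.\<close>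

definition psi :: "complex \<Rightarrow> complex \<Rightarrow> ratfun" where
  "psi t c = Fract [:exp t, - (inverse (exp t) * c):] [:1, - c:]"

text \<open>The value at \<open>x\<close> of a rational function in lowest terms; junk at a pole.\<close>

definition rat_eval :: "ratfun \<Rightarrow> complex \<Rightarrow> complex" where
  "rat_eval f x = (let (n, d) = quot_of_fract f in poly n x / poly d x)"

text \<open>
  \<open>expansion Pos f\<close> is the expansion of \<open>f\<close> in powers of \<open>z\<close>, for \<open>f\<close> regular at \<open>0\<close>, and
  \<open>expansion Neg f\<close> its expansion in powers of \<open>z\<^sup>-\<^sup>1\<close>, for \<open>f\<close> regular at \<open>\<infinity>\<close>. The latter is the
  expansion at \<open>y = 0\<close> of \<open>f(1/y) = y\<^bsup>deg d - deg n\<^esup> (y\<^bsup>deg n\<^esup> n(1/y)) / (y\<^bsup>deg d\<^esup> d(1/y))\<close>.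
\<close>

fun expansion :: "sgn \<Rightarrow> ratfun \<Rightarrow> complex fps" where
  "expansion Pos f = (let (n, d) = quot_of_fract f in fps_of_poly n / fps_of_poly d)"
| "expansion Neg f = (let (n, d) = quot_of_fract f in
     fps_X ^ (degree d - degree n) * fps_of_poly (reflect_poly n) / fps_of_poly (reflect_poly d))"


section \<open>Extremal loop weight modules\<close>

text \<open>Laurent monomials in the variables \<open>Y\<^bsub>i,b\<^esub>\<close>, written additively through their exponents.\<close>

type_synonym monomial = "(int \<times> complex) \<Rightarrow>\<^sub>0 int"

definition Y :: "int \<Rightarrow> complex \<Rightarrow> monomial" where
  "Y i b = Poly_Mapping.single (i, b) 1"

definition monomial_ratfun :: "complex \<Rightarrow> monomial \<Rightarrow> int \<Rightarrow> ratfun" where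
  "monomial_ratfun t m i =
     (\<Prod>b | (i, b) \<in> Poly_Mapping.keys m. psi t (b * exp t) powi Poly_Mapping.lookup m (i, b))"

definition l_weight_space ::
  "complex \<Rightarrow> (complex \<Rightarrow> 'v::ab_group_add \<Rightarrow> 'v) \<Rightarrow> 'v set \<Rightarrow> (falg set \<Rightarrow> 'v \<Rightarrow> 'v) \<Rightarrow>
   monomial \<Rightarrow> 'v set" where
  "l_weight_space t sc V act m =
     {v \<in> V. \<exists>p. \<forall>\<epsilon> i n.
        ((\<lambda>w. act (cls t (phi t \<epsilon> i (sg \<epsilon> * int n))) w
               - sc (fps_nth (expansion \<epsilon> (monomial_ratfun t m i)) n) w) ^^ p) v = 0}"

definition finite_dimensional :: "(complex \<Rightarrow> 'v::ab_group_add \<Rightarrow> 'v) \<Rightarrow> 'v set \<Rightarrow> bool" where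
  "finite_dimensional sc W \<longleftrightarrow> (\<exists>B. finite B \<and> W = Modules.module.span sc B)"

definition extremal_loop_weight_module ::
  "complex \<Rightarrow> (complex \<Rightarrow> 'v::ab_group_add \<Rightarrow> 'v) \<Rightarrow> 'v set \<Rightarrow> (falg set \<Rightarrow> 'v \<Rightarrow> 'v) \<Rightarrow>
   monomial \<Rightarrow> bool" where
  "extremal_loop_weight_module t sc V act m \<longleftrightarrow>
     integrable t sc V act \<and>
     (\<exists>v\<in>l_weight_space t sc V act m.
        (\<lambda>u. act u v) ` carrier (Uq t) = V \<and>
        extremal t sc V act v \<and>
        (\<forall>w\<in>V. \<forall>c d. finite_dimensional sc ((\<lambda>u. act u w) ` Uq_J t c d)))"


section \<open>Tensor products of vector representations\<close>

text \<open>
  The tensor product of the vector representations \<open>V(1\<^sub>b)\<close>, \<open>b\<close> in a list \<open>bs\<close>, has as basis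
  the lists \<open>js\<close> with \<open>length js = length bs\<close>, where \<open>js\<close> stands for the tensor product of the boxes
  \<open>js ! p\<close> with parameter \<open>bs ! p\<close>.
\<close>

type_synonym tensor = "int list \<Rightarrow>\<^sub>0 complex"

definition tscale :: "complex \<Rightarrow> tensor \<Rightarrow> tensor" where
  "tscale c v = Poly_Mapping.map ((*) c) v"

definition boxes :: "int list \<Rightarrow> tensor" where
  "boxes js = Poly_Mapping.single js 1"

definition box_phi :: "complex \<Rightarrow> int \<Rightarrow> complex \<times> int \<Rightarrow> ratfun" where
  "box_phi t i = (\<lambda>(b, j).
     if i = j then psi t (b * exp t powi j)
     else if i = j - 1 then inverse (psi t (b * exp t powi (j + 1)))
     else 1)"

definition tensor_phi :: "complex \<Rightarrow> complex list \<Rightarrow> int \<Rightarrow> int list \<Rightarrow> ratfun" where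
  "tensor_phi t bs i js = prod_list (map (box_phi t i) (zip bs js))"

text \<open>
  The coefficient of \<open>z\<^sup>r\<close> of the action of \<open>x\<^sub>i\<^sup>\<plusminus>(z)\<close> on a basis vector. In the vector representation
  of parameter \<open>b\<close>, \<open>x\<^sub>i\<^sup>+(z)\<close> sends the box \<open>i + 1\<close> to \<open>\<delta>(b q\<^sup>i z)\<close> times the box \<open>i\<close>, and \<open>x\<^sub>i\<^sup>-(z)\<close>
  sends the box \<open>i\<close> to \<open>\<delta>(b q\<^sup>i z)\<close> times the box \<open>i + 1\<close>. The product \<open>f(z) \<delta>(c z) = f(c\<^sup>-\<^sup>1) \<delta>(c z)\<close> has
  \<open>f(c\<^sup>-\<^sup>1) c\<^sup>r\<close> as coefficient of \<open>z\<^sup>r\<close>.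
\<close>

fun tensor_x :: "complex \<Rightarrow> complex list \<Rightarrow> sgn \<Rightarrow> int \<Rightarrow> int \<Rightarrow> int list \<Rightarrow> tensor" where
  "tensor_x t bs Pos i r js =
     (\<Sum>p<length bs. if js ! p = i + 1
        then (let c = bs ! p * exp t powi i in
          tscale (rat_eval (tensor_phi t (take p bs) i (take p js)) (inverse c) * c powi r)
            (boxes (js[p := i])))
        else 0)"
| "tensor_x t bs Neg i r js =
     (\<Sum>p<length bs. if js ! p = i
        then (let c = bs ! p * exp t powi i in
          tscale (rat_eval (tensor_phi t (drop (Suc p) bs) i (drop (Suc p) js)) (inverse c) * c powi r)
            (boxes (js[p := i + 1])))
        else 0)"

text \<open>The value at \<open>h\<close> of the weight of a basis vector; the box \<open>j\<close> has weight \<open>\<Lambda>\<^sub>j - \<Lambda>\<^bsub>j-1\<^esub>\<close>.\<close>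

definition tensor_weight :: "int list \<Rightarrow> cartan \<Rightarrow> rat" where
  "tensor_weight js h = (\<Sum>j\<leftarrow>js. Poly_Mapping.lookup h j - Poly_Mapping.lookup h (j - 1))"

text \<open>
  \<open>act\<close> is given on the basis vectors \<open>js \<in> B\<close> by the iterated Drinfeld coproduct. For a module
  this determines \<open>act\<close> on the span of these vectors: the action of the \<open>h\<^bsub>i,m\<^esub>\<close> is recovered from
  that of the coefficients of the \<open>\<phi>\<^sub>i\<^sup>\<plusminus>(z)\<close>, since \<open>q \<noteq> q\<^sup>-\<^sup>1\<close>.
\<close>

definition acts_by_coproduct ::
  "complex \<Rightarrow> complex list \<Rightarrow> int list set \<Rightarrow> (falg set \<Rightarrow> tensor \<Rightarrow> tensor) \<Rightarrow> bool" where
  "acts_by_coproduct t bs B act \<longleftrightarrow>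
     (\<forall>js\<in>B.
        (\<forall>\<epsilon> i r. act (cls t (gn (X \<epsilon> i r))) (boxes js) = tensor_x t bs \<epsilon> i r js) \<and>
        (\<forall>\<epsilon> i n. act (cls t (phi t \<epsilon> i (sg \<epsilon> * int n))) (boxes js)
                  = tscale (fps_nth (expansion \<epsilon> (tensor_phi t bs i js)) n) (boxes js)) \<and>
        (\<forall>h. act (cls t (gn (K h))) (boxes js) = tscale (qpow t (tensor_weight js h)) (boxes js)))"


section \<open>The module \<open>V(T\<^sup>e\<^sub>a)\<close>\<close>

definition tableaux :: "nat \<Rightarrow> nat \<Rightarrow> (nat \<Rightarrow> nat \<Rightarrow> int) set" where
  "tableaux l k = {T.
     (\<forall>i\<in>{1..l}. \<forall>j\<in>{1..k}. \<forall>j'\<in>{1..k}. j \<le> j' \<longrightarrow> T i j \<le> T i j') \<and>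
     (\<forall>i\<in>{1..l}. \<forall>i'\<in>{1..l}. \<forall>j\<in>{1..k}. i < i' \<longrightarrow> T i j < T i' j)}"

text \<open>The entries of an array in the reading order: columns from left to right, each from top to
  bottom.\<close>

definition reading :: "nat \<Rightarrow> nat \<Rightarrow> (nat \<Rightarrow> nat \<Rightarrow> 'a) \<Rightarrow> 'a list" where
  "reading l k T = concat (map (\<lambda>j. map (\<lambda>i. T i j) [1..<Suc l]) [1..<Suc k])"

definition box_params :: "complex \<Rightarrow> nat \<Rightarrow> nat \<Rightarrow> complex \<Rightarrow> complex list" where
  "box_params t l k a = reading l k (\<lambda>i j. a * exp t powi (- 2 * (int i - int j)))"

definition V_Te :: "nat \<Rightarrow> nat \<Rightarrow> tensor set" where
  "V_Te l k = Modules.module.span tscale ((\<lambda>T. boxes (reading l k T)) ` tableaux l k)"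

definition m_Te :: "complex \<Rightarrow> nat \<Rightarrow> nat \<Rightarrow> complex \<Rightarrow> monomial" where
  "m_Te t l k a =
     (\<Sum>s<k. Y (int l) (a * exp t powi (- int l + 1 + 2 * int s)))
     - (\<Sum>s<k. Y 0 (a * exp t powi (1 + 2 * int s)))"

end

theory Submission
  imports Defs
begin

text \<open>
  On the basis of tableaux, \<open>x\<^sub>i\<^sup>\<plusminus>(z)\<close> is a sum of moves of single boxes, each multiplied by a \<open>\<delta>\<close>-function supported
  at a point that depends on \<open>i\<close> and the content of the box only. The coefficient of a move is a product of values
  of \<open>\<psi>\<close> over the boxes on one side of the moving box. A pole of a factor comes from a box on the same diagonal, and it
  is always accompanied by zeros at two neighbouring boxes; hence the product may be computed with \<open>1/0 = 0\<close>, and it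
  vanishes exactly if the move leaves the set of tableaux. The relations between the \<open>x\<^sub>i\<^sup>\<plusminus>(z)\<close> then reduce
  to identities between the factors contributed by pairs of moving boxes, and the
  commutator of \<open>x\<^sub>i\<^sup>+(z)\<close> and \<open>x\<^sub>i\<^sup>-(w)\<close> is the partial fraction decomposition of \<open>\<phi>\<^sub>i\<close>.

  Since the supports of the \<open>\<delta>\<close>-functions separate the diagonals, a submodule is stable under the moves of
  given colour on a given diagonal. A word of such moves that lowers a maximal tableau of the support of a vector far
  enough kills all other tableaux in the support; so the submodule contains a tableau, and moves connect all tableaux.
  The vectors \<open>S\<^bsub>i1\<^esub> \<cdots> S\<^bsub>il\<^esub> T\<^sup>e\<close> are multiples of tableaux with constant rows, and these are
  \<open>i\<close>-extremal.
\<close>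

section \<open>Linear extension of maps on basis vectors\<close>

text \<open>The tensor product of the vector representations is not itself a module: on an arbitrary
  list a coefficient may have an uncancelled pole at the support of its delta-function. So there is
  nothing to restrict from, and the action is built on the free algebra. Every generator receives an
  operator on all lists, even where the coefficients are meaningless, and the relators are shown to
  vanish on the span of the readings only. An intermediate list in a product of moves may leave the
  tableaux; each relation is therefore an identity of coefficients in which only the list at the
  start is assumed to be a reading.

  The coproduct prescribes the \<open>phi\<close> and not the \<open>H i m\<close>. The latter are
  defined by a logarithm of the expanded eigenvalue, so that the exponential series of the
  presentation returns this expansion.

  The locale \<open>box_config\<close> isolates what is needed of tableaux: growth along diagonals,
  the squares that accompany a pole, the criterion for a move to stay in the set, and paths of
  moves. The rectangle reappears only in the axioms of the locale, the extremal vectors and the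
  l-weight.\<close>

lemma lookup_tscale [simp]: "Poly_Mapping.lookup (tscale c v) x = c * Poly_Mapping.lookup v x"
  unfolding tscale_def by (simp add: Poly_Mapping.map.rep_eq when_def)

interpretation tensor: vector_space tscale
  by unfold_locales (auto intro!: poly_mapping_eqI simp: lookup_add algebra_simps)

definition lin :: "(int list \<Rightarrow> tensor) \<Rightarrow> tensor \<Rightarrow> tensor" where
  "lin F v = (\<Sum>x\<in>Poly_Mapping.keys v. tscale (Poly_Mapping.lookup v x) (F x))"

lemma lin_superset:
  assumes "finite A" "Poly_Mapping.keys v \<subseteq> A"
  shows "lin F v = (\<Sum>x\<in>A. tscale (Poly_Mapping.lookup v x) (F x))"
  unfolding lin_def
  by (rule sum.mono_neutral_left) (use assms in \<open>auto simp: in_keys_iff\<close>)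

lemma lin_add: "lin F (v + w) = lin F v + lin F w"
proof -
  let ?A = "Poly_Mapping.keys v \<union> Poly_Mapping.keys w"
  have "lin F (v + w) = (\<Sum>x\<in>?A. tscale (Poly_Mapping.lookup (v + w) x) (F x))"
    by (rule lin_superset) (use keys_add[of v w] in auto)
  then show ?thesis
    by (simp add: lin_superset[of ?A] lookup_add tensor.scale_left_distrib sum.distrib)
qed

lemma lin_scale: "lin F (tscale c v) = tscale c (lin F v)"
proof -
  have "lin F (tscale c v)
      = (\<Sum>x\<in>Poly_Mapping.keys v. tscale (Poly_Mapping.lookup (tscale c v) x) (F x))"
    by (rule lin_superset) (auto simp: in_keys_iff)
  then show ?thesis
    by (simp add: lin_def tensor.scale_sum_right)
qed

lemma lin_zero [simp]: "lin F 0 = 0"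
  by (simp add: lin_def)

lemma lin_sum: "lin F (sum g A) = (\<Sum>x\<in>A. lin F (g x))"
  by (induction A rule: infinite_finite_induct) (auto simp: lin_add)

lemma lin_boxes [simp]: "lin F (boxes x) = F x"
  by (simp add: lin_def boxes_def)

lemma lookup_boxes: "Poly_Mapping.lookup (boxes x) y = (if x = y then 1 else 0)"
  by (simp add: boxes_def lookup_single)

lemma boxes_nonzero [simp]: "boxes x \<noteq> 0"
  by (metis lookup_boxes lookup_zero zero_neq_one)

lemma lin_boxes_id: "lin boxes v = v"
  by (rule poly_mapping_eqI)
    (simp add: lin_def lookup_sum lookup_boxes in_keys_iff if_distrib cong: if_cong)

lemma lin_cong: "(\<And>x. x \<in> Poly_Mapping.keys v \<Longrightarrow> F x = G x) \<Longrightarrow> lin F v = lin G v"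
  by (simp add: lin_def)

lemma lin_fun_add: "lin (\<lambda>x. F x + G x) v = lin F v + lin G v"
  by (simp add: lin_def tensor.scale_right_distrib sum.distrib)

lemma lin_fun_zero: "lin (\<lambda>x. 0) v = 0"
  by (simp add: lin_def)

lemma lin_fun_scale: "lin (\<lambda>x. tscale c (F x)) v = tscale c (lin F v)"
  by (simp add: lin_def tensor.scale_sum_right mult.commute)

lemma lin_fun_sum: "lin (\<lambda>x. \<Sum>p\<in>A. F p x) v = (\<Sum>p\<in>A. lin (F p) v)"
  by (induction A rule: infinite_finite_induct) (simp_all add: lin_fun_zero lin_fun_add)

section \<open>Representations of the free algebra\<close>

definition word_op :: "(gen \<Rightarrow> int list \<Rightarrow> tensor) \<Rightarrow> gword \<Rightarrow> tensor \<Rightarrow> tensor" where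
  "word_op G w = foldr (\<lambda>g. lin (G g)) (letters w)"

definition rho :: "(gen \<Rightarrow> int list \<Rightarrow> tensor) \<Rightarrow> falg \<Rightarrow> tensor \<Rightarrow> tensor" where
  "rho G p v = (\<Sum>w\<in>Poly_Mapping.keys p. tscale (Poly_Mapping.lookup p w) (word_op G w v))"

lemma word_op_zero [simp]: "word_op G 0 v = v"
  by (simp add: word_op_def zero_gword_def)

lemma word_op_plus: "word_op G (u + w) v = word_op G u (word_op G w v)"
  by (simp add: word_op_def plus_gword_def)

lemma word_op_add: "word_op G w (u + v) = word_op G w u + word_op G w v"
proof -
  have "foldr (\<lambda>g. lin (G g)) xs (u + v)
      = foldr (\<lambda>g. lin (G g)) xs u + foldr (\<lambda>g. lin (G g)) xs v" for xs
    by (induction xs) (auto simp: lin_add)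
  then show ?thesis by (simp add: word_op_def)
qed

lemma word_op_scale: "word_op G w (tscale c v) = tscale c (word_op G w v)"
proof -
  have "foldr (\<lambda>g. lin (G g)) xs (tscale c v) = tscale c (foldr (\<lambda>g. lin (G g)) xs v)" for xs
    by (induction xs) (auto simp: lin_scale)
  then show ?thesis by (simp add: word_op_def)
qed

lemma rho_superset:
  assumes "finite A" "Poly_Mapping.keys p \<subseteq> A"
  shows "rho G p v = (\<Sum>w\<in>A. tscale (Poly_Mapping.lookup p w) (word_op G w v))"
  unfolding rho_def
  by (rule sum.mono_neutral_left) (use assms in \<open>auto simp: in_keys_iff\<close>)

lemma rho_add: "rho G (p + p') v = rho G p v + rho G p' v"
proof -
  let ?A = "Poly_Mapping.keys p \<union> Poly_Mapping.keys p'"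
  have "rho G (p + p') v = (\<Sum>x\<in>?A. tscale (Poly_Mapping.lookup (p + p') x) (word_op G x v))"
    by (rule rho_superset) (use keys_add[of p p'] in auto)
  then show ?thesis
    by (simp add: rho_superset[of ?A] lookup_add tensor.scale_left_distrib sum.distrib)
qed

lemma rho_zero [simp]: "rho G 0 v = 0"
  by (simp add: rho_def)

lemma rho_uminus: "rho G (- p) v = - rho G p v"
  using rho_add[of G p "- p" v] by (simp add: eq_neg_iff_add_eq_0 add.commute)

lemma rho_diff: "rho G (p - p') v = rho G p v - rho G p' v"
  using rho_add[of G p "- p'" v] by (simp add: rho_uminus)

lemma rho_sum: "rho G (sum g A) v = (\<Sum>x\<in>A. rho G (g x) v)"
  by (induction A rule: infinite_finite_induct) (auto simp: rho_add)

lemma rho_single: "rho G (Poly_Mapping.single w c) v = tscale c (word_op G w v)"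
  by (simp add: rho_def)

lemma rho_scal [simp]: "rho G (scal c) v = tscale c v"
  by (simp add: scal_def rho_single)

lemma rho_one [simp]: "rho G 1 v = v"
  using rho_scal[of G 1 v] by (simp add: scal_def)

lemma rho_gn [simp]: "rho G (gn g) v = lin (G g) v"
  by (simp add: gn_def rho_single word_op_def)

lemma rho_add_right: "rho G p (u + v) = rho G p u + rho G p v"
  by (simp add: rho_def word_op_add tensor.scale_right_distrib sum.distrib)

lemma rho_scale_right: "rho G p (tscale c v) = tscale c (rho G p v)"
  by (simp add: rho_def word_op_scale tensor.scale_sum_right mult.commute)

lemma rho_zero_right [simp]: "rho G p 0 = 0"
  using rho_scale_right[of G p 0 0] by simp

lemma rho_sum_right: "rho G p (sum g A) = (\<Sum>x\<in>A. rho G p (g x))"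
  by (induction A rule: infinite_finite_induct) (auto simp: rho_add_right)

lemma rho_lin: "rho G p v = lin (\<lambda>x. rho G p (boxes x)) v"
proof -
  have "rho G p v = rho G p (lin boxes v)" by (simp add: lin_boxes_id)
  then show ?thesis by (simp add: lin_def rho_sum_right rho_scale_right)
qed

text \<open>Zero needs no case of its own, being \<open>single k 0\<close> for any \<open>k\<close>.
  For the free algebra this reduces additive statements to multiples of single words.\<close>

lemma poly_mapping_single_induct [case_names single add]:
  assumes single: "\<And>k c. P (Poly_Mapping.single k c)"
    and add: "\<And>p q. P p \<Longrightarrow> P q \<Longrightarrow> P (p + q)"
  shows "P (p :: 'a \<Rightarrow>\<^sub>0 'b::comm_monoid_add)"
proof -
  have "p = (\<Sum>k\<in>Poly_Mapping.keys p. Poly_Mapping.single k (Poly_Mapping.lookup p k))"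
    by (rule poly_mapping_eqI) (auto simp: lookup_sum lookup_single when_def in_keys_iff)
  moreover have "P (\<Sum>k\<in>A. Poly_Mapping.single k (Poly_Mapping.lookup p k))" if "finite A" for A
    using that
  proof (induction A)
    case empty
    show ?case using single[of undefined 0] by simp
  qed (simp add: single add)
  ultimately show ?thesis by (metis finite_keys)
qed

text \<open>Both sides are biadditive, and on two words the convolution product is concatenation,
  which \<open>word_op\<close> turns into composition.\<close>

lemma rho_mult: "rho G (p * p') v = rho G p (rho G p' v)"
proof (induction p rule: poly_mapping_single_induct)
  case (single k c)
  show ?case
    by (induction p' rule: poly_mapping_single_induct)
      (simp_all add: mult_single rho_single word_op_plus word_op_scale distrib_left rho_add rho_add_right)
qed (simp add: distrib_right rho_add)

section \<open>From representations of the free algebra to modules\<close>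

lemma ring_free_alg: "ring free_alg"
proof (rule ringI)
  show "abelian_group free_alg"
  proof (rule abelian_groupI)
    show "\<And>x. x \<in> carrier free_alg \<Longrightarrow> \<exists>y\<in>carrier free_alg. y \<oplus>\<^bsub>free_alg\<^esub> x = \<zero>\<^bsub>free_alg\<^esub>"
      by (auto simp: free_alg_def intro: left_minus)
  qed (auto simp: free_alg_def algebra_simps)
  show "monoid free_alg"
    by (rule monoidI) (auto simp: free_alg_def algebra_simps)
qed (auto simp: free_alg_def algebra_simps)

lemma free_alg_simps [simp]:
  "carrier free_alg = UNIV" "x \<otimes>\<^bsub>free_alg\<^esub> y = x * y" "\<one>\<^bsub>free_alg\<^esub> = 1"
  "\<zero>\<^bsub>free_alg\<^esub> = 0" "x \<oplus>\<^bsub>free_alg\<^esub> y = x + y"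
  by (simp_all add: free_alg_def)

lemma ideal_rel_ideal: "ideal (rel_ideal t) free_alg"
  unfolding rel_ideal_def by (rule ring.genideal_ideal[OF ring_free_alg]) simp

lemma Uq_simps:
  "carrier (Uq t) = range (cls t)"
  "cls t p \<otimes>\<^bsub>Uq t\<^esub> cls t p' = cls t (p * p')"
  "cls t p \<oplus>\<^bsub>Uq t\<^esub> cls t p' = cls t (p + p')"
  "\<one>\<^bsub>Uq t\<^esub> = cls t 1"
proof -
  interpret I: ideal "rel_ideal t" free_alg by (rule ideal_rel_ideal)
  show "carrier (Uq t) = range (cls t)"
    by (auto simp: Uq_def FactRing_def A_RCOSETS_def' cls_def)
  show "cls t p \<otimes>\<^bsub>Uq t\<^esub> cls t p' = cls t (p * p')"
    using I.rcoset_mult_add[of p p'] by (simp add: Uq_def FactRing_def cls_def)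
  show "cls t p \<oplus>\<^bsub>Uq t\<^esub> cls t p' = cls t (p + p')"
    using I.a_rcos_sum[of p p'] by (simp add: Uq_def FactRing_def cls_def)
  show "\<one>\<^bsub>Uq t\<^esub> = cls t 1"
    by (simp add: Uq_def FactRing_def cls_def)
qed

lemma ring_Uq: "ring (Uq t)"
  unfolding Uq_def by (rule ideal.quotient_is_ring[OF ideal_rel_ideal])

lemma Uq_a_inv: "\<ominus>\<^bsub>Uq t\<^esub> cls t p = cls t (- p)"
proof -
  interpret U: ring "Uq t" by (rule ring_Uq)
  have z: "\<zero>\<^bsub>Uq t\<^esub> = cls t 0"
    by (metis U.add.l_cancel_one Uq_simps(1,3) add.right_neutral rangeI)
  show ?thesis
    by (rule U.minus_equality) (auto simp: Uq_simps z)
qed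

lemma cls_eqD: "cls t p = cls t p' \<Longrightarrow> p - p' \<in> rel_ideal t"
proof -
  assume *: "cls t p = cls t p'"
  interpret I: ideal "rel_ideal t" free_alg by (rule ideal_rel_ideal)
  have "p \<in> cls t p'"
    using I.a_rcos_self[of p] * by (simp add: cls_def)
  then obtain h where "h \<in> rel_ideal t" "p = h + p'"
    by (auto simp: cls_def a_r_coset_def' )
  then show ?thesis by simp
qed

text \<open>The relations are demanded on \<open>V\<close> alone; what the operators do to vectors
  outside \<open>V\<close> is left open.\<close>

locale relator_killing =
  fixes t :: complex and G :: "gen \<Rightarrow> int list \<Rightarrow> tensor" and V :: "tensor set"
  assumes subspace_V: "tensor.subspace V"
    and G_V: "\<And>g v. v \<in> V \<Longrightarrow> lin (G g) v \<in> V"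
    and rel: "\<And>p v. p \<in> relators t \<Longrightarrow> v \<in> V \<Longrightarrow> rho G p v = 0"
begin

lemma rho_V: "v \<in> V \<Longrightarrow> rho G p v \<in> V"
proof (induction p rule: poly_mapping_single_induct)
  case (single k c)
  have "foldr (\<lambda>g. lin (G g)) xs v \<in> V" for xs
    by (induction xs) (auto simp: single G_V)
  then show ?case
    by (simp add: rho_single word_op_def tensor.subspace_scale[OF subspace_V])
qed (simp add: rho_add tensor.subspace_add[OF subspace_V])

text \<open>The annihilator of \<open>V\<close> is a two-sided ideal containing the relators.
  Closure under multiplication from the right is where the invariance of \<open>V\<close>
  enters.\<close>

lemma rho_rel_ideal:
  assumes "p \<in> rel_ideal t" "v \<in> V"
  shows "rho G p v = 0"
proof -
  let ?I = "{p. \<forall>v\<in>V. rho G p v = 0}"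
  have "ideal ?I free_alg"
  proof (rule idealI[OF ring_free_alg])
    show "subgroup ?I (add_monoid free_alg)"
    proof (rule subgroup.intro)
      fix x assume "x \<in> ?I"
      moreover have "inv\<^bsub>add_monoid free_alg\<^esub> x = - x"
        using abelian_group.minus_equality[OF ring.is_abelian_group[OF ring_free_alg], of "- x" x]
        by (simp add: a_inv_def)
      ultimately show "inv\<^bsub>add_monoid free_alg\<^esub> x \<in> ?I"
        by (simp add: rho_uminus)
    qed (auto simp: rho_add)
  qed (auto simp: rho_mult rho_V)
  then have "rel_ideal t \<subseteq> ?I"
    unfolding rel_ideal_def
    by (rule ring.genideal_minimal[OF ring_free_alg]) (auto simp: rel)
  then show ?thesis using assms by auto
qed

text \<open>On \<open>V\<close> the chosen representative of the class does not matter, by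
  \<open>rho_rel_ideal\<close>; outside \<open>V\<close> the value is arbitrary.\<close>

definition act :: "falg set \<Rightarrow> tensor \<Rightarrow> tensor" where
  "act u = rho G (SOME p. u = cls t p)"

lemma act_cls: "v \<in> V \<Longrightarrow> act (cls t p) v = rho G p v"
proof -
  assume v: "v \<in> V"
  have "cls t p = cls t (SOME p'. cls t p = cls t p')"
    by (rule someI_ex) auto
  then have "p - (SOME p'. cls t p = cls t p') \<in> rel_ideal t"
    by (rule cls_eqD)
  from rho_rel_ideal[OF this v] show ?thesis
    by (simp add: act_def rho_diff)
qed

lemma uq_module_subspaceI:
  assumes "tensor.subspace W" "W \<subseteq> V" "\<And>p v. v \<in> W \<Longrightarrow> rho G p v \<in> W"
  shows "uq_module t tscale W act"
  unfolding uq_module_def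
  using assms tensor.subspace_add[OF assms(1)]
  by (auto simp: tensor.vector_space_axioms Uq_simps act_cls rho_add rho_mult
      rho_add_right subset_iff rho_V)

lemma uq_module_V: "uq_module t tscale V act"
  by (rule uq_module_subspaceI) (auto simp: subspace_V rho_V)

end

section \<open>Configurations of boxes\<close>

fun src :: "sgn \<Rightarrow> int \<Rightarrow> int" where
  "src Pos i = i + 1"
| "src Neg i = i"

fun tgt :: "sgn \<Rightarrow> int \<Rightarrow> int" where
  "tgt Pos i = i"
| "tgt Neg i = i + 1"

text \<open>Selects the boxes \<open>r\<close> whose eigenvalue multiplies a move of
  \<open>p\<close>: the coproduct puts \<open>phi\<close> to the left of a raising operator and to
  the right of a lowering one.\<close>

fun bef :: "sgn \<Rightarrow> nat \<Rightarrow> nat \<Rightarrow> bool" where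
  "bef Pos r p \<longleftrightarrow> r < p"
| "bef Neg r p \<longleftrightarrow> p < r"

lemma src_neq_tgt [simp]: "src \<epsilon> i \<noteq> tgt \<epsilon> i" "tgt \<epsilon> i \<noteq> src \<epsilon> i"
  by (cases \<epsilon>; simp)+

lemma src_eq_iff [simp]: "src \<epsilon> i = src \<epsilon> j \<longleftrightarrow> i = j"
  by (cases \<epsilon>) auto

lemma bef_irrefl [simp]: "\<not> bef \<epsilon> p p"
  by (cases \<epsilon>) auto

lemma bef_antisym: "bef \<epsilon> p r \<Longrightarrow> \<not> bef \<epsilon> r p"
  by (cases \<epsilon>) auto

lemma bef_total: "p \<noteq> r \<Longrightarrow> bef \<epsilon> p r \<or> bef \<epsilon> r p"
  by (cases \<epsilon>) auto

text \<open>The value of psi at \<open>q^(2d)\<close>. Only even exponents occur, because box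
  parameters are \<open>a\<close> times even powers of \<open>q\<close> and the shifts by the colour
  cancel.\<close>

definition psi_val :: "complex \<Rightarrow> int \<Rightarrow> complex" where
  "psi_val t d = (exp t - inverse (exp t) * exp t powi (2 * d)) / (1 - exp t powi (2 * d))"

text \<open>The eigenvalue of \<open>\<phi>\<^sub>i(z)\<close> on a box of entry \<open>x\<close>, at the point \<open>z\<close> where the \<open>\<delta>\<close>-function of a box whose
  content is smaller by \<open>d\<close> is supported. At the pole \<open>d = 0\<close> the convention \<open>x / 0 = 0\<close> gives \<open>0\<close>.\<close>

definition fac :: "complex \<Rightarrow> int \<Rightarrow> int \<Rightarrow> int \<Rightarrow> complex" where
  "fac t i x d = (if x = i then psi_val t d else if x = i + 1 then psi_val t (- d) else 1)"

text \<open>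
  \<open>B\<close> is the set of readings of tableaux and \<open>kap p\<close> the content of the \<open>p\<close>-th box. The two boxes in the
  conclusion of \<open>B_square\<close> and the two excluded in \<open>B_move\<close> are neighbours in the same row or column.
\<close>

locale box_config =
  fixes t a :: complex and N :: nat and kap :: "nat \<Rightarrow> int" and B :: "int list set"
  assumes q_root: "\<And>n :: nat. n \<ge> 1 \<Longrightarrow> exp t ^ n \<noteq> 1"
    and a_nonzero: "a \<noteq> 0"
    and B_length: "js \<in> B \<Longrightarrow> length js = N"
    and B_diag: "js \<in> B \<Longrightarrow> p < r \<Longrightarrow> r < N \<Longrightarrow> kap p = kap r \<Longrightarrow> js ! p < js ! r"
    and B_square: "js \<in> B \<Longrightarrow> p < r \<Longrightarrow> r < N \<Longrightarrow> kap p = kap r \<Longrightarrow> js ! r = js ! p + 1 \<Longrightarrow>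
      (\<exists>s. p < s \<and> s < r \<and> js ! s = js ! p \<and> kap s = kap p + 1) \<and>
      (\<exists>s. p < s \<and> s < r \<and> js ! s = js ! r \<and> kap s = kap p - 1)"
    and B_move: "js \<in> B \<Longrightarrow> p < N \<Longrightarrow> js ! p = src \<epsilon> i \<Longrightarrow>
      js[p := tgt \<epsilon> i] \<in> B \<longleftrightarrow>
      \<not> (\<exists>r<N. bef \<epsilon> r p \<and> (js ! r = tgt \<epsilon> i \<and> sg \<epsilon> * (kap r - kap p) = 1 \<or>
                            js ! r = src \<epsilon> i \<and> sg \<epsilon> * (kap r - kap p) = -1))"
    and B_low: "\<exists>js\<in>B. \<forall>p<N. js ! p < m"
    and B_down: "js \<in> B \<Longrightarrow> js' \<in> B \<Longrightarrow> \<forall>p<N. js' ! p \<le> js ! p \<Longrightarrow> js' \<noteq> js \<Longrightarrow>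
      \<exists>p<N. js' ! p < js ! p \<and> js[p := js ! p - 1] \<in> B"
    and B_up: "js \<in> B \<Longrightarrow> js' \<in> B \<Longrightarrow> \<forall>p<N. js' ! p \<le> js ! p \<Longrightarrow> js' \<noteq> js \<Longrightarrow>
      \<exists>p<N. js' ! p < js ! p \<and> js'[p := js' ! p + 1] \<in> B"
begin

abbreviation q :: complex where "q \<equiv> exp t"

definition params :: "complex list" where
  "params = map (\<lambda>p. a * q powi (2 * kap p)) [0..<N]"

text \<open>The constant \<open>c\<close> of the delta-function \<open>\<delta>(c z)\<close> that
  comes with a move of colour \<open>i\<close> of the box \<open>p\<close>; the support is the point
  \<open>1/c\<close>.\<close>

definition spec :: "int \<Rightarrow> nat \<Rightarrow> complex" where
  "spec i p = a * q powi (2 * kap p + i)"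

lemma powi_eq_one_iff: "q powi m = 1 \<longleftrightarrow> m = 0"
proof (cases m)
  case (nonneg n)
  have "q powi m = q ^ n" by (simp only: nonneg power_int_of_nat)
  then show ?thesis using q_root[of n] nonneg by (cases "n = 0") auto
next
  case (neg n)
  have "q powi m = inverse (q ^ Suc n)" by (simp only: neg power_int_minus power_int_of_nat)
  then show ?thesis using q_root[of "Suc n"] neg by (auto simp del: power_Suc)
qed

lemma powi_eq_iff: "q powi m = q powi n \<longleftrightarrow> m = n"
proof -
  have "q powi m = q powi n \<longleftrightarrow> q powi (m - n) = 1"
    by (simp add: power_int_diff)
  then show ?thesis by (simp add: powi_eq_one_iff)
qed

lemma q_neq_inverse: "q - inverse q \<noteq> 0"
proof
  assume "q - inverse q = 0"
  then have "q * q = 1" by (simp add: field_simps)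
  with q_root[of 2] show False by (simp add: power2_eq_square)
qed

lemma spec_nonzero [simp]: "spec i p \<noteq> 0"
  using a_nonzero by (simp add: spec_def)

lemma spec_eq_iff: "spec i p = spec i r \<longleftrightarrow> kap p = kap r"
  using a_nonzero by (simp add: spec_def powi_eq_iff)

lemma psi_val_0 [simp]: "psi_val t 0 = 0"
  by (simp add: psi_val_def)

lemma psi_val_1 [simp]: "psi_val t 1 = 0"
  by (simp add: psi_val_def power2_eq_square)

lemma powi_2_neq_1: "d \<noteq> 0 \<Longrightarrow> 1 - q powi (2 * d) \<noteq> 0"
  using powi_eq_one_iff[of "2 * d"] by auto

text \<open>Only \<open>d = 1\<close> is a zero of the function. \<open>d = 0\<close> is its pole,
  counted as a zero by the convention for division.\<close>

lemma psi_val_eq_0_iff: "psi_val t d = 0 \<longleftrightarrow> d = 0 \<or> d = 1"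
proof (cases "d = 0")
  case False
  have "psi_val t d = 0 \<longleftrightarrow> q - inverse q * q powi (2 * d) = 0"
    unfolding psi_val_def using powi_2_neq_1[OF False] by simp
  also have "\<dots> \<longleftrightarrow> q powi (2 * d) = q powi 2"
    by (auto simp: field_simps power2_eq_square)
  also have "\<dots> \<longleftrightarrow> d = 1" by (simp only: powi_eq_iff) simp
  finally show ?thesis using False by simp
qed simp

text \<open>With \<open>w = q^(2d)\<close> the right-hand side is also
  \<open>1 / psi(q^2 w)\<close>, which is the eigenvalue of a box of entry \<open>i + 1\<close>;
  hence the argument \<open>- d\<close> in \<open>fac\<close>. At \<open>d = 0\<close> both sides
  are 0 by convention.\<close>

lemma psi_val_minus: "psi_val t (- d) = (inverse q - q * q powi (2 * d)) / (1 - q powi (2 * d))"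
proof (cases "d = 0")
  case False
  define w where "w = q powi (2 * d)"
  have w: "w \<noteq> 0" "1 - w \<noteq> 0" using powi_2_neq_1[OF False] by (auto simp: w_def)
  have "q powi (2 * - d) = inverse w"
    by (simp add: w_def flip: power_int_minus)
  then have "psi_val t (- d) = (q - inverse q * inverse w) / (1 - inverse w)"
    unfolding psi_val_def by (simp only:)
  also have "\<dots> = (inverse q - q * w) / (1 - w)"
    using w by (simp add: divide_simps) (simp add: algebra_simps)
  finally show ?thesis by (simp only: w_def)
qed simp

text \<open>Over the common denominator \<open>1 - w\<close>, with \<open>w = q^(2d)\<close>, the
  two numerators add up to \<open>(q + 1/q) (1 - w)\<close>.\<close>

lemma psi_val_add: "d \<noteq> 0 \<Longrightarrow> psi_val t d + psi_val t (- d) = q + inverse q"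
proof -
  assume "d \<noteq> 0"
  note w = powi_2_neq_1[OF this]
  show ?thesis
    unfolding psi_val_minus unfolding psi_val_def using w
    by (simp add: add_divide_distrib[symmetric] nonzero_divide_eq_eq) (simp add: algebra_simps)
qed

section \<open>Coefficients of moves and the factors of pairs of boxes\<close>

definition coef :: "sgn \<Rightarrow> int \<Rightarrow> int list \<Rightarrow> nat \<Rightarrow> complex" where
  "coef \<epsilon> i js p = (\<Prod>r | r < N \<and> bef \<epsilon> r p. fac t i (js ! r) (kap r - kap p))"

text \<open>\<open>Z\<close> will consist of the other boxes that move. The factors kept here are
  the same whether those boxes have moved or not.\<close>

definition coef_except :: "sgn \<Rightarrow> int \<Rightarrow> int list \<Rightarrow> nat \<Rightarrow> nat set \<Rightarrow> complex" where
  "coef_except \<epsilon> i js p Z = (\<Prod>r\<in>{r. r < N \<and> bef \<epsilon> r p} - Z. fac t i (js ! r) (kap r - kap p))"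

text \<open>The entry \<open>x\<close> of the box \<open>r\<close> is a separate argument because
  \<open>r\<close> may have moved by the time \<open>p\<close> does.\<close>

definition pair_fac :: "sgn \<Rightarrow> int \<Rightarrow> nat \<Rightarrow> nat \<Rightarrow> int \<Rightarrow> complex" where
  "pair_fac \<epsilon> i p r x = (if bef \<epsilon> r p then fac t i x (kap r - kap p) else 1)"

lemma coef_except_split:
  assumes "r < N" "r \<notin> Z"
  shows "coef_except \<epsilon> i js p Z = pair_fac \<epsilon> i p r (js ! r) * coef_except \<epsilon> i js p (insert r Z)"
proof (cases "bef \<epsilon> r p")
  case True
  have "{r. r < N \<and> bef \<epsilon> r p} - insert r Z = ({r. r < N \<and> bef \<epsilon> r p} - Z) - {r}" by auto
  then show ?thesis
    unfolding coef_except_def pair_fac_def using True assms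
    by (simp add: prod.remove[of "{r. r < N \<and> bef \<epsilon> r p} - Z" r])
next
  case False
  then have "{r. r < N \<and> bef \<epsilon> r p} - insert r Z = {r. r < N \<and> bef \<epsilon> r p} - Z" by auto
  then show ?thesis
    unfolding coef_except_def pair_fac_def using False by simp
qed

lemma coef_coef_except: "coef \<epsilon> i js p = coef_except \<epsilon> i js p {}"
  by (simp add: coef_def coef_except_def)

lemma coef_split2: "r < N \<Longrightarrow> coef \<epsilon> i js p = pair_fac \<epsilon> i p r (js ! r) * coef_except \<epsilon> i js p {r}"
  by (simp add: coef_coef_except coef_except_split[of r "{}"])

lemma coef_split3:
  "r < N \<Longrightarrow> s < N \<Longrightarrow> r \<noteq> s \<Longrightarrow>
   coef \<epsilon> i js p = pair_fac \<epsilon> i p r (js ! r) * (pair_fac \<epsilon> i p s (js ! s) * coef_except \<epsilon> i js p {r, s})"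
  by (simp add: coef_split2[of r] coef_except_split[of s "{r}"] insert_commute)

lemma coef_except_upd: "r \<in> Z \<Longrightarrow> coef_except \<epsilon> i (js[r := x]) p Z = coef_except \<epsilon> i js p Z"
  unfolding coef_except_def by (intro prod.cong refl) (metis DiffD2 nth_list_update_neq)

lemma coef_except_upd_self: "coef_except \<epsilon> i (js[p := x]) p Z = coef_except \<epsilon> i js p Z"
  unfolding coef_except_def
  by (intro prod.cong refl) (metis DiffD1 bef_irrefl mem_Collect_eq nth_list_update_neq)

lemma coef_upd_self [simp]: "coef \<epsilon> i (js[p := x]) p = coef \<epsilon> i js p"
  by (simp add: coef_coef_except coef_except_upd_self)

lemma coef_except_eq_0:
  assumes "s < N" "bef \<epsilon> s p" "s \<notin> Z" "fac t i (js ! s) (kap s - kap p) = 0"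
  shows "coef_except \<epsilon> i js p Z = 0"
  unfolding coef_except_def by (rule prod_zero) (use assms in auto)

lemma same_diag_same_entry:
  assumes "js \<in> B" "p < N" "r < N" "kap p = kap r" "js ! p = js ! r"
  shows "p = r"
  using B_diag[OF assms(1), of p r] B_diag[OF assms(1), of r p] assms
  by (metis less_irrefl linorder_neqE_nat)

text \<open>The source entries differ by one, so \<open>p\<close> and \<open>r\<close> are opposite
  corners of a square. Its other two corners lie between them and are zeros of the coefficient of
  \<open>r\<close>. Two versions, with corners of different entry, make it possible to avoid the
  remaining moving box in the Serre relation.\<close>

lemma square_zero:
  assumes js: "js \<in> B" and p: "p < N" "r < N" "bef \<epsilon> p r" "kap p = kap r"
    and src: "js ! p = src \<epsilon> i" "js ! r = src \<epsilon> j" and ij: "\<bar>i - j\<bar> = 1"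
  shows "\<exists>s<N. bef \<epsilon> p s \<and> bef \<epsilon> s r \<and> js ! s = src \<epsilon> i \<and> fac t j (js ! s) (kap s - kap r) = 0"
    and "\<exists>s<N. bef \<epsilon> p s \<and> bef \<epsilon> s r \<and> js ! s = src \<epsilon> j \<and> fac t j (js ! s) (kap s - kap r) = 0"
proof -
  consider "\<epsilon> = Pos" | "\<epsilon> = Neg" by (cases \<epsilon>)
  then have "(\<exists>s<N. bef \<epsilon> p s \<and> bef \<epsilon> s r \<and> js ! s = src \<epsilon> i \<and> fac t j (js ! s) (kap s - kap r) = 0) \<and>
    (\<exists>s<N. bef \<epsilon> p s \<and> bef \<epsilon> s r \<and> js ! s = src \<epsilon> j \<and> fac t j (js ! s) (kap s - kap r) = 0)"
  proof cases
    case 1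
    have "js ! p < js ! r" using B_diag[OF js, of p r] p 1 by simp
    then have j: "j = i + 1" using src ij 1 by simp
    obtain s s' where s: "p < s" "s < r" "js ! s = js ! p" "kap s = kap p + 1"
      "p < s'" "s' < r" "js ! s' = js ! r" "kap s' = kap p - 1"
      using B_square[OF js, of p r] p src 1 j by auto
    have "s < N \<and> bef \<epsilon> p s \<and> bef \<epsilon> s r \<and> js ! s = src \<epsilon> i \<and> fac t j (js ! s) (kap s - kap r) = 0"
      "s' < N \<and> bef \<epsilon> p s' \<and> bef \<epsilon> s' r \<and> js ! s' = src \<epsilon> j \<and> fac t j (js ! s') (kap s' - kap r) = 0"
      using s p src 1 j by (auto simp: fac_def)
    then show ?thesis by blast
  next
    case 2
    have "js ! r < js ! p" using B_diag[OF js, of r p] p 2 by simp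
    then have j: "i = j + 1" using src ij 2 by simp
    obtain s s' where s: "r < s" "s < p" "js ! s = js ! r" "kap s = kap r + 1"
      "r < s'" "s' < p" "js ! s' = js ! p" "kap s' = kap r - 1"
      using B_square[OF js, of r p] p src 2 j by auto
    have "s < N \<and> bef \<epsilon> p s \<and> bef \<epsilon> s r \<and> js ! s = src \<epsilon> j \<and> fac t j (js ! s) (kap s - kap r) = 0"
      "s' < N \<and> bef \<epsilon> p s' \<and> bef \<epsilon> s' r \<and> js ! s' = src \<epsilon> i \<and> fac t j (js ! s') (kap s' - kap r) = 0"
      using s p src 2 j by (auto simp: fac_def)
    then show ?thesis by blast
  qed
  then show "\<exists>s<N. bef \<epsilon> p s \<and> bef \<epsilon> s r \<and> js ! s = src \<epsilon> i \<and> fac t j (js ! s) (kap s - kap r) = 0"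
    "\<exists>s<N. bef \<epsilon> p s \<and> bef \<epsilon> s r \<and> js ! s = src \<epsilon> j \<and> fac t j (js ! s) (kap s - kap r) = 0"
    by auto
qed

text \<open>The two factors by which a pair of boxes \<open>p\<close> (colour \<open>i\<close>) and \<open>r\<close> (colour \<open>j\<close>) contributes to the coefficient of
  a product of moves, according to whether \<open>p\<close> or \<open>r\<close> moves first.\<close>

definition first_fac :: "sgn \<Rightarrow> int \<Rightarrow> nat \<Rightarrow> int \<Rightarrow> nat \<Rightarrow> complex" where
  "first_fac \<epsilon> i p j r = pair_fac \<epsilon> i p r (src \<epsilon> j) * pair_fac \<epsilon> j r p (tgt \<epsilon> i)"

definition q_cart :: "sgn \<Rightarrow> int \<Rightarrow> int \<Rightarrow> complex" where
  "q_cart \<epsilon> i j = q powi (sg \<epsilon> * cart i j)"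

lemma spec_ratio: "spec i p = spec j r * (q powi (2 * (kap p - kap r)) * q powi (i - j))"
  unfolding spec_def by (simp flip: power_int_add add: algebra_simps)

text \<open>Both values of psi have the denominator \<open>1 - w\<close> with
  \<open>w = q^(2 (kap p - kap r))\<close>, and \<open>spec i p\<close> is \<open>w\<close> times a
  power of \<open>q\<close> times \<open>spec j r\<close>. For each of \<open>i = j\<close>,
  \<open>i = j + 1\<close>, \<open>i = j - 1\<close> the identity then compares numerators.\<close>

lemma pair_ratio_bef:
  assumes d: "kap p \<noteq> kap r"
  shows "(spec i p - q_cart \<epsilon> i j * spec j r) * fac t j (src \<epsilon> i) (kap p - kap r)
       = (q_cart \<epsilon> i j * spec i p - spec j r) * fac t j (tgt \<epsilon> i) (kap p - kap r)"
proof -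
  define w A A' where "w = q powi (2 * (kap p - kap r))"
    and "A = psi_val t (kap p - kap r)" and "A' = psi_val t (- (kap p - kap r))"
  have w: "1 - w \<noteq> 0" using d powi_2_neq_1[of "kap p - kap r"] by (simp add: w_def)
  have A: "A = (q - inverse q * w) / (1 - w)" "A' = (inverse q - q * w) / (1 - w)"
    unfolding A_def A'_def w_def psi_val_minus by (simp_all add: psi_val_def)
  have c: "spec i p = spec j r * (w * q powi (i - j))"
    by (simp only: spec_ratio[of i p j r] w_def)
  consider "i = j" | "i = j + 1" | "i = j - 1" | "2 \<le> \<bar>i - j\<bar>" by linarith
  then show ?thesis
  proof cases
    case 1
    have "(spec i p - q powi 2 * spec j r) * A' = (q powi 2 * spec i p - spec j r) * A"
      "(spec i p - q powi (-2) * spec j r) * A = (q powi (-2) * spec i p - spec j r) * A'"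
      using w 1 unfolding A c
      by (simp_all add: divide_simps power_int_minus) (simp_all add: algebra_simps power2_eq_square)
    then show ?thesis
      by (cases \<epsilon>) (simp_all add: 1 q_cart_def cart_def fac_def A_def A'_def)
  next
    case 2
    have "spec i p - q powi (-1) * spec j r = (q powi (-1) * spec i p - spec j r) * A'"
      "(spec i p - q powi 1 * spec j r) * A' = q powi 1 * spec i p - spec j r"
      using w 2 unfolding A c
      by (simp_all add: divide_simps power_int_minus) (simp_all add: algebra_simps power2_eq_square)
    then show ?thesis
      by (cases \<epsilon>) (simp_all add: 2 q_cart_def cart_def fac_def A_def A'_def)
  next
    case 3
    have "(spec i p - q powi (-1) * spec j r) * A = q powi (-1) * spec i p - spec j r"
      "spec i p - q powi 1 * spec j r = (q powi 1 * spec i p - spec j r) * A"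
      using w 3 unfolding A c
      by (simp_all add: divide_simps power_int_minus) (simp_all add: algebra_simps power2_eq_square)
    then show ?thesis
      by (cases \<epsilon>) (simp_all add: 3 q_cart_def cart_def fac_def A_def A'_def)
  next
    case 4
    then have "cart i j = 0" "fac t j (src \<epsilon> i) (kap p - kap r) = 1"
      "fac t j (tgt \<epsilon> i) (kap p - kap r) = 1"
      by (cases \<epsilon>; auto simp: cart_def fac_def)+
    then show ?thesis by (simp add: q_cart_def)
  qed
qed

lemma cart_sym: "cart j i = cart i j"
  by (auto simp: cart_def)

lemma q_cart_sym: "q_cart \<epsilon> j i = q_cart \<epsilon> i j"
  by (simp add: q_cart_def cart_sym)

lemma pair_ratio:
  assumes "p \<noteq> r" "kap p \<noteq> kap r"
  shows "(spec i p - q_cart \<epsilon> i j * spec j r) * first_fac \<epsilon> j r i p = (q_cart \<epsilon> i j * spec i p - spec j r) * first_fac \<epsilon> i p j r"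
proof (cases "bef \<epsilon> p r")
  case True
  then show ?thesis
    using pair_ratio_bef[of p r i \<epsilon> j] bef_antisym[OF True] assms by (simp add: first_fac_def pair_fac_def)
next
  case False
  then have b: "bef \<epsilon> r p" using bef_total assms by blast
  then show ?thesis
    using pair_ratio_bef[of r p j \<epsilon> i] False assms
    by (simp add: first_fac_def pair_fac_def q_cart_sym[of \<epsilon> i j]) (simp add: algebra_simps)
qed

text \<open>Proportionality without a quotient: either exchange factor may vanish, but not both,
  since that would force \<open>q_cart\<close> to have square 1. The Serre relation needs this form,
  in which no order of moves is assumed to be nonzero.\<close>

lemma pair_param:
  assumes "p \<noteq> r" "kap p \<noteq> kap r" "\<bar>i - j\<bar> \<le> 1"
  obtains \<gamma> where "first_fac \<epsilon> i p j r = (spec i p - q_cart \<epsilon> i j * spec j r) * \<gamma>"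
    "first_fac \<epsilon> j r i p = (q_cart \<epsilon> i j * spec i p - spec j r) * \<gamma>"
proof -
  let ?x = "spec i p - q_cart \<epsilon> i j * spec j r" and ?y = "q_cart \<epsilon> i j * spec i p - spec j r"
  have "cart i j \<noteq> 0" using assms(3) by (auto simp: cart_def)
  then have "sg \<epsilon> * cart i j + sg \<epsilon> * cart i j \<noteq> 0" by (cases \<epsilon>) auto
  then have "q_cart \<epsilon> i j * q_cart \<epsilon> i j \<noteq> 1"
    unfolding q_cart_def by (simp add: powi_eq_one_iff flip: power_int_add)
  moreover have "?x = 0 \<Longrightarrow> ?y = spec j r * (q_cart \<epsilon> i j * q_cart \<epsilon> i j - 1)"
    by (simp add: algebra_simps)
  ultimately have xy: "?x \<noteq> 0 \<or> ?y \<noteq> 0" by auto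
  note eq = pair_ratio[OF assms(1,2), of i \<epsilon> j]
  show thesis
  proof (cases "?x = 0")
    case True
    then show thesis using eq xy that[of "first_fac \<epsilon> j r i p / ?y"] by auto
  next
    case False
    show thesis
      by (rule that[of "first_fac \<epsilon> i p j r / ?x"]) (use False eq in \<open>auto simp: field_simps\<close>)
  qed
qed

section \<open>Moves of single boxes\<close>

definition move_basis :: "sgn \<Rightarrow> int \<Rightarrow> nat \<Rightarrow> int list \<Rightarrow> tensor" where
  "move_basis \<epsilon> i p js =
     (if js ! p = src \<epsilon> i then tscale (coef \<epsilon> i js p) (boxes (js[p := tgt \<epsilon> i])) else 0)"

definition move :: "sgn \<Rightarrow> int \<Rightarrow> nat \<Rightarrow> tensor \<Rightarrow> tensor" where
  "move \<epsilon> i p = lin (move_basis \<epsilon> i p)"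

lemma move_scale [simp]: "move \<epsilon> i p (tscale c v) = tscale c (move \<epsilon> i p v)"
  and move_zero [simp]: "move \<epsilon> i p 0 = 0"
  and move_boxes [simp]: "move \<epsilon> i p (boxes js) = move_basis \<epsilon> i p js"
  by (simp_all add: move_def lin_scale)

lemma move_move_basis:
  "move \<eta> j r (move_basis \<epsilon> i p js) =
     (if js ! p = src \<epsilon> i \<and> js[p := tgt \<epsilon> i] ! r = src \<eta> j
      then tscale (coef \<epsilon> i js p * coef \<eta> j (js[p := tgt \<epsilon> i]) r)
             (boxes (js[p := tgt \<epsilon> i, r := tgt \<eta> j])) else 0)"
  by (simp add: move_basis_def)

lemma coef_pair:
  assumes "p < N" "r < N" "p \<noteq> r" "length js = N" "js ! r = src \<epsilon> j"
  shows "coef \<epsilon> i js p * coef \<epsilon> j (js[p := tgt \<epsilon> i]) r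
       = coef_except \<epsilon> i js p {r} * coef_except \<epsilon> j js r {p} * first_fac \<epsilon> i p j r"
  using assms by (simp add: coef_split2[of r \<epsilon> i js p] coef_split2[of p \<epsilon> j _ r] coef_except_upd first_fac_def)

lemma move_comm_distinct:
  assumes "js \<in> B" "p < N" "r < N" "p \<noteq> r" "js ! p = src \<epsilon> i" "js ! r = src \<epsilon> j"
  shows "(spec i p - q_cart \<epsilon> i j * spec j r) * (coef \<epsilon> j js r * coef \<epsilon> i (js[r := tgt \<epsilon> j]) p)
       = (q_cart \<epsilon> i j * spec i p - spec j r) * (coef \<epsilon> i js p * coef \<epsilon> j (js[p := tgt \<epsilon> i]) r)" (is ?A)
    and "\<bar>i - j\<bar> \<ge> 2 \<Longrightarrow> coef \<epsilon> j js r * coef \<epsilon> i (js[r := tgt \<epsilon> j]) p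
       = coef \<epsilon> i js p * coef \<epsilon> j (js[p := tgt \<epsilon> i]) r" (is "?far \<Longrightarrow> ?B")
proof -
  have l: "length js = N" using assms B_length by blast
  note pr = coef_pair[OF assms(2-4) l assms(6), of i]
    and rp = coef_pair[OF assms(3,2) assms(4)[symmetric] l assms(5), of j]
  show far: ?B if ?far
  proof -
    have "first_fac \<epsilon> i p j r = 1" "first_fac \<epsilon> j r i p = 1"
      using that by (cases \<epsilon>; auto simp: first_fac_def pair_fac_def fac_def)+
    then show ?thesis unfolding pr rp by simp
  qed
  show ?A
  proof (cases "\<bar>i - j\<bar> \<ge> 2")
    case True
    then have "q_cart \<epsilon> i j = 1" by (simp add: q_cart_def cart_def)
    then show ?thesis using far[OF True] by simp
  next
    case False
    show ?thesis
    proof (cases "kap p = kap r")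
      case True
      have "i \<noteq> j" using same_diag_same_entry[OF assms(1-3) True] assms by auto
      with False have ij: "\<bar>i - j\<bar> = 1" by linarith
      have "coef_except \<epsilon> i js p {r} = 0 \<or> coef_except \<epsilon> j js r {p} = 0"
      proof (cases "bef \<epsilon> p r")
        case b: True
        from square_zero(1)[OF assms(1-3) b True assms(5,6) ij]
        obtain s where "s < N" "bef \<epsilon> p s" "bef \<epsilon> s r" "fac t j (js ! s) (kap s - kap r) = 0"
          by blast
        then have "coef_except \<epsilon> j js r {p} = 0"
          by (intro coef_except_eq_0[of s]) auto
        then show ?thesis by simp
      next
        case False
        then have b: "bef \<epsilon> r p" using bef_total assms by blast
        have ji: "\<bar>j - i\<bar> = 1" using ij by linarith
        from square_zero(1)[OF assms(1,3,2) b True[symmetric] assms(6,5) ji]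
        obtain s where "s < N" "bef \<epsilon> r s" "bef \<epsilon> s p" "fac t i (js ! s) (kap s - kap p) = 0"
          by blast
        then have "coef_except \<epsilon> i js p {r} = 0"
          by (intro coef_except_eq_0[of s]) auto
        then show ?thesis by simp
      qed
      then show ?thesis unfolding pr rp by auto
    next
      case neq: False
      have *: "x * (c * d * B) = y * (d * c * A)" if "x * B = y * A" for x y A B c d :: complex
        using that by Groebner_Basis.algebra
      show ?thesis
        unfolding pr rp by (rule *) (rule pair_ratio[OF assms(4) neq])
    qed
  qed
qed

lemma move_comm:
  assumes "js \<in> B" "p < N" "r < N"
  shows "tscale (spec i p - q_cart \<epsilon> i j * spec j r) (move \<epsilon> i p (move_basis \<epsilon> j r js))
       = tscale (q_cart \<epsilon> i j * spec i p - spec j r) (move \<epsilon> j r (move_basis \<epsilon> i p js))"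
proof (cases "p = r")
  case True
  have l: "length js = N" using assms B_length by blast
  \<comment> \<open>A single box can make both moves in one order only, and for that order the two
    spectral constants differ exactly by the factor \<open>q_cart\<close>: the exchange factor is
    zero.\<close>
  have "spec i p - q_cart \<epsilon> i j * spec j p = 0" if "tgt \<epsilon> j = src \<epsilon> i"
    using that by (cases \<epsilon>) (auto simp: q_cart_def cart_def spec_def power_int_add field_simps)
  then have "tscale (spec i p - q_cart \<epsilon> i j * spec j p) (move \<epsilon> i p (move_basis \<epsilon> j p js)) = 0"
    using assms l by (cases "tgt \<epsilon> j = src \<epsilon> i") (simp_all only: tensor.scale_zero_left, simp add: move_move_basis)
  moreover have "q_cart \<epsilon> i j * spec i p - spec j p = 0" if "tgt \<epsilon> i = src \<epsilon> j"
    using that by (cases \<epsilon>) (auto simp: q_cart_def cart_def spec_def power_int_add field_simps)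
  then have "tscale (q_cart \<epsilon> i j * spec i p - spec j p) (move \<epsilon> j p (move_basis \<epsilon> i p js)) = 0"
    using assms l by (cases "tgt \<epsilon> i = src \<epsilon> j") (simp_all only: tensor.scale_zero_left, simp add: move_move_basis)
  ultimately show ?thesis unfolding True by (simp only:)
next
  case False
  have sw: "js[r := tgt \<epsilon> j, p := tgt \<epsilon> i] = js[p := tgt \<epsilon> i, r := tgt \<epsilon> j]"
    using False by (metis list_update_swap)
  show ?thesis
    using move_comm_distinct(1)[OF assms False, of \<epsilon> i j] False
    unfolding move_move_basis sw by simp
qed

lemma move_far:
  assumes "js \<in> B" "p < N" "r < N" "\<bar>i - j\<bar> \<ge> 2"
  shows "move \<epsilon> i p (move_basis \<epsilon> j r js) = move \<epsilon> j r (move_basis \<epsilon> i p js)"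
proof (cases "p = r")
  case True
  have l: "length js = N" using assms B_length by blast
  have "tgt \<epsilon> j \<noteq> src \<epsilon> i" "tgt \<epsilon> i \<noteq> src \<epsilon> j"
    using assms(4) by (cases \<epsilon>; auto)+
  then show ?thesis using True assms l by (auto simp: move_move_basis)
next
  case False
  have sw: "js[r := tgt \<epsilon> j, p := tgt \<epsilon> i] = js[p := tgt \<epsilon> i, r := tgt \<epsilon> j]"
    using False by (metis list_update_swap)
  show ?thesis
    using move_comm_distinct(2)[OF assms(1-3) False _ _ assms(4), of \<epsilon>] False
    unfolding move_move_basis sw by simp
qed

text \<open>For distinct boxes, either neither enters the coefficient of the other or both do. In
  the latter case both orders yield the same values of psi, because a box of entry
  \<open>i + 1\<close> at distance \<open>d\<close> counts like one of entry \<open>i\<close> at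
  distance \<open>- d\<close>.\<close>

lemma move_mixed:
  assumes "js \<in> B" "p < N" "r < N" "i \<noteq> j \<or> p \<noteq> r"
  shows "move Pos i p (move_basis Neg j r js) = move Neg j r (move_basis Pos i p js)"
proof (cases "p = r")
  case True
  have l: "length js = N" using assms B_length by blast
  then show ?thesis using True assms by (auto simp: move_move_basis)
next
  case False
  have l: "length js = N" using assms B_length by blast
  have "coef Neg j js r * coef Pos i (js[r := j + 1]) p = coef Pos i js p * coef Neg j (js[p := i]) r"
    if "js ! p = i + 1" "js ! r = j"
    using False assms that l
    by (simp add: coef_split2[of r Pos i _ p] coef_split2[of p Neg j _ r] coef_except_upd pair_fac_def fac_def)
  moreover have "js[r := j + 1, p := i] = js[p := i, r := j + 1]"
    using False by (metis list_update_swap)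
  ultimately show ?thesis using False by (simp add: move_move_basis nth_list_update_neq)
qed

text \<open>The coefficient of moving \<open>p\<close> away and back: the two directions see the
  boxes on opposite sides of \<open>p\<close>. It will turn out to be a partial fraction coefficient
  of the eigenvalue of \<open>phi\<close>.\<close>

definition full :: "int \<Rightarrow> int list \<Rightarrow> nat \<Rightarrow> complex" where
  "full i js p = (\<Prod>r\<in>{..<N} - {p}. fac t i (js ! r) (kap r - kap p))"

lemma coef_Pos_Neg: "p < N \<Longrightarrow> coef Pos i js p * coef Neg i js p = full i js p"
  unfolding coef_def full_def
  by (subst prod.union_disjoint[symmetric]) (auto intro!: prod.cong)

lemma move_Pos_Neg:
  assumes "js \<in> B" "p < N"
  shows "move Pos i p (move_basis Neg i p js) = (if js ! p = i then tscale (full i js p) (boxes js) else 0)"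
    and "move Neg i p (move_basis Pos i p js) = (if js ! p = i + 1 then tscale (full i js p) (boxes js) else 0)"
proof -
  have l: "length js = N" using assms B_length by blast
  have id: "js[p := x] = js" if "js ! p = x" for x
    using that by (metis list_update_id)
  show "move Pos i p (move_basis Neg i p js) = (if js ! p = i then tscale (full i js p) (boxes js) else 0)"
    using assms(2) l
    by (simp add: move_move_basis id flip: coef_Pos_Neg)
  show "move Neg i p (move_basis Pos i p js) = (if js ! p = i + 1 then tscale (full i js p) (boxes js) else 0)"
    using assms(2) l
    by (simp add: move_move_basis id flip: coef_Pos_Neg)
qed

section \<open>The Serre relations\<close>

text \<open>The head of the list moves first, opposite to the order of factors in a product of
  generators.\<close>

definition moves :: "sgn \<Rightarrow> (int \<times> nat) list \<Rightarrow> int list \<Rightarrow> tensor" where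
  "moves \<epsilon> w js = fold (\<lambda>(i, p). move \<epsilon> i p) w (boxes js)"

lemma mseq3:
  "moves \<epsilon> [(i, p), (j, r), (k, s)] js =
     (if js ! p = src \<epsilon> i \<and> js[p := tgt \<epsilon> i] ! r = src \<epsilon> j \<and>
         js[p := tgt \<epsilon> i, r := tgt \<epsilon> j] ! s = src \<epsilon> k
      then tscale (coef \<epsilon> i js p * coef \<epsilon> j (js[p := tgt \<epsilon> i]) r *
                   coef \<epsilon> k (js[p := tgt \<epsilon> i, r := tgt \<epsilon> j]) s)
             (boxes (js[p := tgt \<epsilon> i, r := tgt \<epsilon> j, s := tgt \<epsilon> k])) else 0)"
  by (auto simp: moves_def move_move_basis) (auto simp: move_basis_def mult.assoc)

text \<open>The symmetrization over the two variables of colour \<open>i\<close> appears as one over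
  the boxes \<open>p\<close> and \<open>r\<close>: in the sum over all boxes, exchanging the modes
  amounts to renaming them.\<close>

definition serre6 :: "sgn \<Rightarrow> int \<Rightarrow> int \<Rightarrow> nat \<Rightarrow> nat \<Rightarrow> nat \<Rightarrow> int list \<Rightarrow> tensor" where
  "serre6 \<epsilon> i j p r s js =
     (moves \<epsilon> [(j, s), (i, r), (i, p)] js - tscale (q + inverse q) (moves \<epsilon> [(i, r), (j, s), (i, p)] js)
       + moves \<epsilon> [(i, r), (i, p), (j, s)] js)
     + (moves \<epsilon> [(j, s), (i, p), (i, r)] js - tscale (q + inverse q) (moves \<epsilon> [(i, p), (j, s), (i, r)] js)
       + moves \<epsilon> [(i, p), (i, r), (j, s)] js)"

lemma serre6_sym: "serre6 \<epsilon> i j p r s js = serre6 \<epsilon> i j r p s js"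
  by (simp add: serre6_def add.commute)

lemma coef_triple:
  assumes "p < N" "r < N" "s < N" "p \<noteq> r" "p \<noteq> s" "r \<noteq> s" "length js = N"
    "js ! r = src \<epsilon> j" "js ! s = src \<epsilon> k"
  shows "coef \<epsilon> i js p * coef \<epsilon> j (js[p := tgt \<epsilon> i]) r * coef \<epsilon> k (js[p := tgt \<epsilon> i, r := tgt \<epsilon> j]) s
       = coef_except \<epsilon> i js p {r, s} * coef_except \<epsilon> j js r {p, s} * coef_except \<epsilon> k js s {p, r}
         * (first_fac \<epsilon> i p j r * first_fac \<epsilon> i p k s * first_fac \<epsilon> j r k s)"
  using assms
  by (simp add: coef_split3[of r s \<epsilon> i js p] coef_split3[of p s \<epsilon> j _ r] coef_split3[of p r \<epsilon> k _ s]
      coef_except_upd first_fac_def)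

text \<open>Here \<open>c1\<close>, \<open>c2\<close> are the spectral constants of the two boxes of
  colour \<open>i\<close>, \<open>c3\<close> that of the box of colour \<open>j\<close>,
  \<open>Q\<close> is \<open>q_cart \<epsilon> i j\<close>, and the square of \<open>R\<close> is
  \<open>q_cart \<epsilon> i i\<close>. It is what remains of the Serre relation once the common
  factors given by \<open>pair_param\<close> are removed.\<close>

lemma serre_identity:
  fixes Q R :: complex
  assumes "Q * R = 1"
  shows "((c1 - R\<^sup>2 * c2) + (R\<^sup>2 * c1 - c2)) *
      ((c1 - Q * c3) * (c2 - Q * c3) + (Q * c1 - c3) * (Q * c2 - c3))
    = (Q + R) * ((R\<^sup>2 * c1 - c2) * (c2 - Q * c3) * (Q * c1 - c3)
      + (c1 - R\<^sup>2 * c2) * (c1 - Q * c3) * (Q * c2 - c3))"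
  using assms by Groebner_Basis.algebra

text \<open>All six orders share the factor \<open>C\<close>, which involves each coefficient
  without the moving boxes. If \<open>p\<close> or \<open>r\<close> lies on the diagonal of
  \<open>s\<close>, a corner of the square makes \<open>C\<close> zero; otherwise every pair is on
  different diagonals and \<open>serre_identity\<close> applies.\<close>

lemma serre6_distinct:
  assumes js: "js \<in> B" and p: "p < N" "r < N" "s < N" and neq: "p \<noteq> r" "p \<noteq> s" "r \<noteq> s"
    and ij: "\<bar>i - j\<bar> = 1"
  shows "serre6 \<epsilon> i j p r s js = 0"
proof (cases "js ! p = src \<epsilon> i \<and> js ! r = src \<epsilon> i \<and> js ! s = src \<epsilon> j")
  case False
  then show ?thesis using neq unfolding serre6_def mseq3 by (auto simp: nth_list_update_neq)
next
  case src: True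
  have l: "length js = N" using js B_length by blast
  have kpr: "kap p \<noteq> kap r" using same_diag_same_entry[OF js p(1,2)] src neq by auto
  define C where "C = coef_except \<epsilon> i js p {r, s} * coef_except \<epsilon> i js r {p, s} * coef_except \<epsilon> j js s {p, r}"
  define \<alpha> \<beta> A1 A2 B1 B2 where "\<alpha> = first_fac \<epsilon> i p i r" and "\<beta> = first_fac \<epsilon> i r i p"
    and "A1 = first_fac \<epsilon> i p j s" and "A2 = first_fac \<epsilon> i r j s"
    and "B1 = first_fac \<epsilon> j s i p" and "B2 = first_fac \<epsilon> j s i r"
  define b where "b = boxes (js[p := tgt \<epsilon> i, r := tgt \<epsilon> i, s := tgt \<epsilon> j])"
  have perm: "js[s := y, r := x, p := x'] = js[p := x', r := x, s := y]"
    "js[r := x, s := y, p := x'] = js[p := x', r := x, s := y]"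
    "js[r := x, p := x', s := y] = js[p := x', r := x, s := y]"
    "js[s := y, p := x', r := x] = js[p := x', r := x, s := y]"
    "js[p := x', s := y, r := x] = js[p := x', r := x, s := y]" for x x' y
    using neq by (metis list_update_swap)+
  have m: "moves \<epsilon> [(j, s), (i, r), (i, p)] js = tscale (C * (B2 * B1 * \<beta>)) b"
    "moves \<epsilon> [(i, r), (j, s), (i, p)] js = tscale (C * (A2 * \<beta> * B1)) b"
    "moves \<epsilon> [(i, r), (i, p), (j, s)] js = tscale (C * (\<beta> * A2 * A1)) b"
    "moves \<epsilon> [(j, s), (i, p), (i, r)] js = tscale (C * (B1 * B2 * \<alpha>)) b"
    "moves \<epsilon> [(i, p), (j, s), (i, r)] js = tscale (C * (A1 * \<alpha> * B2)) b"
    "moves \<epsilon> [(i, p), (i, r), (j, s)] js = tscale (C * (\<alpha> * A1 * A2)) b"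
    using neq p src l
    by (simp_all add: mseq3 coef_triple perm)
      (simp_all add: b_def C_def insert_commute
        \<alpha>_def \<beta>_def A1_def A2_def B1_def B2_def mult_ac)
  have "C * ((\<alpha> + \<beta>) * (A1 * A2 + B1 * B2)) = C * ((q + inverse q) * (\<beta> * A2 * B1 + \<alpha> * A1 * B2))"
  proof (cases "kap p = kap s \<or> kap r = kap s")
    case True
    have z: "coef_except \<epsilon> i js x {y, s} = 0 \<or> coef_except \<epsilon> j js s {x, y} = 0"
      if x: "kap x = kap s" "x < N" "x \<noteq> s" "js ! x = src \<epsilon> i" "js ! y = src \<epsilon> i" for x y
    proof (cases "bef \<epsilon> x s")
      case True
      from square_zero(2)[OF js x(2) p(3) True x(1,4) _ ij] src
      obtain z where z: "z < N" "bef \<epsilon> x z" "bef \<epsilon> z s" "js ! z = src \<epsilon> j"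
        "fac t j (js ! z) (kap z - kap s) = 0" by blast
      have "z \<notin> {x, y}" using z(4) x ij by auto
      from coef_except_eq_0[OF z(1,3) this z(5)] show ?thesis by simp
    next
      case False
      then have b: "bef \<epsilon> s x" using bef_total x by blast
      have ji: "\<bar>j - i\<bar> = 1" using ij by linarith
      from square_zero(1)[OF js p(3) x(2) b x(1)[symmetric] _ x(4) ji] src
      obtain z where z: "z < N" "bef \<epsilon> s z" "bef \<epsilon> z x" "js ! z = src \<epsilon> j"
        "fac t i (js ! z) (kap z - kap x) = 0" by blast
      have "z \<notin> {y, s}" using z x ij by auto
      from coef_except_eq_0[OF z(1,3) this z(5)] show ?thesis by simp
    qed
    have "C = 0"
      using True z[of p r] z[of r p] src p neq unfolding C_def
      by (auto simp: insert_commute)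
    then show ?thesis by simp
  next
    case False
    have ii: "\<bar>i - i\<bar> \<le> 1" and ij': "\<bar>i - j\<bar> \<le> 1" using ij by auto
    obtain g where g: "\<alpha> = (spec i p - q_cart \<epsilon> i i * spec i r) * g" "\<beta> = (q_cart \<epsilon> i i * spec i p - spec i r) * g"
      unfolding \<alpha>_def \<beta>_def using pair_param[OF neq(1) kpr ii] by metis
    obtain h where h: "A1 = (spec i p - q_cart \<epsilon> i j * spec j s) * h" "B1 = (q_cart \<epsilon> i j * spec i p - spec j s) * h"
      unfolding A1_def B1_def using pair_param[OF neq(2) _ ij'] False by metis
    obtain k where k: "A2 = (spec i r - q_cart \<epsilon> i j * spec j s) * k" "B2 = (q_cart \<epsilon> i j * spec i r - spec j s) * k"
      unfolding A2_def B2_def using pair_param[OF neq(3) _ ij'] False by metis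
    define Q where "Q = q_cart \<epsilon> i j"
    have Q: "Q * inverse Q = 1" "q_cart \<epsilon> i i = (inverse Q)\<^sup>2" "q + inverse q = Q + inverse Q"
      using ij by (cases \<epsilon>; auto simp: Q_def q_cart_def cart_def power_int_minus power_inverse)+
    show ?thesis
      using serre_identity[OF Q(1), of "spec i p" "spec i r" "spec j s"]
      unfolding g h k Q(2,3) Q_def[symmetric] by Groebner_Basis.algebra
  qed
  then have z: "C * (B2 * B1 * \<beta>) - (q + inverse q) * (C * (A2 * \<beta> * B1)) + C * (\<beta> * A2 * A1)
    + (C * (B1 * B2 * \<alpha>) - (q + inverse q) * (C * (A1 * \<alpha> * B2)) + C * (\<alpha> * A1 * A2)) = 0"
    by Groebner_Basis.algebra
  show ?thesis
    unfolding serre6_def m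
    by (simp only: tensor.scale_scale flip: tensor.scale_left_distrib tensor.scale_left_diff_distrib)
      (simp only: z tensor.scale_zero_left)
qed

text \<open>The two orders of a box of colours \<open>i\<close>, \<open>j\<close> and another of colour \<open>i\<close>: everything reduces to
  \<open>\<psi>(q\<^bsup>2d\<^esup>) + \<psi>(q\<^bsup>-2d\<^esup>) = q + q\<^sup>-\<^sup>1\<close>.\<close>

lemma pair_fac_identity1:
  assumes "p \<noteq> r" "kap p \<noteq> kap r" "tgt \<epsilon> i = src \<epsilon> j"
  shows "pair_fac \<epsilon> i p r (src \<epsilon> i) * pair_fac \<epsilon> i r p (tgt \<epsilon> i) * pair_fac \<epsilon> j p r (tgt \<epsilon> i)
    + pair_fac \<epsilon> i r p (src \<epsilon> i) * pair_fac \<epsilon> i p r (tgt \<epsilon> i) * pair_fac \<epsilon> j p r (tgt \<epsilon> i)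
    = (q + inverse q) * (pair_fac \<epsilon> i p r (src \<epsilon> i) * pair_fac \<epsilon> j p r (src \<epsilon> i) * pair_fac \<epsilon> i r p (tgt \<epsilon> j))"
proof -
  have s: "psi_val t (kap p - kap r) + psi_val t (kap r - kap p) = q + inverse q"
    using psi_val_add[of "kap p - kap r"] assms by simp
  show ?thesis
    using assms bef_total[OF assms(1), of \<epsilon>] unfolding s[symmetric]
    by (cases \<epsilon>) (auto simp: pair_fac_def fac_def algebra_simps)
qed

text \<open>The entries differ here, so the boxes may share a diagonal when
  \<open>bef \<epsilon> r p\<close>. Then each side contains a factor taken at the pole, which is 0
  by convention.\<close>

lemma pair_fac_identity2:
  assumes "p \<noteq> r" "bef \<epsilon> p r \<Longrightarrow> kap p \<noteq> kap r" "tgt \<epsilon> j = src \<epsilon> i"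
  shows "pair_fac \<epsilon> j p r (src \<epsilon> i) * pair_fac \<epsilon> i r p (src \<epsilon> i) * pair_fac \<epsilon> i p r (tgt \<epsilon> i)
    + pair_fac \<epsilon> j p r (src \<epsilon> i) * pair_fac \<epsilon> i p r (src \<epsilon> i) * pair_fac \<epsilon> i r p (tgt \<epsilon> i)
    = (q + inverse q) * (pair_fac \<epsilon> i r p (src \<epsilon> j) * pair_fac \<epsilon> j p r (tgt \<epsilon> i) * pair_fac \<epsilon> i p r (tgt \<epsilon> i))"
proof (cases "kap p = kap r")
  case True
  then show ?thesis
    using assms bef_total[OF assms(1), of \<epsilon>]
    by (cases \<epsilon>) (auto simp: pair_fac_def fac_def algebra_simps)
next
  case False
  have s: "psi_val t (kap p - kap r) + psi_val t (kap r - kap p) = q + inverse q"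
    using psi_val_add[of "kap p - kap r"] False by simp
  show ?thesis
    using assms bef_total[OF assms(1), of \<epsilon>] unfolding s[symmetric]
    by (cases \<epsilon>) (auto simp: pair_fac_def fac_def algebra_simps)
qed

text \<open>The box \<open>p\<close> makes a move of each colour, and only one order of these two is
  possible. This discards three of the six terms and leaves one of the two preceding
  identities.\<close>

lemma serre6_same:
  assumes js: "js \<in> B" and p: "p < N" "r < N" and neq: "p \<noteq> r" and ij: "\<bar>i - j\<bar> = 1"
  shows "serre6 \<epsilon> i j p r p js = 0"
proof -
  have l: "length js = N" using js B_length by blast
  have perm: "js[r := x, p := y] = js[p := y, r := x]"
    "js[p := y, r := x, p := y'] = js[p := y', r := x]"
    "js[r := x, p := y, p := y'] = js[p := y', r := x]" for x y y'
    using neq by (metis list_update_swap list_update_overwrite)+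
  have i0: "src \<epsilon> i \<noteq> src \<epsilon> j" using ij by auto
  have upd: "js[p := x] ! p = x" "js[p := x] ! r = js ! r" "js[r := x] ! p = js ! p" for x
    using p l neq by auto
  note cp = coef_split2[OF p(2), of \<epsilon> _ _ p] and cr = coef_split2[OF p(1), of \<epsilon> _ _ r]
  consider "tgt \<epsilon> i = src \<epsilon> j" "tgt \<epsilon> j \<noteq> src \<epsilon> i" | "tgt \<epsilon> j = src \<epsilon> i" "tgt \<epsilon> i \<noteq> src \<epsilon> j"
    using ij by (cases \<epsilon>) fastforce+
  then show ?thesis
  proof cases
    case 1
    show ?thesis
    proof (cases "js ! p = src \<epsilon> i \<and> js ! r = src \<epsilon> i")
      case False
      then show ?thesis using 1 neq i0 l p unfolding serre6_def mseq3 by (auto simp: nth_list_update)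
    next
      case src: True
      have d: "kap p \<noteq> kap r" using same_diag_same_entry[OF js p] src neq by auto
      define C b where "C = coef_except \<epsilon> i js p {r} * coef_except \<epsilon> j js p {r} * coef_except \<epsilon> i js r {p}"
        and "b = boxes (js[p := tgt \<epsilon> j, r := tgt \<epsilon> i])"
      have m: "moves \<epsilon> [(j, p), (i, r), (i, p)] js = 0"
        "moves \<epsilon> [(i, r), (j, p), (i, p)] js = 0" "moves \<epsilon> [(j, p), (i, p), (i, r)] js = 0"
        "moves \<epsilon> [(i, r), (i, p), (j, p)] js = tscale (C * (pair_fac \<epsilon> i r p (src \<epsilon> i) *
           pair_fac \<epsilon> i p r (tgt \<epsilon> i) * pair_fac \<epsilon> j p r (tgt \<epsilon> i))) b"
        "moves \<epsilon> [(i, p), (j, p), (i, r)] js = tscale (C * (pair_fac \<epsilon> i p r (src \<epsilon> i) *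
           pair_fac \<epsilon> j p r (src \<epsilon> i) * pair_fac \<epsilon> i r p (tgt \<epsilon> j))) b"
        "moves \<epsilon> [(i, p), (i, r), (j, p)] js = tscale (C * (pair_fac \<epsilon> i p r (src \<epsilon> i) *
           pair_fac \<epsilon> i r p (tgt \<epsilon> i) * pair_fac \<epsilon> j p r (tgt \<epsilon> i))) b"
        using 1 neq i0 l p src
        by (simp_all add: mseq3 perm upd b_def C_def cp cr coef_except_upd coef_except_upd_self mult_ac
            nth_list_update)
      show ?thesis
        unfolding serre6_def m using pair_fac_identity1[OF neq d 1(1)]
        by (simp flip: tensor.scale_left_distrib tensor.scale_left_diff_distrib distrib_left
              right_diff_distrib add: mult.left_commute[of _ C])
          (simp add: algebra_simps)
    qed
  next
    case 2
    show ?thesis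
    proof (cases "js ! p = src \<epsilon> j \<and> js ! r = src \<epsilon> i")
      case False
      then show ?thesis using 2 neq i0 l p unfolding serre6_def mseq3 by (auto simp: nth_list_update)
    next
      case src: True
      have d: "kap p \<noteq> kap r" if "bef \<epsilon> p r"
        using that B_diag[OF js, of p r] B_diag[OF js, of r p] src p 2(1) by (cases \<epsilon>) auto
      define C b where "C = coef_except \<epsilon> i js p {r} * coef_except \<epsilon> j js p {r} * coef_except \<epsilon> i js r {p}"
        and "b = boxes (js[p := tgt \<epsilon> i, r := tgt \<epsilon> i])"
      have m: "moves \<epsilon> [(i, r), (i, p), (j, p)] js = 0"
        "moves \<epsilon> [(i, p), (j, p), (i, r)] js = 0" "moves \<epsilon> [(i, p), (i, r), (j, p)] js = 0"
        "moves \<epsilon> [(j, p), (i, r), (i, p)] js = tscale (C * (pair_fac \<epsilon> j p r (src \<epsilon> i) *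
           pair_fac \<epsilon> i r p (src \<epsilon> i) * pair_fac \<epsilon> i p r (tgt \<epsilon> i))) b"
        "moves \<epsilon> [(j, p), (i, p), (i, r)] js = tscale (C * (pair_fac \<epsilon> j p r (src \<epsilon> i) *
           pair_fac \<epsilon> i p r (src \<epsilon> i) * pair_fac \<epsilon> i r p (tgt \<epsilon> i))) b"
        "moves \<epsilon> [(i, r), (j, p), (i, p)] js = tscale (C * (pair_fac \<epsilon> i r p (src \<epsilon> j) *
           pair_fac \<epsilon> j p r (tgt \<epsilon> i) * pair_fac \<epsilon> i p r (tgt \<epsilon> i))) b"
        using 2 neq i0 l p src
        by (simp_all add: mseq3 perm upd b_def C_def cp cr coef_except_upd coef_except_upd_self mult_ac
            nth_list_update)
      show ?thesis
        unfolding serre6_def m using pair_fac_identity2[OF neq d 2(1)]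
        by (simp flip: tensor.scale_left_distrib tensor.scale_left_diff_distrib distrib_left
              right_diff_distrib add: mult.left_commute[of _ C])
          (simp add: algebra_simps)
    qed
  qed
qed

lemma serre6_zero:
  assumes "js \<in> B" "p < N" "r < N" "s < N" "\<bar>i - j\<bar> = 1"
  shows "serre6 \<epsilon> i j p r s js = 0"
proof -
  have l: "length js = N" using assms B_length by blast
  consider "p = r" | "p \<noteq> r" "s = p" | "p \<noteq> r" "s = r" | "p \<noteq> r" "p \<noteq> s" "r \<noteq> s" by blast
  then show ?thesis
  proof cases
    case 1
    \<comment> \<open>Moves of one sign shift entries in one direction, so no box can use the colour
      \<open>i\<close> twice, even with a move of colour \<open>j\<close> in between.\<close>
    have "tgt \<epsilon> i = src \<epsilon> j \<longrightarrow> tgt \<epsilon> j \<noteq> src \<epsilon> i" by (cases \<epsilon>) auto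
    then show ?thesis
      using 1 assms l by (cases "r = s") (auto simp: serre6_def mseq3 nth_list_update)
  next
    case 2
    then show ?thesis using serre6_same[of js p r i j \<epsilon>] assms by simp
  next
    case 3
    then show ?thesis
      using serre6_same[of js r p i j \<epsilon>] assms by (simp add: serre6_sym[of \<epsilon> i j p])
  next
    case 4
    then show ?thesis using serre6_distinct[of js p r s i j \<epsilon>] assms by simp
  qed
qed

end

section \<open>Expansions and values of rational functions\<close>

lemma quot_of_fract_cross:
  fixes n d :: "complex poly"
  assumes "d \<noteq> 0" "quot_of_fract (Fract n d) = (n', d')"
  shows "n' * d = n * d'" "d' \<noteq> 0" "coprime n' d'" "d' dvd d"
proof -
  show d': "d' \<noteq> 0"
    using snd_quot_of_fract_nonzero[of "Fract n d"] assms by simp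
  have "Fract n' d' = Fract n d"
    using Fract_quot_of_fract[of "Fract n d"] assms by simp
  then show eq: "n' * d = n * d'"
    using assms d' by (simp add: eq_fract)
  show c: "coprime n' d'"
    using coprime_quot_of_fract[of "Fract n d"] assms by simp
  have "d' dvd n' * d" by (simp add: eq)
  then show "d' dvd d"
    using c by (metis coprime_commute coprime_dvd_mult_right_iff)
qed

text \<open>The denominator in lowest terms divides \<open>d\<close>, so any representation whose
  denominator is nonzero at \<open>x\<close> gives the value.\<close>

lemma rat_eval_Fract:
  assumes "poly d x \<noteq> 0"
  shows "rat_eval (Fract n d) x = poly n x / poly d x"
proof -
  have d0: "d \<noteq> 0" using assms by auto
  obtain n' d' where q: "quot_of_fract (Fract n d) = (n', d')" by (metis surj_pair)
  note c = quot_of_fract_cross[OF d0 q]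
  from c(4) have "poly d' x \<noteq> 0" using assms by (auto simp: dvd_def)
  moreover have "poly n' x * poly d x = poly n x * poly d' x"
    using c(1) by (metis poly_mult)
  ultimately show ?thesis using assms by (simp add: rat_eval_def q divide_simps)
qed

text \<open>\<open>series Neg M p\<close> is the power series of \<open>y\<^sup>M p(1/y)\<close>.\<close>

fun series :: "sgn \<Rightarrow> nat \<Rightarrow> complex poly \<Rightarrow> complex fps" where
  "series Pos M p = fps_of_poly p"
| "series Neg M p = Abs_fps (\<lambda>n. if n \<le> M then poly.coeff p (M - n) else 0)"

lemma series_Neg: "degree p \<le> M \<Longrightarrow> series Neg M p = fps_X ^ (M - degree p) * fps_of_poly (reflect_poly p)"
  by (rule fps_ext) (auto simp: fps_X_power_mult_nth coeff_reflect_poly coeff_eq_0)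

lemma series_add: "series \<epsilon> M (p + p') = series \<epsilon> M p + series \<epsilon> M p'"
  by (cases \<epsilon>) (auto simp: fps_of_poly_add intro: fps_ext)

lemma series_smult: "series \<epsilon> M (Polynomial.smult c p) = fps_const c * series \<epsilon> M p"
  by (cases \<epsilon>) (auto simp: fps_of_poly_smult intro!: fps_ext)

lemma series_zero: "series \<epsilon> M 0 = 0"
  by (cases \<epsilon>) (auto intro: fps_ext)

lemma series_sum: "series \<epsilon> M (sum f A) = (\<Sum>x\<in>A. series \<epsilon> M (f x))"
  by (induction A rule: infinite_finite_induct) (simp_all add: series_zero series_add del: series.simps)

lemma series_mult:
  assumes "degree p \<le> M" "degree p' \<le> M'"
  shows "series \<epsilon> (M + M') (p * p') = series \<epsilon> M p * series \<epsilon> M' p'"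
proof (cases "\<epsilon> = Pos \<or> p = 0 \<or> p' = 0")
  case True
  then consider "\<epsilon> = Pos" | "p = 0" | "p' = 0" by blast
  then show ?thesis
    by cases (simp_all add: series_zero fps_of_poly_mult del: series.simps(2))
next
  case False
  then have \<epsilon>: "\<epsilon> = Neg" and nz: "p \<noteq> 0" "p' \<noteq> 0" by (cases \<epsilon>; simp)+
  have "series Neg (M + M') (p * p') = fps_X ^ (M + M' - degree (p * p')) * fps_of_poly (reflect_poly (p * p'))"
    using assms nz by (intro series_Neg) (simp add: degree_mult_eq)
  also have "M + M' - degree (p * p') = (M - degree p) + (M' - degree p')"
    using assms nz by (simp add: degree_mult_eq)
  finally show ?thesis
    unfolding \<epsilon> series_Neg[OF assms(1)] series_Neg[OF assms(2)]
    by (simp only: reflect_poly_mult fps_of_poly_mult power_add mult_ac)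
qed

text \<open>A fraction, not necessarily reduced, without poles at zero and infinity.
  \<open>M\<close> is the common degree with respect to which numerator and denominator are reversed
  for the expansion at infinity.\<close>

definition regular :: "ratfun \<Rightarrow> complex poly \<Rightarrow> complex poly \<Rightarrow> nat \<Rightarrow> bool" where
  "regular f n d M \<longleftrightarrow> f = Fract n d \<and> degree d = M \<and> degree n \<le> M \<and> poly.coeff d 0 \<noteq> 0"

lemma regular_mult: "regular f n d M \<Longrightarrow> regular g n' d' M' \<Longrightarrow> regular (f * g) (n * n') (d * d') (M + M')"
  unfolding regular_def
  by (subst degree_mult_eq) (auto simp: coeff_mult_0 intro!: degree_mult_le[THEN order_trans] add_mono)

lemma regular_one: "regular 1 1 1 0"
  by (simp add: regular_def One_fract_def)

lemma series_nth_0: "series \<epsilon> M d $ 0 = (case \<epsilon> of Pos \<Rightarrow> poly.coeff d 0 | Neg \<Rightarrow> poly.coeff d M)"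
  by (cases \<epsilon>) auto

lemma regular_series_nonzero:
  assumes "regular f n d M"
  shows "series \<epsilon> M d $ 0 \<noteq> 0" "series \<epsilon> M d \<noteq> 0"
proof -
  have "d \<noteq> 0" using assms by (auto simp: regular_def)
  then show "series \<epsilon> M d $ 0 \<noteq> 0"
    using assms by (cases \<epsilon>) (auto simp: regular_def)
  then show "series \<epsilon> M d \<noteq> 0" by (metis fps_zero_nth)
qed

text \<open>A common factor \<open>g\<close> of numerator and denominator contributes the same
  series to both sides. This frees all later computations from the lowest terms in the definition of
  \<open>expansion\<close>.\<close>

lemma expansion_regular:
  assumes "regular f n d M"
  shows "expansion \<epsilon> f * series \<epsilon> M d = series \<epsilon> M n"
proof -
  have d0: "d \<noteq> 0" and f: "f = Fract n d" and deg: "degree d = M" "degree n \<le> M"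
    and c0: "poly.coeff d 0 \<noteq> 0"
    using assms by (auto simp: regular_def)
  obtain n' d' where q: "quot_of_fract f = (n', d')" by (metis surj_pair)
  note c = quot_of_fract_cross[OF d0 q[unfolded f]]
  obtain g where g: "d = d' * g" using c(4) by (auto simp: dvd_def)
  have g0: "g \<noteq> 0" using d0 g by auto
  have n: "n = n' * g" using c(1,2) g by auto
  have dn: "degree n' \<le> degree d'"
    using deg g n c(2) g0 by (cases "n' = 0") (auto simp: degree_mult_eq)
  have cd: "poly.coeff d' 0 \<noteq> 0" using c0 g by (auto simp: coeff_mult_0)
  have "expansion \<epsilon> f * series \<epsilon> (degree d') d' = series \<epsilon> (degree d') n'"
  proof (cases \<epsilon>)
    case Pos
    then show ?thesis using cd by (simp add: q fps_divide_unit mult.assoc inverse_mult_eq_1)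
  next
    case Neg
    have "fps_of_poly (reflect_poly d') $ 0 \<noteq> 0" using c(2) by simp
    then show ?thesis
      unfolding Neg using dn by (simp add: q fps_divide_unit mult.assoc inverse_mult_eq_1 series_Neg del: series.simps)
  qed
  moreover have "M = degree d' + degree g" using deg g c(2) g0 by (simp add: degree_mult_eq)
  ultimately show ?thesis
    unfolding g n using dn by (simp add: series_mult del: series.simps expansion.simps flip: mult.assoc)
qed

lemma expansion_unique:
  assumes "regular f n d M" "E * series \<epsilon> M d = series \<epsilon> M n"
  shows "expansion \<epsilon> f = E"
  using expansion_regular[OF assms(1), of \<epsilon>] regular_series_nonzero[OF assms(1), of \<epsilon>] assms(2)
  by (metis mult_right_cancel)

lemma expansion_mult:
  assumes "regular f n d M" "regular g n' d' M'"
  shows "expansion \<epsilon> (f * g) = expansion \<epsilon> f * expansion \<epsilon> g"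
proof (rule expansion_unique[OF regular_mult[OF assms]])
  have "degree n \<le> M" "degree d \<le> M" "degree n' \<le> M'" "degree d' \<le> M'"
    using assms by (auto simp: regular_def)
  then have "expansion \<epsilon> f * expansion \<epsilon> g * series \<epsilon> (M + M') (d * d')
    = (expansion \<epsilon> f * series \<epsilon> M d) * (expansion \<epsilon> g * series \<epsilon> M' d')"
    by (simp add: series_mult mult_ac del: series.simps expansion.simps)
  also have "\<dots> = series \<epsilon> (M + M') (n * n')"
    unfolding expansion_regular[OF assms(1)] expansion_regular[OF assms(2)]
    using \<open>degree n \<le> M\<close> \<open>degree n' \<le> M'\<close> by (simp add: series_mult del: series.simps)
  finally show "expansion \<epsilon> f * expansion \<epsilon> g * series \<epsilon> (M + M') (d * d') = series \<epsilon> (M + M') (n * n')" .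
qed

lemma expansion_one: "expansion \<epsilon> 1 = 1"
  by (rule expansion_unique[OF regular_one]) simp

definition bicoeff :: "sgn \<Rightarrow> ratfun \<Rightarrow> int \<Rightarrow> complex" where
  "bicoeff \<epsilon> f m = (if 0 \<le> sg \<epsilon> * m then fps_nth (expansion \<epsilon> f) (nat \<bar>m\<bar>) else 0)"

text \<open>Each term \<open>A / (1 - x z)\<close> of the partial fraction decomposition contributes \<open>A \<delta>(x z)\<close>.\<close>

lemma bicoeff_diff:
  fixes n :: "complex poly"
  assumes S: "finite S" "0 \<notin> S" and deg: "degree n \<le> card S"
    and f: "f = Fract n (\<Prod>x\<in>S. [:1, - x:])"
  shows "bicoeff Pos f m - bicoeff Neg f m =
    (\<Sum>x\<in>S. poly n (inverse x) / (\<Prod>y\<in>S - {x}. 1 - y / x) * x powi m)"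
proof -
  define D where "D = (\<lambda>T :: complex set. \<Prod>x\<in>T. [:1, - x:])"
  define A where "A = (\<lambda>x. poly n (inverse x) / (\<Prod>y\<in>S - {x}. 1 - y / x))"
  define k0 where "k0 = poly.coeff n (card S) / poly.coeff (D S) (card S)"
  have degD: "degree (D T) = card T" if "T \<subseteq> S" for T
  proof -
    have "degree (D T) = (\<Sum>x\<in>T. degree [:1, - x:])"
      unfolding D_def by (rule degree_prod_sum_eq) auto
    also have "\<dots> = (\<Sum>x\<in>T. 1)"
      by (rule sum.cong) (use that S(2) in auto)
    finally show ?thesis by simp
  qed
  have D0: "D T \<noteq> 0" for T unfolding D_def by (cases "finite T") auto
  have cD: "poly.coeff (D T) 0 = 1" for T
    unfolding D_def by (simp add: poly_0_coeff_0[symmetric] poly_prod)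
  have DS: "D S = D (S - {x}) * [:1, - x:]" if "x \<in> S" for x
    unfolding D_def using that S by (simp add: prod.remove mult.commute)
  have r: "regular f n (D S) (card S)"
    using f deg by (simp add: regular_def D_def[symmetric] degD cD)
  \<comment> \<open>The choice of \<open>k0\<close> cancels the top coefficient, so a nonzero
    difference would have degree below \<open>card S\<close>; but it vanishes at the
    \<open>card S\<close> points \<open>inverse x\<close>.\<close>
  have n_eq: "n = Polynomial.smult k0 (D S) + (\<Sum>x\<in>S. Polynomial.smult (A x) (D (S - {x})))" (is "n = ?R")
  proof (rule ccontr)
    assume "n \<noteq> ?R"
    then have P: "n - ?R \<noteq> 0" by simp
    have dR: "degree (Polynomial.smult (A x) (D (S - {x}))) \<le> card S - 1" if "x \<in> S" for x
      using that S degD[of "S - {x}"] by (intro order_trans[OF degree_smult_le]) (auto simp: card_Diff_singleton)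
    have "degree ?R \<le> card S"
      by (intro degree_add_le degree_sum_le S order_trans[OF degree_smult_le])
        (use degD dR in \<open>auto intro: order_trans[OF dR]\<close>)
    then have d1: "degree (n - ?R) \<le> card S" using deg by (intro degree_diff_le) auto
    have "poly.coeff (Polynomial.smult (A x) (D (S - {x}))) (card S) = 0" if "x \<in> S" for x
    proof -
      have "0 < card S" using that S by (auto simp: card_gt_0_iff)
      then show ?thesis using dR[OF that] by (intro coeff_eq_0) linarith
    qed
    then have "poly.coeff (\<Sum>x\<in>S. Polynomial.smult (A x) (D (S - {x}))) (card S) = 0"
      by (simp only: coeff_sum) (rule sum.neutral, blast)
    moreover have "poly.coeff (D S) (card S) \<noteq> 0"
      using D0[of S] degD[of S] by (metis leading_coeff_0_iff order_refl)
    ultimately have "poly.coeff (n - ?R) (card S) = 0"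
      by (simp add: k0_def)
    with P d1 have d2: "degree (n - ?R) < card S"
      by (metis leading_coeff_0_iff le_neq_implies_less)
    have "poly (n - ?R) (inverse x) = 0" if x: "x \<in> S" for x
    proof -
      have x0: "x \<noteq> 0" using x S by auto
      have pD: "poly (D T) (inverse x) = (\<Prod>y\<in>T. 1 - y / x)" for T
        unfolding D_def by (simp add: poly_prod divide_inverse mult.commute)
      have nz: "(\<Prod>y\<in>S - {x}. 1 - y / x) \<noteq> 0"
        using S x0 by auto
      have z: "(\<Prod>y\<in>T. 1 - y / x) = 0" if "x \<in> T" "T \<subseteq> S" for T
        using that S x0 finite_subset by (intro prod_zero) auto
      have "(\<Sum>y\<in>S. A y * (\<Prod>y\<in>S - {y}. 1 - y / x)) = (\<Sum>y\<in>S. if y = x then A x * (\<Prod>y\<in>S - {x}. 1 - y / x) else 0)"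
        by (rule sum.cong) (use z x in auto)
      also have "\<dots> = poly n (inverse x)"
        using S x nz by (simp add: A_def)
      finally show ?thesis using z[OF x] by (simp add: poly_sum pD)
    qed
    then have "inverse ` S \<subseteq> {x. poly (n - ?R) x = 0}" by auto
    then have "card (inverse ` S) \<le> card {x. poly (n - ?R) x = 0}"
      by (intro card_mono poly_roots_finite P)
    also have "\<dots> \<le> degree (n - ?R)" by (rule card_poly_roots_bound[OF P])
    finally show False using d2 card_image[of inverse S] by (simp add: inj_on_def)
  qed
  \<comment> \<open>The two expansions of \<open>1 / (1 - x z)\<close>. The constant term belongs to
    the one at zero, so their difference contains every power of \<open>z\<close> exactly
    once.\<close>
  define G where "G = (\<lambda>\<epsilon> x. case \<epsilon> of Pos \<Rightarrow> Abs_fps (\<lambda>n. x ^ n :: complex)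
    | Neg \<Rightarrow> Abs_fps (\<lambda>n. if n = 0 then 0 else - (inverse x ^ n)))"
  have G: "G \<epsilon> x * series \<epsilon> 1 [:1, - x:] = series \<epsilon> 1 1" if "x \<in> S" for \<epsilon> x
  proof -
    have x0: "x \<noteq> 0" using that S by auto
    show ?thesis
    proof (cases \<epsilon>)
      case Pos
      have e: "series Pos 1 [:1, - x:] = 1 - fps_const x * fps_X"
        by (simp add: fps_of_poly_linear')
      have "G Pos x * series Pos 1 [:1, - x:]
          = G Pos x - fps_const x * (fps_X * G Pos x)"
        unfolding e by (simp add: right_diff_distrib mult_ac)
      also have "\<dots> = 1"
      proof (rule fps_ext)
        show "(G Pos x - fps_const x * (fps_X * G Pos x)) $ n = 1 $ n" for n
          by (cases n) (simp_all add: G_def)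
      qed
      finally show ?thesis by (simp add: Pos)
    next
      case Neg
      have e: "series Neg 1 [:1, - x:] = fps_X - fps_const x" "series Neg 1 1 = fps_X"
        by (rule fps_ext, auto simp: fps_X_def le_Suc_eq)+
      have "G Neg x * series Neg 1 [:1, - x:] = fps_X * G Neg x - fps_const x * G Neg x"
        unfolding e by (simp add: right_diff_distrib mult_ac)
      also have "\<dots> = fps_X"
      proof (rule fps_ext)
        fix n
        show "(fps_X * G Neg x - fps_const x * G Neg x) $ n = fps_X $ n"
          using x0 by (cases n) (auto simp: G_def)
      qed
      finally show ?thesis by (simp only: Neg e)
    qed
  qed
  have E: "expansion \<epsilon> f = fps_const k0 + (\<Sum>x\<in>S. fps_const (A x) * G \<epsilon> x)" for \<epsilon>
  proof (rule expansion_unique[OF r])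
    have "G \<epsilon> x * series \<epsilon> (card S) (D S) = series \<epsilon> (card S) (D (S - {x}))" if "x \<in> S" for x
    proof -
      have cs: "card S = card (S - {x}) + 1" using card_Suc_Diff1[OF S(1) that] by linarith
      have "series \<epsilon> (card S) (D S) = series \<epsilon> (card (S - {x})) (D (S - {x})) * series \<epsilon> 1 [:1, - x:]"
        unfolding cs DS[OF that] by (rule series_mult) (use degD in auto)
      moreover have "series \<epsilon> (card S) (D (S - {x}) * 1) = series \<epsilon> (card (S - {x})) (D (S - {x})) * series \<epsilon> 1 1"
        unfolding cs by (rule series_mult) (use degD in auto)
      ultimately show ?thesis using G[OF that, of \<epsilon>] by (simp add: mult_ac del: series.simps)
    qed
    then show "(fps_const k0 + (\<Sum>x\<in>S. fps_const (A x) * G \<epsilon> x)) * series \<epsilon> (card S) (D S) = series \<epsilon> (card S) n"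
      by (subst n_eq)
        (simp add: series_add series_sum series_smult distrib_right sum_distrib_right mult.assoc del: series.simps)
  qed
  have nth: "expansion \<epsilon> f $ k = (if k = 0 then k0 else 0) + (\<Sum>x\<in>S. A x * (G \<epsilon> x $ k))" for \<epsilon> k
    unfolding E by (simp add: fps_sum_nth)
  have pw: "G Pos x $ nat m = x powi m" if "0 \<le> m" for x
    using that by (simp add: G_def power_int_def)
  have pwN: "G Neg x $ nat (- m) = - (x powi m)" if "m < 0" for x
    using that by (simp add: G_def power_int_def)
  have "bicoeff Pos f m - bicoeff Neg f m = (\<Sum>x\<in>S. A x * x powi m)"
  proof (cases "m = 0")
    case True
    then show ?thesis unfolding bicoeff_def nth by (simp add: G_def)
  next
    case False
    then consider "m > 0" | "m < 0" by linarith
    then show ?thesis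
      by cases (use pw pwN in \<open>auto simp: bicoeff_def nth sum_negf simp del: expansion.simps\<close>)
  qed
  then show ?thesis by (simp add: A_def)
qed

section \<open>Cancellation of poles in the eigenvalues of \<open>phi\<close>\<close>

context box_config
begin

text \<open>For entry \<open>i + 1\<close> the inverse of psi is rescaled to have the denominator
  \<open>1 - spec i r * z\<close>, the same as for entry \<open>i\<close>. Cancellations between
  different boxes become visible in this form.\<close>

definition box_num :: "int \<Rightarrow> int list \<Rightarrow> nat \<Rightarrow> complex poly" where
  "box_num i js r = (if js ! r = i then [:q, - (inverse q * spec i r):]
     else if js ! r = i + 1 then [:inverse q, - (q * spec i r):] else 1)"

definition box_den :: "int \<Rightarrow> int list \<Rightarrow> nat \<Rightarrow> complex poly" where
  "box_den i js r = (if js ! r = i \<or> js ! r = i + 1 then [:1, - spec i r:] else 1)"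

lemma box_den_nonzero [simp]: "box_den i js r \<noteq> 0"
  by (simp add: box_den_def)

lemma params_nth: "r < N \<Longrightarrow> params ! r = a * q powi (2 * kap r)"
  by (simp add: params_def)

lemma length_params [simp]: "length params = N"
  by (simp add: params_def)

lemma params_spec: "r < N \<Longrightarrow> params ! r * q powi i = spec i r"
  by (simp add: params_nth spec_def power_int_add)

lemma box_phi_regular:
  assumes "r < N"
  shows "regular (box_phi t i (params ! r, js ! r)) (box_num i js r) (box_den i js r) (degree (box_den i js r))"
proof -
  have c: "params ! r * q powi (i + 2) = q\<^sup>2 * spec i r"
    using assms by (simp add: params_nth spec_def power_int_add power2_eq_square)
  have "Fract [:1, - (q\<^sup>2 * spec i r):] [:q, - (inverse q * (q\<^sup>2 * spec i r)):]
      = Fract [:inverse q, - (q * spec i r):] [:1, - spec i r:]"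
    by (subst eq_fract) (auto simp: power2_eq_square)
  then show ?thesis
    using assms c
    by (auto simp: regular_def box_phi_def box_num_def box_den_def psi_def params_spec One_fract_def add.commute)
qed

lemma box_phi_Fract: "r < N \<Longrightarrow> box_phi t i (params ! r, js ! r) = Fract (box_num i js r) (box_den i js r)"
  using box_phi_regular by (simp add: regular_def)

lemma Fract_prod:
  "(\<Prod>r\<in>A. Fract (f r) (g r)) = Fract (\<Prod>r\<in>A. f r) (\<Prod>r\<in>A. g r)"
  if "\<And>r. r \<in> A \<Longrightarrow> g r \<noteq> (0 :: complex poly)"
  using that by (induction A rule: infinite_finite_induct) (auto simp: One_fract_def)

lemma tensor_phi_prod:
  assumes "length js = N"
  shows "tensor_phi t params i js = (\<Prod>r<N. box_phi t i (params ! r, js ! r))"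
    and "p < N \<Longrightarrow> tensor_phi t (take p params) i (take p js) = (\<Prod>r | r < N \<and> bef Pos r p. box_phi t i (params ! r, js ! r))"
    and "p < N \<Longrightarrow> tensor_phi t (drop (Suc p) params) i (drop (Suc p) js) = (\<Prod>r | r < N \<and> bef Neg r p. box_phi t i (params ! r, js ! r))"
proof -
  show "tensor_phi t params i js = (\<Prod>r<N. box_phi t i (params ! r, js ! r))"
    using assms by (simp add: tensor_phi_def prod.list_conv_set_nth atLeast0LessThan)
  have "{r. r < N \<and> r < p} = {..<p}" if "p < N" using that by auto
  then show "p < N \<Longrightarrow> tensor_phi t (take p params) i (take p js) = (\<Prod>r | r < N \<and> bef Pos r p. box_phi t i (params ! r, js ! r))"
    using assms by (simp add: tensor_phi_def prod.list_conv_set_nth atLeast0LessThan)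
  assume p: "p < N"
  have "tensor_phi t (drop (Suc p) params) i (drop (Suc p) js)
      = (\<Prod>r<N - Suc p. box_phi t i (params ! (Suc p + r), js ! (Suc p + r)))"
    using assms p by (simp add: tensor_phi_def prod.list_conv_set_nth atLeast0LessThan)
  also have "\<dots> = (\<Prod>r | r < N \<and> bef Neg r p. box_phi t i (params ! r, js ! r))"
    by (rule prod.reindex_bij_witness[of _ "\<lambda>r. r - Suc p" "\<lambda>r. Suc p + r"]) auto
  finally show "tensor_phi t (drop (Suc p) params) i (drop (Suc p) js) = (\<Prod>r | r < N \<and> bef Neg r p. box_phi t i (params ! r, js ! r))" .
qed

text \<open>True at the pole as well: there both sides are quotients by zero.\<close>

lemma box_num_eval:
  "poly (box_num i js r) (inverse (spec i p)) / poly (box_den i js r) (inverse (spec i p)) = fac t i (js ! r) (kap r - kap p)"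
proof -
  have "spec i r / spec i p = q powi (2 * (kap r - kap p))"
    using spec_ratio[of i r i p] by simp
  then have c: "inverse (spec i p) * spec i r = q powi (2 * (kap r - kap p))"
    by (simp add: divide_inverse mult.commute)
  define d where "d = kap r - kap p"
  show ?thesis
    using c unfolding box_num_def box_den_def fac_def psi_val_minus d_def[symmetric]
    by (simp add: mult.left_commute[of "inverse (spec i p)"] psi_val_def)
qed

lemma box_den_eval_0_iff:
  "poly (box_den i js r) (inverse (spec i p)) = 0 \<longleftrightarrow> (js ! r = i \<or> js ! r = i + 1) \<and> kap r = kap p"
proof -
  have "1 = inverse (spec i p) * spec i r \<longleftrightarrow> spec i r = spec i p"
    by (auto simp: field_simps)
  then show ?thesis by (auto simp: box_den_def spec_eq_iff)
qed

text \<open>A numerator cancelling the denominator of a neighbour on the next diagonal.\<close>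

lemma box_num_neighbour:
  "js ! s = i \<Longrightarrow> kap s = kap r + 1 \<Longrightarrow> box_num i js s = Polynomial.smult q [:1, - spec i r:]"
  "js ! s = i + 1 \<Longrightarrow> kap s = kap r - 1 \<Longrightarrow> box_num i js s = Polynomial.smult (inverse q) [:1, - spec i r:]"
proof -
  have c: "spec i s = spec i r * q powi (2 * d)" if "kap s = kap r + d" for d
    using spec_ratio[of i s i r] that by simp
  show "js ! s = i \<Longrightarrow> kap s = kap r + 1 \<Longrightarrow> box_num i js s = Polynomial.smult q [:1, - spec i r:]"
    using c[of 1] by (auto simp: box_num_def power2_eq_square field_simps)
  have "spec i s = inverse (q\<^sup>2) * spec i r" if "kap s = kap r - 1"
    using c[of "-1"] that by (simp add: power_int_minus mult.commute)
  then show "js ! s = i + 1 \<Longrightarrow> kap s = kap r - 1 \<Longrightarrow> box_num i js s = Polynomial.smult (inverse q) [:1, - spec i r:]"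
    by (auto simp: box_num_def power2_eq_square field_simps)
qed

lemma box_num_neighbour_eval:
  "js ! s = i \<and> kap s = kap r + 1 \<or> js ! s = i + 1 \<and> kap s = kap r - 1 \<Longrightarrow>
   poly (box_num i js s) (inverse (spec i r)) = 0"
  using box_num_neighbour[of js s i r] by auto

text \<open>The justification of the convention for division by zero. At most one box on the
  relevant side is at its pole, and it forms a square with \<open>p\<close>. The numerator of one
  further corner cancels the pole, that of the other vanishes, so the true value is 0 as
  well.\<close>

lemma rat_eval_coef:
  assumes js: "js \<in> B" and p: "p < N" and src: "js ! p = src \<epsilon> i"
  shows "rat_eval (\<Prod>r | r < N \<and> bef \<epsilon> r p. box_phi t i (params ! r, js ! r)) (inverse (spec i p))
    = coef \<epsilon> i js p"
proof -
  define R where "R = {r. r < N \<and> bef \<epsilon> r p}"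
  have R: "finite R" "\<And>r. r \<in> R \<Longrightarrow> r < N" "p \<notin> R" by (auto simp: R_def)
  let ?x = "inverse (spec i p)"
  have "(\<Prod>r\<in>R. box_phi t i (params ! r, js ! r)) = (\<Prod>r\<in>R. Fract (box_num i js r) (box_den i js r))"
    using R by (intro prod.cong box_phi_Fract) auto
  then have f: "(\<Prod>r\<in>R. box_phi t i (params ! r, js ! r)) = Fract (\<Prod>r\<in>R. box_num i js r) (\<Prod>r\<in>R. box_den i js r)"
    by (simp add: Fract_prod)
  have coef: "coef \<epsilon> i js p = (\<Prod>r\<in>R. poly (box_num i js r) ?x / poly (box_den i js r) ?x)"
    by (simp add: coef_def R_def box_num_eval)
  have "rat_eval (\<Prod>r\<in>R. box_phi t i (params ! r, js ! r)) ?x = coef \<epsilon> i js p"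
  proof (cases "\<exists>r\<in>R. poly (box_den i js r) ?x = 0")
    case False
    then have "poly (\<Prod>r\<in>R. box_den i js r) ?x \<noteq> 0" using R by (simp add: poly_prod)
    then show ?thesis
      unfolding f coef by (simp add: rat_eval_Fract poly_prod prod_dividef)
  next
    case True
    then obtain r0 where r0: "r0 \<in> R" "js ! r0 = i \<or> js ! r0 = i + 1" "kap r0 = kap p"
      by (auto simp: box_den_eval_0_iff)
    have uniq: "r = r0" if "r \<in> R" "js ! r = i \<or> js ! r = i + 1" "kap r = kap p" for r
    proof -
      have "js ! r \<noteq> src \<epsilon> i" "js ! r0 \<noteq> src \<epsilon> i"
        using same_diag_same_entry[OF js _ p, of r] same_diag_same_entry[OF js _ p, of r0] that r0 R src
        by auto
      then have "js ! r = js ! r0" using that r0 by (cases \<epsilon>) auto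
      then show ?thesis using same_diag_same_entry[OF js, of r r0] that r0 R by auto
    qed
    have neq: "js ! r0 \<noteq> js ! p"
      using same_diag_same_entry[OF js _ p, of r0] r0 R by auto
    have "\<exists>s\<in>R. \<exists>s'\<in>R. js ! s = i \<and> kap s = kap p + 1 \<and> js ! s' = i + 1 \<and> kap s' = kap p - 1"
    proof (cases \<epsilon>)
      case Pos
      then have "r0 < p" "js ! p = i + 1" "js ! r0 = i" using r0 src neq by (auto simp: R_def)
      then obtain s s' where "r0 < s" "s < p" "js ! s = i" "kap s = kap r0 + 1"
        "r0 < s'" "s' < p" "js ! s' = i + 1" "kap s' = kap r0 - 1"
        using B_square[OF js _ p, of r0] r0(3) by auto
      then show ?thesis using Pos p r0 unfolding R_def
        by (intro bexI[of _ s] bexI[of _ s']) auto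
    next
      case Neg
      then have "p < r0" "r0 < N" "js ! p = i" "js ! r0 = i + 1" using r0 src neq by (auto simp: R_def)
      then obtain s s' where "p < s" "s < r0" "js ! s = i" "kap s = kap p + 1"
        "p < s'" "s' < r0" "js ! s' = i + 1" "kap s' = kap p - 1"
        using B_square[OF js, of p r0] r0(3) by auto
      then show ?thesis using Neg \<open>r0 < N\<close> unfolding R_def
        by (intro bexI[of _ s] bexI[of _ s']) auto
    qed
    then obtain s s' where s: "s \<in> R" "js ! s = i" "kap s = kap p + 1"
      "s' \<in> R" "js ! s' = i + 1" "kap s' = kap p - 1" by blast
    have ss: "s \<noteq> s'" using s by auto
    have "box_num i js s' = Polynomial.smult (inverse q) (box_den i js r0)"
      using box_num_neighbour(2)[of js s' i r0] s r0 by (simp add: box_den_def)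
    then have "(\<Prod>r\<in>R. box_num i js r) = Polynomial.smult (inverse q) (box_den i js r0) * (\<Prod>r\<in>R - {s'}. box_num i js r)"
      using R s by (simp add: prod.remove[of R s'])
    moreover have "(\<Prod>r\<in>R. box_den i js r) = box_den i js r0 * (\<Prod>r\<in>R - {r0}. box_den i js r)"
      using R r0 by (simp add: prod.remove[of R r0])
    ultimately have f': "(\<Prod>r\<in>R. box_phi t i (params ! r, js ! r))
      = Fract (Polynomial.smult (inverse q) (\<Prod>r\<in>R - {s'}. box_num i js r)) (\<Prod>r\<in>R - {r0}. box_den i js r)"
      unfolding f using R by (subst eq_fract) (auto simp: mult_ac)
    have "poly (box_den i js r) ?x \<noteq> 0" if "r \<in> R - {r0}" for r
      using uniq[of r] that by (auto simp: box_den_eval_0_iff)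
    then have "poly (\<Prod>r\<in>R - {r0}. box_den i js r) ?x \<noteq> 0"
      using R by (simp add: poly_prod)
    moreover have "(\<Prod>r\<in>R - {s'}. poly (box_num i js r) ?x) = 0"
      using s R ss box_num_neighbour_eval[of js s i p] by (intro prod_zero) auto
    ultimately have "rat_eval (\<Prod>r\<in>R. box_phi t i (params ! r, js ! r)) ?x = 0"
      unfolding f' by (simp add: rat_eval_Fract poly_prod)
    moreover have "coef \<epsilon> i js p = 0"
      unfolding coef using s R box_num_neighbour_eval[of js s i p] by (intro prod_zero) auto
    ultimately show ?thesis by simp
  qed
  then show ?thesis by (simp add: R_def)
qed

lemma full_eq_0:
  assumes "s < N" "s \<noteq> p" "js ! s = i \<and> kap s = kap p + 1 \<or> js ! s = i + 1 \<and> kap s = kap p - 1"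
  shows "full i js p = 0"
proof -
  have "fac t i (js ! s) (kap s - kap p) = 0" using assms(3) by (auto simp: fac_def)
  then show ?thesis unfolding full_def using assms(1,2) by (intro prod_zero) auto
qed

text \<open>A diagonal carrying both \<open>i\<close> and \<open>i + 1\<close> seems to give a
  double pole. The square spanned by these boxes reduces it to a removable singularity, so every
  remaining pole is simple and \<open>bicoeff_diff\<close> applies.\<close>

lemma residues:
  assumes js: "js \<in> B"
  shows "bicoeff Pos (tensor_phi t params i js) m - bicoeff Neg (tensor_phi t params i js) m
    = (q - inverse q) * (\<Sum>p<N. if js ! p = i then spec i p powi m * full i js p
        else if js ! p = i + 1 then - (spec i p powi m * full i js p) else 0)"
proof -
  define U where "U = {r. r < N \<and> (js ! r = i \<or> js ! r = i + 1)}"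
  \<comment> \<open>One box for each diagonal with both entries, namely the one whose denominator
    will be cancelled. The boxes of \<open>U - I\<close> then lie on different diagonals.\<close>
  define I where "I = {r \<in> U. js ! r = i + 1 \<and> (\<exists>r'\<in>U. js ! r' = i \<and> kap r' = kap r)}"
  have fin: "finite U" "finite I" and sub: "I \<subseteq> U" "\<And>r. r \<in> U \<Longrightarrow> r < N"
    by (auto simp: U_def I_def)
  have inj: "r = r'" if "r \<in> U - I" "r' \<in> U - I" "kap r = kap r'" for r r'
  proof -
    have "js ! r = js ! r'" using that by (auto simp: U_def I_def)
    then show ?thesis using same_diag_same_entry[OF js, of r r'] that by (auto simp: U_def)
  qed
  have sq: "(\<exists>s\<in>U. js ! s = i \<and> kap s = kap r + 1) \<and> (\<exists>s\<in>U. js ! s = i + 1 \<and> kap s = kap r - 1)"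
    if "r \<in> I" for r
  proof -
    from that obtain r' where r': "r' < N" "js ! r' = i" "kap r' = kap r" "r < N" "js ! r = i + 1"
      by (auto simp: I_def U_def)
    then have "r' < r"
      using B_diag[OF js, of r r'] by (cases r r' rule: linorder_cases) auto
    then show ?thesis
      using B_square[OF js, of r' r] r' by (fastforce simp: U_def)
  qed
  \<comment> \<open>The numerator at the corner \<open>\<sigma> r\<close> is \<open>q\<close> times
    the denominator at \<open>r\<close>; injectivity of \<open>\<sigma>\<close> lets all these
    cancellations be carried out at once.\<close>
  then obtain \<sigma> where \<sigma>: "\<And>r. r \<in> I \<Longrightarrow> \<sigma> r \<in> U \<and> js ! \<sigma> r = i \<and> kap (\<sigma> r) = kap r + 1"
    by metis
  have inj\<sigma>: "inj_on \<sigma> I"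
  proof (rule inj_onI)
    fix r r' assume r: "r \<in> I" "r' \<in> I" "\<sigma> r = \<sigma> r'"
    then have "kap r = kap r'" using \<sigma>[of r] \<sigma>[of r'] by simp
    then show "r = r'" using same_diag_same_entry[OF js, of r r'] r by (auto simp: I_def U_def)
  qed
  define n where "n = Polynomial.smult (q ^ card I) (\<Prod>r\<in>U - \<sigma> ` I. box_num i js r)"
  have \<sigma>U: "\<sigma> ` I \<subseteq> U" using \<sigma> by auto
  have "(\<Prod>r\<in>\<sigma> ` I. box_num i js r) = (\<Prod>r\<in>I. Polynomial.smult q (box_den i js r))"
    unfolding prod.reindex[OF inj\<sigma>] comp_def
    by (rule prod.cong) (use \<sigma> box_num_neighbour(1) in \<open>auto simp: box_den_def I_def\<close>)
  also have "\<dots> = Polynomial.smult (q ^ card I) (\<Prod>r\<in>I. box_den i js r)"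
    by (simp add: prod_smult)
  finally have n_I: "(\<Prod>r\<in>U. box_num i js r) = n * (\<Prod>r\<in>I. box_den i js r)"
    using prod.subset_diff[OF \<sigma>U fin(1), of "box_num i js"] by (simp add: n_def mult.commute)
  have d_I: "(\<Prod>r\<in>U. box_den i js r) = (\<Prod>r\<in>U - I. box_den i js r) * (\<Prod>r\<in>I. box_den i js r)"
    using prod.subset_diff[OF sub(1) fin(1)] by simp
  have "tensor_phi t params i js = (\<Prod>r<N. Fract (box_num i js r) (box_den i js r))"
    unfolding tensor_phi_prod(1)[OF B_length[OF js]] by (intro prod.cong box_phi_Fract) auto
  also have "\<dots> = (\<Prod>r\<in>U. Fract (box_num i js r) (box_den i js r))"
    by (rule prod.mono_neutral_right) (auto simp: U_def box_num_def box_den_def One_fract_def)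
  also have "\<dots> = Fract (\<Prod>r\<in>U. box_num i js r) (\<Prod>r\<in>U. box_den i js r)"
    by (simp add: Fract_prod)
  also have "\<dots> = Fract n (\<Prod>r\<in>U - I. box_den i js r)"
    unfolding n_I d_I using fin by (subst eq_fract) auto
  also have "(\<Prod>r\<in>U - I. box_den i js r) = (\<Prod>r\<in>U - I. [:1, - spec i r:])"
    by (rule prod.cong) (auto simp: box_den_def U_def)
  also have "\<dots> = (\<Prod>x\<in>spec i ` (U - I). [:1, - x:])"
    by (subst prod.reindex) (auto intro!: inj_onI inj simp: spec_eq_iff)
  finally have f: "tensor_phi t params i js = Fract n (\<Prod>x\<in>spec i ` (U - I). [:1, - x:])" .
  have injc: "inj_on (spec i) (U - I)" by (auto intro!: inj_onI inj simp: spec_eq_iff)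
  have "degree n \<le> (\<Sum>r\<in>U - \<sigma> ` I. degree (box_num i js r))"
    unfolding n_def using degree_prod_sum_le[of "U - \<sigma> ` I" "box_num i js"] fin
    by (simp add: comp_def)
  also have "\<dots> \<le> (\<Sum>r\<in>U - \<sigma> ` I. 1)" by (rule sum_mono) (auto simp: box_num_def)
  also have "\<dots> = card (U - I)"
    using \<sigma>U sub fin by (simp add: card_Diff_subset card_image[OF inj\<sigma>] finite_subset)
  finally have deg: "degree n \<le> card (spec i ` (U - I))" by (simp add: card_image[OF injc])
  define A where "A = (\<lambda>p. poly n (inverse (spec i p)) / (\<Prod>y\<in>spec i ` (U - I) - {spec i p}. 1 - y / spec i p))"
  have A: "A p = (q - inverse q) * (if js ! p = i then full i js p else - full i js p)"
    if p: "p \<in> U - I" for p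
  proof -
    let ?x = "inverse (spec i p)"
    have "spec i ` (U - I) - {spec i p} = spec i ` (U - I - {p})"
      using inj p by (auto simp: spec_eq_iff)
    then have A1: "A p = poly n ?x / (\<Prod>r\<in>U - I - {p}. 1 - spec i r / spec i p)"
      unfolding A_def using injc by (simp add: prod.reindex inj_on_diff)
    have "(\<Prod>r\<in>U - I - {p}. 1 - spec i r / spec i p) = (\<Prod>r\<in>U - I - {p}. poly (box_den i js r) ?x)"
      by (rule prod.cong) (auto simp: box_den_def U_def divide_inverse mult.commute)
    note A1 = A1[unfolded this]
    have full: "full i js p = (\<Prod>r\<in>U - {p}. poly (box_num i js r) ?x / poly (box_den i js r) ?x)"
      unfolding full_def box_num_eval
      by (rule prod.mono_neutral_right) (auto simp: U_def fac_def)
    show ?thesis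
    proof (cases "\<exists>r\<in>I. kap r = kap p")
      case True
      then obtain r where r: "r \<in> I" "kap r = kap p" by blast
      then obtain s where s: "s \<in> U" "js ! s = i + 1" "kap s = kap p - 1" using sq by metis
      have "s \<notin> \<sigma> ` I" using \<sigma> s by auto
      then have "(\<Prod>r\<in>U - \<sigma> ` I. poly (box_num i js r) ?x) = 0"
        using s fin box_num_neighbour_eval[of js s i p] by (intro prod_zero) auto
      then have "A p = 0" unfolding A1 n_def by (simp add: poly_prod)
      moreover have "full i js p = 0" using full_eq_0[of s p js i] s sub by (cases "s = p") auto
      ultimately show ?thesis by simp
    next
      case False
      have *: "a / y = u / v" if "a * x = u" "v = y * x" "x \<noteq> 0" for a x y u v :: complex
        using that by (auto simp flip: that(1))
      from False have nzI: "(\<Prod>r\<in>I. poly (box_den i js r) ?x) \<noteq> 0"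
        using fin by (auto simp: box_den_eval_0_iff)
      have "poly n ?x * (\<Prod>r\<in>I. poly (box_den i js r) ?x) = (\<Prod>r\<in>U. poly (box_num i js r) ?x)"
        using arg_cong[OF n_I, of "\<lambda>P. poly P ?x"] by (simp add: poly_prod)
      moreover have "U - {p} = (U - I - {p}) \<union> I" "(U - I - {p}) \<inter> I = {}"
        using p sub by auto
      then have "(\<Prod>r\<in>U - {p}. poly (box_den i js r) ?x)
        = (\<Prod>r\<in>U - I - {p}. poly (box_den i js r) ?x) * (\<Prod>r\<in>I. poly (box_den i js r) ?x)"
        using fin prod.union_disjoint[of "U - I - {p}" I] by simp
      ultimately have "A p = (\<Prod>r\<in>U. poly (box_num i js r) ?x) / (\<Prod>r\<in>U - {p}. poly (box_den i js r) ?x)"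
        unfolding A1 using nzI by (intro *)
      also have "\<dots> = poly (box_num i js p) ?x * full i js p"
        unfolding full using p fin by (simp add: prod.remove[of U p] prod_dividef)
      \<comment> \<open>The numerator of \<open>p\<close> at its own support supplies the constant
        \<open>q - 1/q\<close> and the sign that distinguishes the two halves of the
        commutator.\<close>
      also have "poly (box_num i js p) ?x = (if js ! p = i then q - inverse q else inverse q - q)"
        using p by (auto simp: box_num_def U_def)
      finally show ?thesis by (auto simp: algebra_simps)
    qed
  qed
  \<comment> \<open>Thus the sum may be extended from the poles \<open>U - I\<close> to all of
    \<open>U\<close>.\<close>
  have zI: "full i js p = 0" if "p \<in> I" for p
  proof -
    obtain s where s: "s \<in> U" "js ! s = i + 1" "kap s = kap p - 1" using sq[OF \<open>p \<in> I\<close>] by blast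
    then show ?thesis using full_eq_0[of s p js i] sub by (cases "s = p") auto
  qed
  have "bicoeff Pos (tensor_phi t params i js) m - bicoeff Neg (tensor_phi t params i js) m
    = (\<Sum>x\<in>spec i ` (U - I). poly n (inverse x) / (\<Prod>y\<in>spec i ` (U - I) - {x}. 1 - y / x) * x powi m)"
    by (rule bicoeff_diff) (use fin deg f in \<open>auto simp del: params_def\<close>)
  also have "\<dots> = (\<Sum>p\<in>U - I. A p * spec i p powi m)"
    by (simp add: sum.reindex[OF injc] A_def)
  also have "\<dots> = (\<Sum>p\<in>U - I. (q - inverse q) * (if js ! p = i then spec i p powi m * full i js p
        else - (spec i p powi m * full i js p)))"
    by (rule sum.cong) (auto simp: A)
  also have "\<dots> = (\<Sum>p\<in>U. (q - inverse q) * (if js ! p = i then spec i p powi m * full i js p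
        else - (spec i p powi m * full i js p)))"
    by (rule sum.mono_neutral_left) (use fin zI in auto)
  also have "\<dots> = (q - inverse q) * (\<Sum>p\<in>U. (if js ! p = i then spec i p powi m * full i js p
        else - (spec i p powi m * full i js p)))"
    by (simp only: sum_distrib_left)
  also have "(\<Sum>p\<in>U. (if js ! p = i then spec i p powi m * full i js p
        else - (spec i p powi m * full i js p)))
      = (\<Sum>p<N. if js ! p = i then spec i p powi m * full i js p
        else if js ! p = i + 1 then - (spec i p powi m * full i js p) else 0)"
    by (rule sum.mono_neutral_cong_left) (auto simp: U_def)
  finally show ?thesis .
qed

section \<open>The action of the generators\<close>

lemma sum_list_nth: "length js = N \<Longrightarrow> (\<Sum>j\<leftarrow>js. f j) = (\<Sum>r<N. f (js ! r))"
  by (simp add: sum_list_sum_nth atLeast0LessThan)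

lemma qpow_of_int: "qpow t (of_int n) = q powi n"
  by (simp add: qpow_def exp_power_int mult.commute)

lemma qpow_add: "qpow t (x + y) = qpow t x * qpow t y"
  by (simp add: qpow_def of_rat_add distrib_left exp_add)

lemma qpow_zero [simp]: "qpow t 0 = 1"
  by (simp add: qpow_def)

lemma qpow_sum: "qpow t (\<Sum>x\<in>A. f x) = (\<Prod>x\<in>A. qpow t (f x))"
  by (induction A rule: infinite_finite_induct) (auto simp: qpow_add)

lemma tensor_weight_add: "tensor_weight js (h + h') = tensor_weight js h + tensor_weight js h'"
  by (simp add: tensor_weight_def lookup_add algebra_simps flip: sum_list_addf)

lemma tensor_weight_zero [simp]: "tensor_weight js 0 = 0"
  by (simp add: tensor_weight_def)

lemma tensor_weight_upd:
  assumes "length js = N" "p < N"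
  shows "tensor_weight (js[p := x]) h = tensor_weight js h
    + (Poly_Mapping.lookup h x - Poly_Mapping.lookup h (x - 1))
    - (Poly_Mapping.lookup h (js ! p) - Poly_Mapping.lookup h (js ! p - 1))"
proof -
  have "(\<Sum>r\<in>{..<N} - {p}. Poly_Mapping.lookup h (js[p := x] ! r) - Poly_Mapping.lookup h (js[p := x] ! r - 1))
    = (\<Sum>r\<in>{..<N} - {p}. Poly_Mapping.lookup h (js ! r) - Poly_Mapping.lookup h (js ! r - 1))"
    by (rule sum.cong) auto
  then show ?thesis
    using assms by (simp add: tensor_weight_def sum_list_nth sum.remove[of "{..<N}" p])
qed

definition E :: "sgn \<Rightarrow> int \<Rightarrow> int list \<Rightarrow> complex fps" where
  "E \<epsilon> i js = expansion \<epsilon> (tensor_phi t params i js)"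

lemma prod_regular:
  assumes "finite A" "\<And>r. r \<in> A \<Longrightarrow> r < N"
  shows "(\<exists>n d M. regular (\<Prod>r\<in>A. box_phi t i (params ! r, js ! r)) n d M) \<and>
    expansion \<epsilon> (\<Prod>r\<in>A. box_phi t i (params ! r, js ! r)) = (\<Prod>r\<in>A. expansion \<epsilon> (box_phi t i (params ! r, js ! r)))"
  using assms
proof (induction A)
  case empty
  show ?case using regular_one expansion_one by auto
next
  case (insert x A)
  then obtain n d M where r: "regular (\<Prod>r\<in>A. box_phi t i (params ! r, js ! r)) n d M" by auto
  from insert.prems have "x < N" by simp
  note rx = box_phi_regular[OF this, of i js]
  show ?case
    using insert regular_mult[OF rx r] expansion_mult[OF rx r, of \<epsilon>]
    by (auto simp del: expansion.simps)
qed

lemma E_prod: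
  assumes "length js = N"
  shows "E \<epsilon> i js = (\<Prod>r<N. expansion \<epsilon> (box_phi t i (params ! r, js ! r)))"
  unfolding E_def tensor_phi_prod(1)[OF assms] using prod_regular[of "{..<N}"] by blast

lemma expansion_box_nth_0:
  assumes "r < N"
  shows "expansion \<epsilon> (box_phi t i (params ! r, js ! r)) $ 0
    = (if js ! r = i then q powi sg \<epsilon> else if js ! r = i + 1 then q powi (- sg \<epsilon>) else 1)"
proof -
  note r = box_phi_regular[OF assms, of i js]
  have "expansion \<epsilon> (box_phi t i (params ! r, js ! r)) $ 0 * series \<epsilon> (degree (box_den i js r)) (box_den i js r) $ 0
    = series \<epsilon> (degree (box_den i js r)) (box_num i js r) $ 0"
    using arg_cong[OF expansion_regular[OF r, of \<epsilon>], of "\<lambda>f. f $ 0"]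
    by (simp only: fps_mult_nth_0)
  then show ?thesis
    by (cases \<epsilon>) (auto simp: series_nth_0 box_num_def box_den_def power_int_minus simp del: expansion.simps series.simps)
qed

text \<open>The series of \<open>phi\<close> begins with the element \<open>K\<close> of plus or
  minus \<open>h\<^sub>i\<close>. The operator chosen for \<open>K\<close> must therefore agree with
  the constant term of the expanded eigenvalue.\<close>

lemma E_nth_0:
  assumes l: "length js = N"
  shows "E \<epsilon> i js $ 0 = qpow t (tensor_weight js (Poly_Mapping.single i (of_int (sg \<epsilon>))))"
proof -
  have "E \<epsilon> i js $ 0 = (\<Prod>r<N. expansion \<epsilon> (box_phi t i (params ! r, js ! r)) $ 0)"
  proof -
    have "(\<Prod>r<n. f r) $ 0 = (\<Prod>r<n. f r $ 0)" for f :: "nat \<Rightarrow> complex fps" and n :: nat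
      by (induction n) simp_all
    then show ?thesis unfolding E_prod[OF l] .
  qed
  also have "\<dots> = (\<Prod>r<N. qpow t (of_int ((if js ! r = i then sg \<epsilon> else 0) - (if js ! r = i + 1 then sg \<epsilon> else 0))))"
    by (rule prod.cong) (auto simp: expansion_box_nth_0 simp del: expansion.simps simp flip: qpow_of_int)
  also have "\<dots> = qpow t (tensor_weight js (Poly_Mapping.single i (of_int (sg \<epsilon>))))"
    unfolding tensor_weight_def sum_list_nth[OF l] qpow_sum
    by (intro prod.cong refl arg_cong[of _ _ "qpow t"]) (auto simp: lookup_single when_def)
  finally show ?thesis .
qed

lemma qpow_nonzero [simp]: "qpow t x \<noteq> 0"
  by (simp add: qpow_def)

text \<open>Since \<open>fps_ln 1\<close> is the series of \<open>log (1 + X)\<close>, this is the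
  logarithm of the expansion normalized to constant term 1.\<close>

definition L :: "sgn \<Rightarrow> int \<Rightarrow> int list \<Rightarrow> complex fps" where
  "L \<epsilon> i js = fps_ln 1 oo (fps_const (inverse (E \<epsilon> i js $ 0)) * E \<epsilon> i js - 1)"

lemma L_nth_0: "L \<epsilon> i js $ 0 = 0"
  by (simp add: L_def)

lemma fps_exp_L:
  assumes "length js = N"
  shows "fps_const (E \<epsilon> i js $ 0) * (fps_exp 1 oo L \<epsilon> i js) = E \<epsilon> i js"
proof -
  define g where "g = fps_const (inverse (E \<epsilon> i js $ 0)) * E \<epsilon> i js - 1"
  have E0: "E \<epsilon> i js $ 0 \<noteq> 0" using E_nth_0[OF assms] by simp
  then have g0: "g $ 0 = 0" by (simp add: g_def)
  have "(fps_exp 1 - 1) oo fps_ln (1::complex) = fps_X"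
    unfolding fps_ln_fps_exp_inv[OF one_neq_zero] by (rule fps_inv_right) auto
  then have "(fps_exp 1 - 1) oo (fps_ln 1 oo g) = g"
    using fps_compose_assoc[OF g0, of "fps_ln 1" "fps_exp (1::complex) - 1"] g0 by simp
  then have "(fps_exp 1 oo L \<epsilon> i js) - 1 = g"
    by (simp add: L_def g_def[symmetric] fps_compose_sub_distrib)
  then have "fps_exp 1 oo L \<epsilon> i js = fps_const (inverse (E \<epsilon> i js $ 0)) * E \<epsilon> i js"
    by (simp add: g_def)
  then show ?thesis using E0 by (simp flip: mult.assoc)
qed

text \<open>The solution of the exponential formula for \<open>phi\<close>, with the sign of the
  lower half put in by hand. The value at \<open>m = 0\<close> is forced by the relator for
  \<open>H i 0\<close>.\<close>

definition h_val :: "int \<Rightarrow> int \<Rightarrow> int list \<Rightarrow> complex" where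
  "h_val i m js = (if m = 0 then 0 else if m > 0 then L Pos i js $ nat m / (q - inverse q)
     else - (L Neg i js $ nat (- m) / (q - inverse q)))"

definition x_basis :: "sgn \<Rightarrow> int \<Rightarrow> int \<Rightarrow> int list \<Rightarrow> tensor" where
  "x_basis \<epsilon> i r js = (\<Sum>p<N. tscale (spec i p powi r) (move_basis \<epsilon> i p js))"

fun G :: "gen \<Rightarrow> int list \<Rightarrow> tensor" where
  "G (X \<epsilon> i r) js = x_basis \<epsilon> i r js"
| "G (K h) js = tscale (qpow t (tensor_weight js h)) (boxes js)"
| "G (H i m) js = tscale (h_val i m js) (boxes js)"

lemma x_basis_tensor_x:
  assumes js: "js \<in> B"
  shows "tensor_x t params \<epsilon> i r js = x_basis \<epsilon> i r js"
proof -
  have "tensor_x t params \<epsilon> i r js = (\<Sum>p<N. if js ! p = src \<epsilon> i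
      then tscale (coef \<epsilon> i js p * spec i p powi r) (boxes (js[p := tgt \<epsilon> i])) else 0)"
  proof (cases \<epsilon>)
    case Pos
    have "rat_eval (tensor_phi t (take p params) i (take p js)) (inverse (spec i p)) = coef Pos i js p"
      if "p < N" "js ! p = i + 1" for p
      using rat_eval_coef[OF js that(1), of Pos i] that tensor_phi_prod(2)[OF B_length[OF js] that(1)] by simp
    then show ?thesis unfolding Pos tensor_x.simps length_params
      by (intro sum.cong) (auto simp: Let_def params_spec)
  next
    case Neg
    have "rat_eval (tensor_phi t (drop (Suc p) params) i (drop (Suc p) js)) (inverse (spec i p)) = coef Neg i js p"
      if "p < N" "js ! p = i" for p
      using rat_eval_coef[OF js that(1), of Neg i] that tensor_phi_prod(3)[OF B_length[OF js] that(1)] by simp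
    then show ?thesis unfolding Neg tensor_x.simps length_params
      by (intro sum.cong) (auto simp: Let_def params_spec)
  qed
  also have "\<dots> = x_basis \<epsilon> i r js"
    unfolding x_basis_def by (rule sum.cong) (auto simp: move_basis_def mult.commute)
  finally show ?thesis .
qed

lemma lin_x_basis: "lin (x_basis \<epsilon> i r) v = (\<Sum>p<N. tscale (spec i p powi r) (move \<epsilon> i p v))"
  unfolding x_basis_def move_def by (simp add: lin_fun_sum lin_fun_scale)

lemma lin_G_X: "lin (G (X \<epsilon> i r)) v = (\<Sum>p<N. tscale (spec i p powi r) (move \<epsilon> i p v))"
proof -
  have "G (X \<epsilon> i r) = x_basis \<epsilon> i r" by auto
  then show ?thesis by (simp add: lin_x_basis)
qed

text \<open>The letters \<open>H i m\<close> act on a basis vector by scalars, so their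
  noncommutative power series may be evaluated coefficient by coefficient.\<close>

lemma rho_exp_h:
  assumes l: "length js = N"
  shows "rho G (fps_nth (exp_h t \<epsilon> i) n) (boxes js) = tscale (fps_nth (fps_exp 1 oo L \<epsilon> i js) n) (boxes js)"
proof -
  define Bf where "Bf = Abs_fps (\<lambda>m. if m = 0 then 0
          else scal (of_int (sg \<epsilon>) * (exp t - inverse (exp t))) * gn (H i (sg \<epsilon> * int m)))"
  have B: "rho G (Bf $ m) (boxes js) = tscale (L \<epsilon> i js $ m) (boxes js)" for m
  proof (cases "m = 0")
    case True
    then show ?thesis by (simp add: Bf_def L_nth_0)
  next
    case False
    have "of_int (sg \<epsilon>) * (q - inverse q) * h_val i (sg \<epsilon> * int m) js = L \<epsilon> i js $ m"
      using False q_neq_inverse by (cases \<epsilon>) (auto simp: h_val_def field_simps)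
    then show ?thesis using False by (simp add: Bf_def rho_mult)
  qed
  have Bp: "rho G ((Bf ^ k) $ m) (boxes js) = tscale ((L \<epsilon> i js ^ k) $ m) (boxes js)" for k m
  proof (induction k arbitrary: m)
    case 0
    show ?case by (cases m) auto
  next
    case (Suc k)
    then show ?case
      by (simp add: fps_mult_nth rho_sum rho_mult rho_scale_right B tensor.scale_sum_left mult.commute)
  qed
  have "exp_h t \<epsilon> i $ n = (\<Sum>k = 0..n. scal (1 / fact k) * (Bf ^ k $ n))"
    unfolding exp_h_def Bf_def[symmetric] by (simp add: fps_compose_def)
  then show ?thesis
    by (simp add: rho_sum rho_mult Bp fps_compose_def tensor.scale_sum_left)
qed

lemma rho_phi:
  assumes l: "length js = N"
  shows "rho G (phi t \<epsilon> i m) (boxes js) = tscale (bicoeff \<epsilon> (tensor_phi t params i js) m) (boxes js)"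
proof -
  have "E \<epsilon> i js $ k = E \<epsilon> i js $ 0 * (fps_exp 1 oo L \<epsilon> i js) $ k" for k
    using arg_cong[OF fps_exp_L[OF l, of \<epsilon> i], of "\<lambda>f. f $ k"] by simp
  then show ?thesis
    by (simp add: phi_def rho_mult rho_exp_h[OF l] rho_scale_right bicoeff_def E_def[symmetric]
        E_nth_0[OF l] lin_scale mult.commute del: expansion.simps)
qed

end

section \<open>Change of the eigenvalues of \<open>phi\<close> under a move\<close>

lemma bicoeff_shift:
  fixes f g :: ratfun
  assumes "expansion \<epsilon> f * series \<epsilon> 1 [:\<alpha>, - \<beta>:] = expansion \<epsilon> g * series \<epsilon> 1 [:\<alpha>', - \<beta>':]"
  shows "\<alpha> * bicoeff \<epsilon> f m - \<beta> * bicoeff \<epsilon> f (m - 1)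
    = \<alpha>' * bicoeff \<epsilon> g m - \<beta>' * bicoeff \<epsilon> g (m - 1)"
proof -
  define F F' where "F = expansion \<epsilon> f" and "F' = expansion \<epsilon> g"
  have sP: "series Pos 1 [:x, - y:] = fps_const x - fps_const y * fps_X" for x y
    by (rule fps_ext) (auto simp: coeff_pCons split: nat.split)
  have sN: "series Neg 1 [:x, - y:] = fps_const x * fps_X - fps_const y" for x y
    by (rule fps_ext) (auto simp: coeff_pCons fps_X_def le_Suc_eq split: nat.split)
  note eq = assms[folded F_def F'_def]
  have n: "bicoeff \<epsilon> f k = (if 0 \<le> sg \<epsilon> * k then F $ nat \<bar>k\<bar> else 0)"
    "bicoeff \<epsilon> g k = (if 0 \<le> sg \<epsilon> * k then F' $ nat \<bar>k\<bar> else 0)" for k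
    by (simp_all add: bicoeff_def F_def F'_def)
  show ?thesis
  proof (cases \<epsilon>)
    case Pos
    have "fps_const \<alpha> * F - fps_const \<beta> * (fps_X * F) = fps_const \<alpha>' * F' - fps_const \<beta>' * (fps_X * F')"
      using eq unfolding Pos sP
      by (simp add: algebra_simps)
    then have c: "(fps_const \<alpha> * F - fps_const \<beta> * (fps_X * F)) $ k = (fps_const \<alpha>' * F' - fps_const \<beta>' * (fps_X * F')) $ k" for k
      by simp
    show ?thesis
    proof (cases "m \<le> 0")
      case True
      then show ?thesis using c[of 0] by (auto simp: n[unfolded Pos] Pos)
    next
      case False
      define k where "k = nat (m - 1)"
      have "m = int (Suc k)" using False by (simp add: k_def)
      then show ?thesis using c[of "Suc k"] by (simp add: n[unfolded Pos] Pos nat_add_distrib)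
    qed
  next
    case Neg
    have "fps_const \<alpha> * (fps_X * F) - fps_const \<beta> * F = fps_const \<alpha>' * (fps_X * F') - fps_const \<beta>' * F'"
      using eq unfolding Neg sN
      by (simp add: algebra_simps)
    then have c: "(fps_const \<alpha> * (fps_X * F) - fps_const \<beta> * F) $ k = (fps_const \<alpha>' * (fps_X * F') - fps_const \<beta>' * F') $ k" for k
      by simp
    show ?thesis
    proof (cases "m \<ge> 1")
      case True
      then show ?thesis using c[of 0] by (auto simp: n[unfolded Neg] Neg)
    next
      case False
      define k where "k = nat (- m)"
      have "m = - int k" using False by (simp add: k_def)
      then show ?thesis using c[of "Suc k"] by (simp add: n[unfolded Neg] Neg nat_add_distrib)
    qed
  qed
qed

context box_config
begin

text \<open>At the support \<open>w = 1/c\<close> of the delta-function, with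
  \<open>c = spec j p\<close> and \<open>Q = q_cart \<epsilon> i j\<close>, the relation between
  \<open>phi\<close> and the series of \<open>X\<close> asks that the move multiply the eigenvalue
  by \<open>(Q - c z) / (1 - Q c z)\<close>. Only the factor of \<open>p\<close> changes, and this
  is the claim for it, cleared of denominators.\<close>

lemma box_num_box_den_shift:
  assumes l: "length js = N" and p: "p < N" and src: "js ! p = src \<epsilon> j"
  shows "box_num i (js[p := tgt \<epsilon> j]) p * box_den i js p * [:1, - (q_cart \<epsilon> i j * spec j p):]
    = box_num i js p * box_den i (js[p := tgt \<epsilon> j]) p * [:q_cart \<epsilon> i j, - spec j p:]"
proof -
  define c where "c = spec i p"
  have cj: "spec j p = c * q powi (j - i)"
    using spec_ratio[of j p i p] by (simp add: c_def)
  have upd: "js[p := x] ! p = x" for x using l p by simp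
  consider "j = i" | "j = i - 1" | "j = i + 1" | "2 \<le> \<bar>i - j\<bar>" by linarith
  then show ?thesis
  proof cases
    case 1
    have cj2: "spec j p = c" using cj 1 by (simp add: power_int_minus mult.commute)
    have Pos: ?thesis if "\<epsilon> = Pos"
    proof -
      have "box_num i (js[p := tgt \<epsilon> j]) p = [:q, - (inverse q * c):]" "box_den i js p = [:1, - c:]" "box_num i js p = [:inverse q, - (q * c):]"
        "box_den i (js[p := tgt \<epsilon> j]) p = [:1, - c:]" "q_cart \<epsilon> i j = q\<^sup>2"
        using src that l p unfolding 1
        by (simp_all add: box_num_def box_den_def q_cart_def cart_def c_def power_int_minus)
      note v = this[unfolded 1] cj2[unfolded 1]
      show ?thesis unfolding 1 v by (simp add: field_simps power2_eq_square)
    qed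
    have Neg: ?thesis if "\<epsilon> = Neg"
    proof -
      have "box_num i (js[p := tgt \<epsilon> j]) p = [:inverse q, - (q * c):]" "box_den i js p = [:1, - c:]" "box_num i js p = [:q, - (inverse q * c):]"
        "box_den i (js[p := tgt \<epsilon> j]) p = [:1, - c:]" "q_cart \<epsilon> i j = inverse (q\<^sup>2)"
        using src that l p unfolding 1
        by (simp_all add: box_num_def box_den_def q_cart_def cart_def c_def power_int_minus)
      note v = this[unfolded 1] cj2[unfolded 1]
      show ?thesis unfolding 1 v by (simp add: field_simps power2_eq_square)
    qed
    show ?thesis using Pos Neg by (cases \<epsilon>)
  next
    case 2
    have cj2: "spec j p = inverse q * c" using cj 2 by (simp add: power_int_minus mult.commute)
    have Pos: ?thesis if "\<epsilon> = Pos"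
    proof -
      have "box_num i (js[p := tgt \<epsilon> j]) p = 1" "box_den i js p = [:1, - c:]" "box_num i js p = [:q, - (inverse q * c):]"
        "box_den i (js[p := tgt \<epsilon> j]) p = 1" "q_cart \<epsilon> i j = inverse q"
        using src that l p unfolding 2
        by (simp_all add: box_num_def box_den_def q_cart_def cart_def c_def power_int_minus)
      note v = this[unfolded 2] cj2[unfolded 2]
      show ?thesis unfolding 2 v by (simp add: field_simps power2_eq_square)
    qed
    have Neg: ?thesis if "\<epsilon> = Neg"
    proof -
      have "box_num i (js[p := tgt \<epsilon> j]) p = [:q, - (inverse q * c):]" "box_den i js p = 1" "box_num i js p = 1"
        "box_den i (js[p := tgt \<epsilon> j]) p = [:1, - c:]" "q_cart \<epsilon> i j = q"
        using src that l p unfolding 2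
        by (simp_all add: box_num_def box_den_def q_cart_def cart_def c_def power_int_minus)
      note v = this[unfolded 2] cj2[unfolded 2]
      show ?thesis unfolding 2 v by (simp add: field_simps power2_eq_square)
    qed
    show ?thesis using Pos Neg by (cases \<epsilon>)
  next
    case 3
    have cj2: "spec j p = q * c" using cj 3 by (simp add: power_int_minus mult.commute)
    have Pos: ?thesis if "\<epsilon> = Pos"
    proof -
      have "box_num i (js[p := tgt \<epsilon> j]) p = [:inverse q, - (q * c):]" "box_den i js p = 1" "box_num i js p = 1"
        "box_den i (js[p := tgt \<epsilon> j]) p = [:1, - c:]" "q_cart \<epsilon> i j = inverse q"
        using src that l p unfolding 3
        by (simp_all add: box_num_def box_den_def q_cart_def cart_def c_def power_int_minus)
      note v = this[unfolded 3] cj2[unfolded 3]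
      show ?thesis unfolding 3 v by (simp add: field_simps power2_eq_square)
    qed
    have Neg: ?thesis if "\<epsilon> = Neg"
    proof -
      have "box_num i (js[p := tgt \<epsilon> j]) p = 1" "box_den i js p = [:1, - c:]" "box_num i js p = [:inverse q, - (q * c):]"
        "box_den i (js[p := tgt \<epsilon> j]) p = 1" "q_cart \<epsilon> i j = q"
        using src that l p unfolding 3
        by (simp_all add: box_num_def box_den_def q_cart_def cart_def c_def power_int_minus)
      note v = this[unfolded 3] cj2[unfolded 3]
      show ?thesis unfolding 3 v by (simp add: field_simps power2_eq_square)
    qed
    show ?thesis using Pos Neg by (cases \<epsilon>)
  next
    case 4
    then have "src \<epsilon> j \<noteq> i" "src \<epsilon> j \<noteq> i + 1" "tgt \<epsilon> j \<noteq> i" "tgt \<epsilon> j \<noteq> i + 1" "cart i j = 0"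
      by (cases \<epsilon>; auto simp: cart_def)+
    then show ?thesis using l p src by (simp add: box_num_def box_den_def q_cart_def)
  qed
qed

lemma expansion_shift:
  assumes l: "length js = N" and p: "p < N" and src: "js ! p = src \<epsilon> j"
  shows "expansion \<eta> (tensor_phi t params i (js[p := tgt \<epsilon> j])) * series \<eta> 1 [:1, - (q_cart \<epsilon> i j * spec j p):]
    = expansion \<eta> (tensor_phi t params i js) * series \<eta> 1 [:q_cart \<epsilon> i j, - spec j p:]"
proof -
  define js' where "js' = js[p := tgt \<epsilon> j]"
  have l': "length js' = N" using l by (simp add: js'_def)
  define Eh where "Eh = (\<Prod>r\<in>{..<N} - {p}. expansion \<eta> (box_phi t i (params ! r, js ! r)))"
  define e e' where "e = expansion \<eta> (box_phi t i (params ! p, js ! p))"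
    and "e' = expansion \<eta> (box_phi t i (params ! p, js' ! p))"
  have "(\<Prod>r\<in>{..<N} - {p}. expansion \<eta> (box_phi t i (params ! r, js' ! r))) = Eh"
    unfolding Eh_def js'_def by (rule prod.cong) auto
  then have E: "expansion \<eta> (tensor_phi t params i js') = e' * Eh" "expansion \<eta> (tensor_phi t params i js) = e * Eh"
    using E_prod[OF l', of \<eta> i] E_prod[OF l, of \<eta> i] p
    by (simp_all add: E_def e_def e'_def Eh_def prod.remove[of "{..<N}" p] del: expansion.simps)
  define n d n' d' where "n = box_num i js p" and "d = box_den i js p" and "n' = box_num i js' p" and "d' = box_den i js' p"
  define M M' where "M = degree d" and "M' = degree d'"
  have r: "regular (box_phi t i (params ! p, js ! p)) n d M"
    and r': "regular (box_phi t i (params ! p, js' ! p)) n' d' M'"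
    unfolding n_def d_def n'_def d'_def M_def M'_def by (rule box_phi_regular[OF p])+
  have deg: "degree n \<le> M" "degree d \<le> M" "degree n' \<le> M'" "degree d' \<le> M'"
    using r r' by (auto simp: regular_def)
  define P P' where "P = [:q_cart \<epsilon> i j, - spec j p:]" and "P' = [:1, - (q_cart \<epsilon> i j * spec j p):]"
  have degP: "degree P \<le> 1" "degree P' \<le> 1" by (simp_all add: P_def P'_def)
  have key: "n' * d * P' = n * d' * P"
    using box_num_box_den_shift[OF l p src, of i] by (simp only: n_def d_def n'_def d'_def P_def P'_def js'_def)
  have "series \<eta> (M' + M + 1) (n' * d * P') = series \<eta> M' n' * series \<eta> M d * series \<eta> 1 P'"
    using deg degP by (simp only: series_mult degree_mult_le[THEN order_trans] add_mono)
  moreover have "series \<eta> (M' + M + 1) (n * d' * P) = series \<eta> M n * series \<eta> M' d' * series \<eta> 1 P"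
    using deg degP unfolding add.commute[of M' M]
    by (simp only: series_mult degree_mult_le[THEN order_trans] add_mono)
  ultimately have "series \<eta> M' n' * series \<eta> M d * series \<eta> 1 P' = series \<eta> M n * series \<eta> M' d' * series \<eta> 1 P"
    by (simp only: key)
  then have "(e' * series \<eta> 1 P') * (series \<eta> M' d' * series \<eta> M d) = (e * series \<eta> 1 P) * (series \<eta> M' d' * series \<eta> M d)"
    unfolding expansion_regular[OF r, symmetric] expansion_regular[OF r', symmetric] e_def e'_def
    by (simp only: mult_ac)
  moreover have "series \<eta> M' d' * series \<eta> M d \<noteq> 0"
    using regular_series_nonzero(2)[OF r] regular_series_nonzero(2)[OF r'] by simp
  ultimately have "e' * series \<eta> 1 P' = e * series \<eta> 1 P"
    by (metis mult_right_cancel)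
  then have "Eh * (e' * series \<eta> 1 P') = Eh * (e * series \<eta> 1 P)"
    by (simp only:)
  then have "e' * Eh * series \<eta> 1 P' = e * Eh * series \<eta> 1 P"
    by (simp only: mult_ac)
  then show ?thesis
    by (simp only: E[unfolded js'_def] P_def P'_def)
qed

lemma phi_shift:
  assumes "length js = N" "p < N" "js ! p = src \<epsilon> j"
  shows "bicoeff \<eta> (tensor_phi t params i (js[p := tgt \<epsilon> j])) m
      - q_cart \<epsilon> i j * spec j p * bicoeff \<eta> (tensor_phi t params i (js[p := tgt \<epsilon> j])) (m - 1)
    = q_cart \<epsilon> i j * bicoeff \<eta> (tensor_phi t params i js) m - spec j p * bicoeff \<eta> (tensor_phi t params i js) (m - 1)"
  using bicoeff_shift[OF expansion_shift[OF assms, of \<eta> i], of m] by simp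

section \<open>The relations\<close>

definition V :: "tensor set" where
  "V = {v. Poly_Mapping.keys v \<subseteq> B}"

lemma boxes_V [simp]: "boxes js \<in> V \<longleftrightarrow> js \<in> B"
  by (simp add: V_def boxes_def)

lemma subspace_V: "tensor.subspace V"
  unfolding tensor.subspace_def V_def
  by (auto simp: in_keys_iff lookup_add subset_iff) (metis add.right_neutral)

lemma lin_in_V:
  assumes "\<And>js. js \<in> B \<Longrightarrow> F js \<in> V" "v \<in> V"
  shows "lin F v \<in> V"
  unfolding lin_def
  by (intro tensor.subspace_sum[OF subspace_V] tensor.subspace_scale[OF subspace_V] assms(1))
    (use assms(2) in \<open>auto simp: V_def\<close>)

text \<open>The genuine zeros of a factor are exactly the two obstructions of \<open>B_move\<close>.
  A zero produced by the convention at a pole adds nothing, since the accompanying square has a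
  corner that is such an obstruction.\<close>

lemma coef_eq_0_iff:
  assumes "js \<in> B" "p < N" "js ! p = src \<epsilon> i"
  shows "coef \<epsilon> i js p = 0 \<longleftrightarrow> js[p := tgt \<epsilon> i] \<notin> B"
proof -
  have fac0: "fac t i (js ! r) (kap r - kap p) = 0 \<longleftrightarrow>
      js ! r = tgt \<epsilon> i \<and> sg \<epsilon> * (kap r - kap p) = 1 \<or> js ! r = src \<epsilon> i \<and> sg \<epsilon> * (kap r - kap p) = -1
      \<or> (js ! r = tgt \<epsilon> i \<or> js ! r = src \<epsilon> i) \<and> kap r = kap p" for r
    by (cases \<epsilon>) (auto simp: fac_def psi_val_eq_0_iff)
  have "\<exists>s<N. bef \<epsilon> s p \<and> (js ! s = tgt \<epsilon> i \<and> sg \<epsilon> * (kap s - kap p) = 1)"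
    if r: "r < N" "bef \<epsilon> r p" "js ! r = tgt \<epsilon> i \<or> js ! r = src \<epsilon> i" "kap r = kap p" for r
  proof -
    have "js ! r \<noteq> src \<epsilon> i"
      using same_diag_same_entry[OF assms(1) r(1) assms(2) r(4)] r assms by auto
    with r have tgt: "js ! r = tgt \<epsilon> i" by simp
    show ?thesis
    proof (cases \<epsilon>)
      case Pos
      then obtain s where "r < s" "s < p" "js ! s = js ! r" "kap s = kap r + 1"
        using B_square[OF assms(1), of r p] r tgt assms by auto
      then show ?thesis using Pos r tgt assms(2) by (intro exI[of _ s]) auto
    next
      case Neg
      then obtain s where "p < s" "s < r" "js ! s = js ! r" "kap s = kap p - 1"
        using B_square[OF assms(1), of p r] r tgt assms by auto
      then show ?thesis using Neg r tgt by (intro exI[of _ s]) auto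
    qed
  qed
  then show ?thesis
    unfolding B_move[OF assms] coef_def
    by (auto simp: fac0)
qed

lemma move_basis_V: "js \<in> B \<Longrightarrow> p < N \<Longrightarrow> move_basis \<epsilon> i p js \<in> V"
  using coef_eq_0_iff[of js p \<epsilon> i] tensor.subspace_0[OF subspace_V]
  by (cases "js[p := tgt \<epsilon> i] \<in> B") (auto simp: move_basis_def intro!: tensor.subspace_scale[OF subspace_V])

lemma G_V: "v \<in> V \<Longrightarrow> lin (G g) v \<in> V"
proof (rule lin_in_V)
  fix js assume "js \<in> B"
  then show "G g js \<in> V"
    by (cases g) (auto simp: x_basis_def move_basis_V intro!: tensor.subspace_scale[OF subspace_V] tensor.subspace_sum[OF subspace_V])
qed

lemma rho_phi_move_basis:
  assumes "length js = N"
  shows "rho G (phi t \<eta> i m) (move_basis \<epsilon> j p js)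
    = tscale (bicoeff \<eta> (tensor_phi t params i (js[p := tgt \<epsilon> j])) m) (move_basis \<epsilon> j p js)"
  using assms by (simp add: move_basis_def rho_scale_right rho_phi mult.commute)

lemma lin_K_move_basis:
  assumes "length js = N" "p < N"
  shows "lin (G (K h)) (move_basis \<epsilon> j p js)
    = tscale (qpow t (of_int (sg \<epsilon>) * alpha j h) * qpow t (tensor_weight js h)) (move_basis \<epsilon> j p js)"
proof (cases "js ! p = src \<epsilon> j")
  case True
  have "tensor_weight (js[p := tgt \<epsilon> j]) h = of_int (sg \<epsilon>) * alpha j h + tensor_weight js h"
    using tensor_weight_upd[OF assms, of "tgt \<epsilon> j" h] True by (cases \<epsilon>) (auto simp: alpha_def)
  then show ?thesis
    by (simp add: move_basis_def lin_scale qpow_add mult_ac)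
qed (simp add: move_basis_def)

lemma move_sum: "move \<epsilon> i p (sum f A) = (\<Sum>x\<in>A. move \<epsilon> i p (f x))"
  by (simp add: move_def lin_sum)

lemma G_X: "G (X \<epsilon> i r) js = (\<Sum>p<N. tscale (spec i p powi r) (move_basis \<epsilon> i p js))"
  by (simp add: x_basis_def)

lemma rho_X_X:
  "rho G (gn (X \<epsilon> i r) * gn (X \<eta> j s)) (boxes js)
    = (\<Sum>p<N. \<Sum>p'<N. tscale (spec i p powi r * spec j p' powi s) (move \<epsilon> i p (move_basis \<eta> j p' js)))"
  by (simp add: rho_mult lin_G_X move_sum tensor.scale_sum_right G_X del: G.simps)

lemma rho_X_X_X:
  "rho G (gn (X \<epsilon> i r) * gn (X \<epsilon> j s) * gn (X \<epsilon> k u)) (boxes js)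
    = (\<Sum>p<N. \<Sum>p'<N. \<Sum>p''<N. tscale (spec i p powi r * spec j p' powi s * spec k p'' powi u)
        (moves \<epsilon> [(k, p''), (j, p'), (i, p)] js))"
  by (simp add: rho_mult lin_G_X move_sum tensor.scale_sum_right moves_def mult.assoc G_X del: G.simps)

lemma relator_x_x:
  assumes js: "js \<in> B" and Q: "Q = q_cart \<epsilon> i j"
  shows "rho G ((gn (X \<epsilon> i r) * gn (X \<epsilon> j (s - 1)) - scal Q * gn (X \<epsilon> i (r - 1)) * gn (X \<epsilon> j s))
    - (scal Q * gn (X \<epsilon> j (s - 1)) * gn (X \<epsilon> i r) - gn (X \<epsilon> j s) * gn (X \<epsilon> i (r - 1)))) (boxes js) = 0"
proof -
  have pw: "x powi m = x * x powi (m - 1)" if "x \<noteq> 0" for x :: complex and m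
    using that by (simp add: power_int_diff)
  have trm: "tscale (spec i p powi r * spec j p' powi (s - 1)) (move \<epsilon> i p (move_basis \<epsilon> j p' js))
      - tscale Q (tscale (spec i p powi (r - 1) * spec j p' powi s) (move \<epsilon> i p (move_basis \<epsilon> j p' js)))
    = tscale Q (tscale (spec j p' powi (s - 1) * spec i p powi r) (move \<epsilon> j p' (move_basis \<epsilon> i p js)))
      - tscale (spec j p' powi s * spec i p powi (r - 1)) (move \<epsilon> j p' (move_basis \<epsilon> i p js))"
    if "p < N" "p' < N" for p p'
  proof -
    \<comment> \<open>After removal of the lower powers of both spectral constants the coefficients
      are linear in them, as in \<open>move_comm\<close>.\<close>
    let ?c = "spec i p powi (r - 1) * spec j p' powi (s - 1)"
    have "tscale ?c (tscale (spec i p - Q * spec j p') (move \<epsilon> i p (move_basis \<epsilon> j p' js)))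
      = tscale ?c (tscale (Q * spec i p - spec j p') (move \<epsilon> j p' (move_basis \<epsilon> i p js)))"
      using move_comm[OF js that, of i \<epsilon> j] by (simp only: Q)
    moreover have "spec i p powi r * spec j p' powi (s - 1) - Q * (spec i p powi (r - 1) * spec j p' powi s) = ?c * (spec i p - Q * spec j p')"
      "Q * (spec j p' powi (s - 1) * spec i p powi r) - spec j p' powi s * spec i p powi (r - 1) = ?c * (Q * spec i p - spec j p')"
      using pw[of "spec i p" r] pw[of "spec j p'" s] by (simp_all add: algebra_simps)
    ultimately show ?thesis
      by (simp flip: tensor.scale_left_diff_distrib)
  qed
  have "rho G ((gn (X \<epsilon> i r) * gn (X \<epsilon> j (s - 1)) - scal Q * gn (X \<epsilon> i (r - 1)) * gn (X \<epsilon> j s))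
    - (scal Q * gn (X \<epsilon> j (s - 1)) * gn (X \<epsilon> i r) - gn (X \<epsilon> j s) * gn (X \<epsilon> i (r - 1)))) (boxes js)
    = (\<Sum>p<N. \<Sum>p'<N. tscale (spec i p powi r * spec j p' powi (s - 1)) (move \<epsilon> i p (move_basis \<epsilon> j p' js)))
      - tscale Q (\<Sum>p<N. \<Sum>p'<N. tscale (spec i p powi (r - 1) * spec j p' powi s) (move \<epsilon> i p (move_basis \<epsilon> j p' js)))
      - (tscale Q (\<Sum>p'<N. \<Sum>p<N. tscale (spec j p' powi (s - 1) * spec i p powi r) (move \<epsilon> j p' (move_basis \<epsilon> i p js)))
      - (\<Sum>p'<N. \<Sum>p<N. tscale (spec j p' powi s * spec i p powi (r - 1)) (move \<epsilon> j p' (move_basis \<epsilon> i p js))))"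
    by (simp only: rho_diff mult.assoc rho_mult[of G "scal Q"] rho_scal rho_X_X)
  also have "\<dots> = 0"
    unfolding sum.swap[of "\<lambda>p' p. tscale (spec j p' powi (s - 1) * spec i p powi r) (move \<epsilon> j p' (move_basis \<epsilon> i p js))"]
      sum.swap[of "\<lambda>p' p. tscale (spec j p' powi s * spec i p powi (r - 1)) (move \<epsilon> j p' (move_basis \<epsilon> i p js))"]
    by (simp only: tensor.scale_sum_right flip: sum_subtractf)
      (intro sum.neutral ballI, use trm in simp)
  finally show ?thesis .
qed

lemma relator_x_far:
  assumes js: "js \<in> B" and ij: "\<bar>i - j\<bar> \<ge> 2"
  shows "rho G (gn (X \<epsilon> i r) * gn (X \<epsilon> j s) - gn (X \<epsilon> j s) * gn (X \<epsilon> i r)) (boxes js) = 0"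
proof -
  have "(\<Sum>p<N. \<Sum>p'<N. tscale (spec i p powi r * spec j p' powi s) (move \<epsilon> i p (move_basis \<epsilon> j p' js)))
     = (\<Sum>p<N. \<Sum>p'<N. tscale (spec j p' powi s * spec i p powi r) (move \<epsilon> j p' (move_basis \<epsilon> i p js)))"
    by (intro sum.cong refl) (use move_far[OF js _ _ ij, of _ _ \<epsilon>] in \<open>auto simp: mult.commute\<close>)
  also have "\<dots> = (\<Sum>p'<N. \<Sum>p<N. tscale (spec j p' powi s * spec i p powi r) (move \<epsilon> j p' (move_basis \<epsilon> i p js)))"
    by (rule sum.swap)
  finally show ?thesis by (simp only: rho_diff rho_X_X right_minus_eq)
qed

lemma relator_serre:
  assumes js: "js \<in> B" and ij: "\<bar>i - j\<bar> = 1"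
  shows "rho G (serre t \<epsilon> i j r1 r2 s + serre t \<epsilon> i j r2 r1 s) (boxes js) = 0"
proof -
  define m where "m = (\<lambda>w. moves \<epsilon> w js)"
  define F where "F = (\<lambda>p r u. m [(j, u), (i, r), (i, p)] - tscale (q + inverse q) (m [(i, r), (j, u), (i, p)])
       + m [(i, r), (i, p), (j, u)])"
  define S where "S = (\<lambda>r1 r2. (\<Sum>p<N. \<Sum>r<N. \<Sum>u<N. tscale (spec i p powi r1 * spec i r powi r2 * spec j u powi s) (F p r u)))"
  have serre: "rho G (serre t \<epsilon> i j r1 r2 s) (boxes js) = S r1 r2" for r1 r2
  proof -
    have A: "rho G (gn (X \<epsilon> i r1) * gn (X \<epsilon> i r2) * gn (X \<epsilon> j s)) (boxes js)
      = (\<Sum>p<N. \<Sum>r<N. \<Sum>u<N. tscale (spec i p powi r1 * spec i r powi r2 * spec j u powi s) (m [(j, u), (i, r), (i, p)]))"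
      by (simp only: rho_X_X_X m_def)
    have "rho G (gn (X \<epsilon> i r1) * gn (X \<epsilon> j s) * gn (X \<epsilon> i r2)) (boxes js)
      = (\<Sum>p<N. \<Sum>u<N. \<Sum>r<N. tscale (spec i p powi r1 * spec i r powi r2 * spec j u powi s) (m [(i, r), (j, u), (i, p)]))"
      unfolding rho_X_X_X m_def by (simp only: mult_ac)
    also have "\<dots> = (\<Sum>p<N. \<Sum>r<N. \<Sum>u<N. tscale (spec i p powi r1 * spec i r powi r2 * spec j u powi s) (m [(i, r), (j, u), (i, p)]))"
      by (intro sum.cong refl sum.swap)
    finally have Bb: "rho G (gn (X \<epsilon> i r1) * gn (X \<epsilon> j s) * gn (X \<epsilon> i r2)) (boxes js) = \<dots>" .
    have "rho G (gn (X \<epsilon> j s) * gn (X \<epsilon> i r1) * gn (X \<epsilon> i r2)) (boxes js)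
      = (\<Sum>u<N. \<Sum>p<N. \<Sum>r<N. tscale (spec i p powi r1 * spec i r powi r2 * spec j u powi s) (m [(i, r), (i, p), (j, u)]))"
      unfolding rho_X_X_X m_def by (simp only: mult_ac)
    also have "\<dots> = (\<Sum>p<N. \<Sum>u<N. \<Sum>r<N. tscale (spec i p powi r1 * spec i r powi r2 * spec j u powi s) (m [(i, r), (i, p), (j, u)]))"
      by (rule sum.swap)
    also have "\<dots> = (\<Sum>p<N. \<Sum>r<N. \<Sum>u<N. tscale (spec i p powi r1 * spec i r powi r2 * spec j u powi s) (m [(i, r), (i, p), (j, u)]))"
      by (intro sum.cong refl sum.swap)
    finally have C: "rho G (gn (X \<epsilon> j s) * gn (X \<epsilon> i r1) * gn (X \<epsilon> i r2)) (boxes js) = \<dots>" .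
    have "rho G (serre t \<epsilon> i j r1 r2 s) (boxes js)
      = rho G (gn (X \<epsilon> i r1) * gn (X \<epsilon> i r2) * gn (X \<epsilon> j s)) (boxes js)
        - tscale (q + inverse q) (rho G (gn (X \<epsilon> i r1) * gn (X \<epsilon> j s) * gn (X \<epsilon> i r2)) (boxes js))
        + rho G (gn (X \<epsilon> j s) * gn (X \<epsilon> i r1) * gn (X \<epsilon> i r2)) (boxes js)"
      unfolding serre_def by (simp only: rho_add rho_diff mult.assoc rho_mult[of G "scal _"] rho_scal)
    then show ?thesis
      unfolding A Bb C S_def F_def
      by (simp only: tensor.scale_right_distrib tensor.scale_right_diff_distrib tensor.scale_sum_right
          sum.distrib sum_subtractf tensor.scale_scale mult.commute[of "q + inverse q"])
  qed
  have "S r2 r1 = (\<Sum>p<N. \<Sum>r<N. \<Sum>u<N. tscale (spec i p powi r1 * spec i r powi r2 * spec j u powi s) (F r p u))"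
    unfolding S_def by (subst sum.swap) (simp only: mult.commute mult.left_commute)
  then have "S r1 r2 + S r2 r1 = (\<Sum>p<N. \<Sum>r<N. \<Sum>u<N. tscale (spec i p powi r1 * spec i r powi r2 * spec j u powi s) (F p r u + F r p u))"
    unfolding S_def by (simp only: tensor.scale_right_distrib sum.distrib)
  also have "\<dots> = 0"
  proof (intro sum.neutral ballI)
    fix p r u assume "p \<in> {..<N}" "r \<in> {..<N}" "u \<in> {..<N}"
    then have "serre6 \<epsilon> i j p r u js = 0" using serre6_zero[OF js _ _ _ ij] by simp
    then have "F p r u + F r p u = 0" by (simp add: serre6_def F_def m_def)
    then show "tscale (spec i p powi r1 * spec i r powi r2 * spec j u powi s) (F p r u + F r p u) = 0" by simp
  qed
  finally show ?thesis by (simp only: rho_add serre)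
qed

text \<open>By \<open>move_mixed\<close> the contributions of two different boxes cancel. What is
  left are single boxes moved away and back, and these sum up to \<open>residues\<close>.\<close>

lemma relator_x_pm:
  assumes js: "js \<in> B"
  shows "rho G ((gn (X Pos i r) * gn (X Neg j s) - gn (X Neg j s) * gn (X Pos i r))
    - (if i = j then scal (1 / (exp t - inverse (exp t))) * (phi t Pos i (r + s) - phi t Neg i (r + s))
       else 0)) (boxes js) = 0"
proof -
  have l: "length js = N" using js B_length by blast
  define D where "D = (\<lambda>p p'. move Pos i p (move_basis Neg j p' js) - move Neg j p' (move_basis Pos i p js))"
  have comm: "rho G (gn (X Pos i r) * gn (X Neg j s) - gn (X Neg j s) * gn (X Pos i r)) (boxes js)
     = (\<Sum>p<N. \<Sum>p'<N. tscale (spec i p powi r * spec j p' powi s) (D p p'))"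
  proof -
    have "rho G (gn (X Neg j s) * gn (X Pos i r)) (boxes js)
      = (\<Sum>p'<N. \<Sum>p<N. tscale (spec i p powi r * spec j p' powi s) (move Neg j p' (move_basis Pos i p js)))"
      unfolding rho_X_X by (simp only: mult.commute)
    also have "\<dots> = (\<Sum>p<N. \<Sum>p'<N. tscale (spec i p powi r * spec j p' powi s) (move Neg j p' (move_basis Pos i p js)))"
      by (rule sum.swap)
    finally show ?thesis
      unfolding rho_diff rho_X_X[of Pos] D_def
      by (simp only: tensor.scale_right_diff_distrib sum_subtractf)
  qed
  show ?thesis
  proof (cases "i = j")
    case False
    then have "D p p' = 0" if "p < N" "p' < N" for p p'
      using move_mixed[OF js that] by (simp add: D_def)
    then have "(\<Sum>p<N. \<Sum>p'<N. tscale (spec i p powi r * spec j p' powi s) (D p p')) = 0"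
      by (intro sum.neutral ballI) auto
    then show ?thesis using False comm by simp
  next
    case True
    define f where "f = (\<lambda>p. if js ! p = i then spec i p powi (r + s) * full i js p
        else if js ! p = i + 1 then - (spec i p powi (r + s) * full i js p) else 0)"
    have "(\<Sum>p'<N. tscale (spec i p powi r * spec j p' powi s) (D p p')) = tscale (f p) (boxes js)"
      if p: "p < N" for p
    proof -
      have "(\<Sum>p'<N. tscale (spec i p powi r * spec j p' powi s) (D p p'))
        = (\<Sum>p'\<in>{p}. tscale (spec i p powi r * spec j p' powi s) (D p p'))"
        by (rule sum.mono_neutral_right) (use p move_mixed[OF js p] in \<open>auto simp: D_def\<close>)
      also have "\<dots> = tscale (f p) (boxes js)"
        using True by (auto simp: D_def move_Pos_Neg[OF js p] f_def power_int_add)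
      finally show ?thesis .
    qed
    then have "(\<Sum>p<N. \<Sum>p'<N. tscale (spec i p powi r * spec j p' powi s) (D p p')) = tscale (\<Sum>p<N. f p) (boxes js)"
      by (simp add: tensor.scale_sum_left)
    moreover have "rho G (scal (1 / (q - inverse q)) * (phi t Pos i (r + s) - phi t Neg i (r + s))) (boxes js)
      = tscale (\<Sum>p<N. f p) (boxes js)"
    proof -
      have "rho G (phi t Pos i (r + s) - phi t Neg i (r + s)) (boxes js)
        = tscale ((q - inverse q) * (\<Sum>p<N. f p)) (boxes js)"
        unfolding rho_diff rho_phi[OF l] f_def residues[OF js, symmetric]
        by (rule tensor.scale_left_diff_distrib[symmetric])
      then show ?thesis
        using q_neq_inverse by (simp add: rho_mult)
    qed
    ultimately show ?thesis
      unfolding if_P[OF True] rho_diff[of G "gn (X Pos i r) * gn (X Neg j s) - gn (X Neg j s) * gn (X Pos i r)"] comm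
      by (simp only: diff_self)
  qed
qed

lemma relator_phi_x:
  assumes js: "js \<in> B" and Q: "Q = q_cart \<epsilon> i j"
  shows "rho G ((phi t \<eta> i m * gn (X \<epsilon> j (r - 1)) - scal Q * phi t \<eta> i (m - 1) * gn (X \<epsilon> j r))
    - (scal Q * gn (X \<epsilon> j (r - 1)) * phi t \<eta> i m - gn (X \<epsilon> j r) * phi t \<eta> i (m - 1))) (boxes js) = 0"
proof -
  have l: "length js = N" using js B_length by blast
  define f f' where "f = bicoeff \<eta> (tensor_phi t params i js)"
    and "f' = (\<lambda>p. bicoeff \<eta> (tensor_phi t params i (js[p := tgt \<epsilon> j])))"
  have "rho G ((phi t \<eta> i m * gn (X \<epsilon> j (r - 1)) - scal Q * phi t \<eta> i (m - 1) * gn (X \<epsilon> j r))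
    - (scal Q * gn (X \<epsilon> j (r - 1)) * phi t \<eta> i m - gn (X \<epsilon> j r) * phi t \<eta> i (m - 1))) (boxes js)
    = (\<Sum>p<N. tscale (spec j p powi (r - 1) * f' p m - Q * (spec j p powi r * f' p (m - 1))
       - (Q * (spec j p powi (r - 1) * f m) - spec j p powi r * f (m - 1))) (move_basis \<epsilon> j p js))"
    by (simp add: rho_diff rho_mult lin_G_X rho_phi[OF l] rho_sum_right rho_scale_right rho_phi_move_basis[OF l]
        tensor.scale_sum_right tensor.scale_left_diff_distrib sum_subtractf lin_scale mult_ac G_X
        f_def f'_def del: G.simps)
  also have "\<dots> = 0"
  proof (intro sum.neutral ballI)
    fix p assume "p \<in> {..<N}"
    then have p: "p < N" by simp
    show "tscale (spec j p powi (r - 1) * f' p m - Q * (spec j p powi r * f' p (m - 1))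
       - (Q * (spec j p powi (r - 1) * f m) - spec j p powi r * f (m - 1))) (move_basis \<epsilon> j p js) = 0"
    proof (cases "js ! p = src \<epsilon> j")
      case True
      have "spec j p powi r = spec j p powi (r - 1) * spec j p"
        by (simp add: power_int_diff)
      then have "spec j p powi (r - 1) * f' p m - Q * (spec j p powi r * f' p (m - 1))
         - (Q * (spec j p powi (r - 1) * f m) - spec j p powi r * f (m - 1))
        = spec j p powi (r - 1) * ((f' p m - Q * spec j p * f' p (m - 1)) - (Q * f m - spec j p * f (m - 1)))"
        by (simp add: algebra_simps)
      also have "\<dots> = 0"
        using phi_shift[OF l p True, of \<eta> i m] by (simp add: f_def f'_def Q)
      finally show ?thesis by simp
    qed (simp add: move_basis_def)
  qed
  finally show ?thesis .
qed

lemma relator_K_x: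
  assumes js: "js \<in> B"
  shows "rho G (gn (K h) * gn (X \<epsilon> j r) * gn (K (- h))
        - scal (qpow t (of_int (sg \<epsilon>) * alpha j h)) * gn (X \<epsilon> j r)) (boxes js) = 0"
proof -
  have l: "length js = N" using js B_length by blast
  have "qpow t (tensor_weight js h) * qpow t (tensor_weight js (- h)) = 1"
    by (simp flip: qpow_add tensor_weight_add)
  then have *: "qpow t (tensor_weight js (- h)) * (x * qpow t (tensor_weight js h)) = x" for x
    by (metis mult.commute mult.left_commute mult.right_neutral)
  have "rho G (gn (K h) * gn (X \<epsilon> j r) * gn (K (- h))) (boxes js)
    = tscale (qpow t (tensor_weight js (- h)))
        (\<Sum>p<N. tscale (spec j p powi r) (lin (G (K h)) (move_basis \<epsilon> j p js)))"
    by (simp add: rho_mult lin_G_X lin_scale lin_sum del: G.simps(1,3))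
      (simp add: x_basis_def lin_scale lin_sum)
  also have "\<dots> = (\<Sum>p<N. tscale (qpow t (of_int (sg \<epsilon>) * alpha j h)) (tscale (spec j p powi r) (move_basis \<epsilon> j p js)))"
    unfolding tensor.scale_sum_right
    by (rule sum.cong) (auto simp: lin_K_move_basis[OF l] * mult.left_commute[of _ "spec j _ powi r"])
  finally show ?thesis
    by (simp add: rho_diff rho_mult lin_G_X tensor.scale_sum_right G_X del: G.simps)
qed

lemma rho_cartan:
  assumes "u \<in> cartan_elems t" "length js = N"
  shows "\<exists>c. rho G u (boxes js) = tscale c (boxes js)"
proof -
  consider h where "u = gn (K h)" | \<epsilon> i m where "u = phi t \<epsilon> i m"
    using assms(1) by (auto simp: cartan_elems_def)
  then show ?thesis
  proof cases
    case 1
    then show ?thesis by (metis rho_gn lin_boxes G.simps(2))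
  next
    case 2
    then show ?thesis using rho_phi[OF assms(2)] by metis
  qed
qed

lemma relators_kill:
  assumes p: "p \<in> relators t" and js: "js \<in> B"
  shows "rho G p (boxes js) = 0"
  using p
proof cases
  case (commute u v)
  have l: "length js = N" using js B_length by blast
  obtain c c' where "rho G u (boxes js) = tscale c (boxes js)" "rho G v (boxes js) = tscale c' (boxes js)"
    using rho_cartan[OF commute(2) l] rho_cartan[OF commute(3) l] by blast
  then show ?thesis by (simp add: commute(1) rho_diff rho_mult rho_scale_right mult.commute)
next
  case (phi_x Q \<epsilon> i j \<eta> m r)
  then show ?thesis using relator_phi_x[OF js, of "q_cart \<epsilon> i j" \<epsilon> i j] by (simp only: q_cart_def)
next
  case (x_x Q \<epsilon> i j r s)
  then show ?thesis using relator_x_x[OF js, of "q_cart \<epsilon> i j" \<epsilon> i j] by (simp only: q_cart_def)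
qed (use js relator_K_x relator_x_pm relator_serre relator_x_far in
    \<open>auto simp: rho_diff rho_mult h_val_def lin_scale tensor_weight_add qpow_add mult.commute\<close>)

sublocale relator_killing t G V
proof
  fix p v assume p: "p \<in> relators t" and v: "v \<in> V"
  have "rho G p v = lin (\<lambda>js. rho G p (boxes js)) v" by (rule rho_lin)
  also have "\<dots> = lin (\<lambda>js. 0) v"
    by (rule lin_cong) (use v relators_kill[OF p] in \<open>auto simp: V_def\<close>)
  finally show "rho G p v = 0" by (simp add: lin_fun_zero)
qed (simp_all add: subspace_V G_V)

lemma acts_by_coproduct: "acts_by_coproduct t params B act"
  unfolding acts_by_coproduct_def
proof (intro ballI conjI allI)
  fix js assume js: "js \<in> B"
  show "act (cls t (gn (X \<epsilon> i r))) (boxes js) = tensor_x t params \<epsilon> i r js" for \<epsilon> i r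
    using js by (simp add: act_cls x_basis_tensor_x)
  show "act (cls t (phi t \<epsilon> i (sg \<epsilon> * int n))) (boxes js)
      = tscale (expansion \<epsilon> (tensor_phi t params i js) $ n) (boxes js)" for \<epsilon> i n
  proof -
    have "0 \<le> sg \<epsilon> * (sg \<epsilon> * int n)" "nat \<bar>sg \<epsilon> * int n\<bar> = n" by (cases \<epsilon>; simp)+
    then show ?thesis
      using js by (simp add: act_cls rho_phi[OF B_length[OF js]] bicoeff_def)
  qed
  show "act (cls t (gn (K h))) (boxes js) = tscale (qpow t (tensor_weight js h)) (boxes js)" for h
    using js by (simp add: act_cls)
qed

end

lemma keys_lin: "Poly_Mapping.keys (lin F v) \<subseteq> (\<Union>x\<in>Poly_Mapping.keys v. Poly_Mapping.keys (F x))"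
proof
  fix y assume "y \<in> Poly_Mapping.keys (lin F v)"
  then have "(\<Sum>x\<in>Poly_Mapping.keys v. Poly_Mapping.lookup v x * Poly_Mapping.lookup (F x) y) \<noteq> 0"
    by (simp add: lin_def lookup_sum in_keys_iff)
  then obtain x where "x \<in> Poly_Mapping.keys v" "Poly_Mapping.lookup v x * Poly_Mapping.lookup (F x) y \<noteq> 0"
    by (meson sum.not_neutral_contains_not_neutral)
  then show "y \<in> (\<Union>x\<in>Poly_Mapping.keys v. Poly_Mapping.keys (F x))"
    by (auto simp: in_keys_iff)
qed

lemma lookup_lin_diag:
  "Poly_Mapping.lookup (lin (\<lambda>x. tscale (c x) (boxes x)) v) y = c y * Poly_Mapping.lookup v y"
  by (simp add: lin_def lookup_sum lookup_boxes in_keys_iff if_distrib cong: if_cong)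

context box_config
begin

section \<open>Integrability\<close>

definition weight :: "int list \<Rightarrow> int \<Rightarrow>\<^sub>0 int" where
  "weight js = (\<Sum>j\<leftarrow>js. Poly_Mapping.single j 1 - Poly_Mapping.single (j - 1) 1)"

lemma qpow_tensor_weight:
  "qpow t (tensor_weight js (Poly_Mapping.single i 1)) = q powi Poly_Mapping.lookup (weight js) i"
proof -
  have "tensor_weight js (Poly_Mapping.single i 1) = of_int (Poly_Mapping.lookup (weight js) i)"
    by (induction js) (auto simp: tensor_weight_def weight_def lookup_add lookup_minus lookup_single when_def)
  then show ?thesis by (simp add: qpow_of_int)
qed

text \<open>Basis vectors are weight vectors, and as \<open>q\<close> is not a root of unity, the
  eigenvalues determine the integral weight.\<close>

lemma weight_space_iff:
  "v \<in> weight_space t tscale V act \<nu> \<longleftrightarrow> v \<in> V \<and> (\<forall>js\<in>Poly_Mapping.keys v. weight js = \<nu>)"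
proof (cases "v \<in> V")
  case True
  have GK: "G (K h) = (\<lambda>js. tscale (qpow t (tensor_weight js h)) (boxes js))" for h by auto
  have "act (cls t (gn (K (Poly_Mapping.single i 1)))) v = tscale (q powi Poly_Mapping.lookup \<nu> i) v
    \<longleftrightarrow> (\<forall>js\<in>Poly_Mapping.keys v. Poly_Mapping.lookup (weight js) i = Poly_Mapping.lookup \<nu> i)" for i
    using True
    by (auto simp: act_cls GK poly_mapping_eq_iff fun_eq_iff lookup_lin_diag qpow_tensor_weight
        powi_eq_iff in_keys_iff simp del: G.simps)
  then show ?thesis
    using True by (auto simp: weight_space_def poly_mapping_eq_iff fun_eq_iff)
qed (simp add: weight_space_def)

lemma weight_decomposition:
  assumes v: "v \<in> V"
  shows "\<exists>!f :: (int \<Rightarrow>\<^sub>0 int) \<Rightarrow>\<^sub>0 tensor.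
        (\<forall>\<nu>. Poly_Mapping.lookup f \<nu> \<in> weight_space t tscale V act \<nu>) \<and>
        v = (\<Sum>\<nu>\<in>Poly_Mapping.keys f. Poly_Mapping.lookup f \<nu>)"
proof -
  have sum: "Poly_Mapping.lookup (\<Sum>\<nu>\<in>Poly_Mapping.keys f. Poly_Mapping.lookup f \<nu>) js
      = Poly_Mapping.lookup (Poly_Mapping.lookup f (weight js)) js"
    if f: "\<forall>\<nu>. Poly_Mapping.lookup f \<nu> \<in> weight_space t tscale V act \<nu>"
    for f :: "(int \<Rightarrow>\<^sub>0 int) \<Rightarrow>\<^sub>0 tensor" and js
  proof -
    have "Poly_Mapping.lookup (Poly_Mapping.lookup f \<nu>) js
      = (if \<nu> = weight js then Poly_Mapping.lookup (Poly_Mapping.lookup f (weight js)) js else 0)" for \<nu>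
      using f unfolding weight_space_iff by (metis in_keys_iff)
    then have "Poly_Mapping.lookup (\<Sum>\<nu>\<in>Poly_Mapping.keys f. Poly_Mapping.lookup f \<nu>) js
      = (\<Sum>\<nu>\<in>Poly_Mapping.keys f. if \<nu> = weight js then Poly_Mapping.lookup (Poly_Mapping.lookup f (weight js)) js else 0)"
      unfolding lookup_sum by (metis (no_types, lifting) sum.cong)
    also have "\<dots> = Poly_Mapping.lookup (Poly_Mapping.lookup f (weight js)) js"
      by (simp add: in_keys_iff)
    finally show ?thesis .
  qed
  define f where "f = (\<Sum>js\<in>Poly_Mapping.keys v. Poly_Mapping.single (weight js) (tscale (Poly_Mapping.lookup v js) (boxes js)))"
  have fl: "Poly_Mapping.lookup (Poly_Mapping.lookup f \<nu>) js = (if \<nu> = weight js then Poly_Mapping.lookup v js else 0)" for \<nu> js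
  proof -
    have "Poly_Mapping.lookup (Poly_Mapping.lookup f \<nu>) js
      = (\<Sum>x\<in>Poly_Mapping.keys v. if x = js then (if \<nu> = weight js then Poly_Mapping.lookup v js else 0) else 0)"
      unfolding f_def lookup_sum
      by (rule sum.cong) (auto simp: lookup_single when_def lookup_boxes)
    then show ?thesis by (simp add: in_keys_iff)
  qed
  show ?thesis
  proof (rule ex1I[of _ f])
    have "Poly_Mapping.lookup f \<nu> \<in> weight_space t tscale V act \<nu>" for \<nu>
      unfolding weight_space_iff using v by (auto simp: V_def in_keys_iff fl split: if_splits)
    then show "(\<forall>\<nu>. Poly_Mapping.lookup f \<nu> \<in> weight_space t tscale V act \<nu>) \<and>
        v = (\<Sum>\<nu>\<in>Poly_Mapping.keys f. Poly_Mapping.lookup f \<nu>)"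
      by (auto intro!: poly_mapping_eqI simp: sum fl)
  next
    fix g :: "(int \<Rightarrow>\<^sub>0 int) \<Rightarrow>\<^sub>0 tensor"
    assume g: "(\<forall>\<nu>. Poly_Mapping.lookup g \<nu> \<in> weight_space t tscale V act \<nu>) \<and>
        v = (\<Sum>\<nu>\<in>Poly_Mapping.keys g. Poly_Mapping.lookup g \<nu>)"
    then have "Poly_Mapping.lookup v js = Poly_Mapping.lookup (Poly_Mapping.lookup g (weight js)) js" for js
      using sum[of g js] by simp
    then have "Poly_Mapping.lookup (Poly_Mapping.lookup g \<nu>) js = (if \<nu> = weight js then Poly_Mapping.lookup v js else 0)" for \<nu> js
      using g unfolding weight_space_iff by (metis in_keys_iff)
    then show "g = f"
      by (intro poly_mapping_eqI) (simp add: fl)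
  qed
qed

lemma keys_move_basis:
  "js' \<in> Poly_Mapping.keys (move_basis \<epsilon> i p js) \<Longrightarrow> js ! p = src \<epsilon> i \<and> js' = js[p := tgt \<epsilon> i]"
  by (auto simp: move_basis_def in_keys_iff lookup_boxes split: if_splits)

lemma keys_x_basis:
  assumes "js' \<in> Poly_Mapping.keys (x_basis \<epsilon> i r js)"
  shows "\<exists>p<N. js ! p = src \<epsilon> i \<and> js' = js[p := tgt \<epsilon> i]"
proof -
  have "(\<Sum>p<N. Poly_Mapping.lookup (tscale (spec i p powi r) (move_basis \<epsilon> i p js)) js') \<noteq> 0"
    using assms by (simp add: x_basis_def in_keys_iff lookup_sum)
  then obtain p where "p < N" "Poly_Mapping.lookup (tscale (spec i p powi r) (move_basis \<epsilon> i p js)) js' \<noteq> 0"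
    by (metis (no_types, lifting) lessThan_iff sum.neutral)
  then show ?thesis using keys_move_basis[of js' \<epsilon> i p js] by (auto simp: in_keys_iff)
qed

definition sources :: "sgn \<Rightarrow> int \<Rightarrow> int list \<Rightarrow> nat set" where
  "sources \<epsilon> i js = {p. p < N \<and> js ! p = src \<epsilon> i}"

lemma sources_upd:
  "length js = N \<Longrightarrow> p < N \<Longrightarrow> sources \<epsilon> i (js[p := tgt \<epsilon> i]) = sources \<epsilon> i js - {p}"
  by (auto simp: sources_def nth_list_update)

text \<open>Every application changes one box from the source entry to a different one, so the
  number of boxes that can move drops by one.\<close>

lemma x_basis_nilpotent:
  assumes "\<And>js. js \<in> Poly_Mapping.keys v \<Longrightarrow> length js = N \<and> card (sources \<epsilon> i js) < n"
  shows "(lin (x_basis \<epsilon> i r) ^^ n) v = 0"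
  using assms
proof (induction n arbitrary: v)
  case 0
  then have "js \<notin> Poly_Mapping.keys v" for js by auto
  then show ?case by (auto intro!: poly_mapping_eqI simp: in_keys_iff)
next
  case (Suc n)
  have "length js' = N \<and> card (sources \<epsilon> i js') < n" if js': "js' \<in> Poly_Mapping.keys (lin (x_basis \<epsilon> i r) v)" for js'
  proof -
    obtain js p where js: "js \<in> Poly_Mapping.keys v" "p < N" "js ! p = src \<epsilon> i" "js' = js[p := tgt \<epsilon> i]"
      using js' keys_lin[of "x_basis \<epsilon> i r" v] keys_x_basis by blast
    have l: "length js = N" "card (sources \<epsilon> i js) < Suc n" using Suc.prems[OF js(1)] by auto
    have "p \<in> sources \<epsilon> i js" "finite (sources \<epsilon> i js)" using js by (auto simp: sources_def)
    then have "card (sources \<epsilon> i js') < card (sources \<epsilon> i js)"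
      unfolding js(4) sources_upd[OF l(1) js(2)] by (rule card_Diff1_less[rotated])
    then show ?thesis using l js by simp
  qed
  then have "(lin (x_basis \<epsilon> i r) ^^ n) (lin (x_basis \<epsilon> i r) v) = 0" by (rule Suc.IH)
  then show ?case by (simp add: funpow_swap1)
qed

lemma G_X_fun: "G (X \<epsilon> i r) = x_basis \<epsilon> i r"
  by auto

lemma x_basis_V: "v \<in> V \<Longrightarrow> lin (x_basis \<epsilon> i r) v \<in> V"
  using G_V[of v "X \<epsilon> i r"] by (simp add: G_X_fun)

lemma act_X_pow:
  "v \<in> V \<Longrightarrow> (act (cls t (gn (X \<epsilon> i r))) ^^ n) v = (lin (x_basis \<epsilon> i r) ^^ n) v
    \<and> (lin (x_basis \<epsilon> i r) ^^ n) v \<in> V"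
  by (induction n) (auto simp: act_cls G_X_fun x_basis_V)

lemma integrable_V: "integrable t tscale V act"
  unfolding integrable_def
proof (intro conjI ballI allI)
  fix \<epsilon> i v assume v: "v \<in> V"
  have "card (sources \<epsilon> i js) \<le> N" for js
    using card_mono[of "{..<N}" "sources \<epsilon> i js"] by (auto simp: sources_def)
  then have "(lin (x_basis \<epsilon> i 0) ^^ Suc N) v = 0"
    using v B_length by (intro x_basis_nilpotent) (auto simp: V_def less_Suc_eq_le)
  then show "\<exists>n. (act (cls t (gn (X \<epsilon> i 0))) ^^ n) v = 0"
    using act_X_pow[OF v] by metis
qed (use uq_module_V weight_decomposition in auto)

section \<open>Finiteness over finite intervals\<close>

lemma finite_dimensional_subspace:
  assumes S: "tensor.subspace S" and A: "finite A" "S \<subseteq> tensor.span A"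
  shows "finite_dimensional tscale S"
proof -
  obtain C where C: "C \<subseteq> S" "tensor.independent C" "S \<subseteq> tensor.span C"
    using tensor.maximal_independent_subset by blast
  then have "finite C" using tensor.independent_span_bound[OF A(1) C(2)] A(2) by blast
  moreover have "S = tensor.span C"
    using C S tensor.span_minimal by blast
  ultimately show ?thesis unfolding finite_dimensional_def by blast
qed

lemma span_boxes: "Poly_Mapping.keys v \<subseteq> A \<Longrightarrow> v \<in> tensor.span (boxes ` A)"
  by (subst lin_boxes_id[symmetric], unfold lin_def)
    (intro tensor.span_sum tensor.span_scale tensor.span_base, auto)

lemma V_eq_span: "V = tensor.span (boxes ` B)"
proof
  show "V \<subseteq> tensor.span (boxes ` B)" using span_boxes by (auto simp: V_def)
  show "tensor.span (boxes ` B) \<subseteq> V"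
    by (rule tensor.span_minimal) (auto simp: subspace_V)
qed

text \<open>Generators with colours in the interval write new entries only from a finite range, so
  just finitely many lists can be reached from \<open>w\<close>. The scalars in the subalgebra make
  the orbit a subspace.\<close>

lemma finite_dimensional_Uq_J:
  assumes w: "w \<in> V"
  shows "finite_dimensional tscale ((\<lambda>u. act u w) ` Uq_J t c d)"
proof -
  \<comment> \<open>The upper end is \<open>d + 1\<close> because raising an entry with colour
    \<open>i\<close> writes \<open>i + 1\<close>.\<close>
  define M where "M = {c..d + 1} \<union> (\<Union>js\<in>Poly_Mapping.keys w. set js)"
  define Ls where "Ls = {js. set js \<subseteq> M \<and> length js = N}"
  define W where "W = {v \<in> V. Poly_Mapping.keys v \<subseteq> Ls}"
  have "finite M" by (simp add: M_def)
  then have finLs: "finite Ls" unfolding Ls_def by (rule finite_lists_length_eq)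
  have W: "tensor.subspace W"
    using subspace_V unfolding tensor.subspace_def W_def
    by (auto simp: in_keys_iff lookup_add subset_iff) (metis add.right_neutral)
  have wW: "w \<in> W"
    using w B_length by (auto simp: W_def V_def Ls_def M_def)
  define gens where "gens = {scal z | z. True}
      \<union> {gn (X \<epsilon> i r) | \<epsilon> i r. i \<in> {c..d}}
      \<union> {gn (H i m) | i m. i \<in> {c..d} \<and> m \<noteq> 0}
      \<union> {gn (K h) | h. Poly_Mapping.keys h \<subseteq> {c..d}}"
  have UJ: "Uq_J t c d = generate_ring (Uq t) (cls t ` gens)"
    by (simp add: Uq_J_def gens_def)
  have diag: "Poly_Mapping.keys (lin (\<lambda>x. tscale (f x) (boxes x)) v) \<subseteq> Poly_Mapping.keys v" for f v
    by (auto simp: in_keys_iff lookup_lin_diag)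
  have gen: "rho G p v \<in> W" if p: "p \<in> gens" and v: "v \<in> W" for p v
  proof -
    have vV: "rho G p v \<in> V" using rho_V v by (auto simp: W_def)
    have "Poly_Mapping.keys (rho G p v) \<subseteq> Ls"
    proof -
      consider z where "p = scal z" | \<epsilon> i r where "p = gn (X \<epsilon> i r)" "i \<in> {c..d}"
        | i m where "p = gn (H i m)" | h where "p = gn (K h)"
        using p by (auto simp: gens_def)
      then show ?thesis
      proof cases
        case 1
        then show ?thesis using v by (auto simp: W_def in_keys_iff)
      next
        case 2
        have "js' \<in> Ls" if "js' \<in> Poly_Mapping.keys (lin (x_basis \<epsilon> i r) v)" for js'
        proof -
          obtain js p where js: "js \<in> Poly_Mapping.keys v" "p < N" "js' = js[p := tgt \<epsilon> i]"
            using \<open>js' \<in> _\<close> keys_lin[of "x_basis \<epsilon> i r" v] keys_x_basis by blast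
          have "tgt \<epsilon> i \<in> M" using 2(2) by (cases \<epsilon>) (auto simp: M_def)
          then show ?thesis
            using js v set_update_subset_insert[of js p "tgt \<epsilon> i"] by (auto simp: Ls_def W_def)
        qed
        then show ?thesis using 2(1) by (auto simp: G_X_fun simp del: G.simps)
      next
        case 3
        have "G (H i m) = (\<lambda>x. tscale (h_val i m x) (boxes x))" by auto
        then show ?thesis using 3 v diag[of "h_val i m" v] by (auto simp: W_def simp del: G.simps)
      next
        case 4
        have "G (K h) = (\<lambda>x. tscale (qpow t (tensor_weight x h)) (boxes x))" by auto
        then show ?thesis using 4 v diag[of "\<lambda>x. qpow t (tensor_weight x h)" v] by (auto simp: W_def simp del: G.simps)
      qed
    qed
    then show ?thesis using vV by (simp add: W_def)
  qed
  have J: "\<exists>p. u = cls t p \<and> (\<forall>v\<in>W. rho G p v \<in> W)" if "u \<in> Uq_J t c d" for u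
    using that unfolding UJ
  proof (induction rule: generate_ring.induct)
    case one
    show ?case by (rule exI[of _ 1]) (simp add: Uq_simps)
  next
    case (incl h)
    then show ?case using gen by auto
  next
    case (a_inv h)
    then show ?case
      using tensor.subspace_neg[OF W] by (metis Uq_a_inv rho_uminus)
  next
    case (eng_add h1 h2)
    then show ?case
      using tensor.subspace_add[OF W] by (metis Uq_simps(3) rho_add)
  next
    case (eng_mult h1 h2)
    then show ?case by (metis Uq_simps(2) rho_mult)
  qed
  have sc: "cls t (scal z) \<in> Uq_J t c d" for z
    unfolding UJ by (rule generate_ring.incl) (auto simp: gens_def)
  show ?thesis
  proof (rule finite_dimensional_subspace)
    show "finite (boxes ` Ls)" using finLs by simp
    show "(\<lambda>u. act u w) ` Uq_J t c d \<subseteq> tensor.span (boxes ` Ls)"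
    proof (rule image_subsetI)
      fix u assume "u \<in> Uq_J t c d"
      then obtain p where "u = cls t p" "rho G p w \<in> W" using J wW by blast
      then show "act u w \<in> tensor.span (boxes ` Ls)"
        using span_boxes w by (auto simp: act_cls W_def)
    qed
    show "tensor.subspace ((\<lambda>u. act u w) ` Uq_J t c d)"
      unfolding tensor.subspace_def
    proof (intro conjI ballI allI)
      show "0 \<in> (\<lambda>u. act u w) ` Uq_J t c d"
        using sc[of 0] w by (intro image_eqI[of _ _ "cls t (scal 0)"]) (auto simp: act_cls)
    next
      fix x y assume "x \<in> (\<lambda>u. act u w) ` Uq_J t c d" "y \<in> (\<lambda>u. act u w) ` Uq_J t c d"
      then obtain u u' where u: "u \<in> Uq_J t c d" "x = act u w" "u' \<in> Uq_J t c d" "y = act u' w" by blast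
      obtain p p' where p: "u = cls t p" "u' = cls t p'" using J u by blast
      have "u \<oplus>\<^bsub>Uq t\<^esub> u' \<in> Uq_J t c d" using u unfolding UJ by (intro generate_ring.eng_add)
      moreover have "act (u \<oplus>\<^bsub>Uq t\<^esub> u') w = x + y"
        using w u p by (simp add: Uq_simps act_cls rho_add)
      ultimately show "x + y \<in> (\<lambda>u. act u w) ` Uq_J t c d" by (metis imageI)
    next
      fix z x assume "x \<in> (\<lambda>u. act u w) ` Uq_J t c d"
      then obtain u where u: "u \<in> Uq_J t c d" "x = act u w" by blast
      obtain p where p: "u = cls t p" using J u by blast
      have "cls t (scal z) \<otimes>\<^bsub>Uq t\<^esub> u \<in> Uq_J t c d"
        using u sc[of z] unfolding UJ by (intro generate_ring.eng_mult)
      moreover have "act (cls t (scal z) \<otimes>\<^bsub>Uq t\<^esub> u) w = tscale z x"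
        using w u p by (simp add: Uq_simps act_cls rho_mult)
      ultimately show "tscale z x \<in> (\<lambda>u. act u w) ` Uq_J t c d" by (metis imageI)
    qed
  qed
qed

end

lemma nonzero_keys: "v \<noteq> 0 \<Longrightarrow> \<exists>x. x \<in> Poly_Mapping.keys v"
  by (metis in_keys_iff lookup_zero poly_mapping_eqI)

lemma subspace_scaleD:
  assumes "tensor.subspace W" "c \<noteq> 0" "tscale c v \<in> W"
  shows "v \<in> W"
  using tensor.subspace_scale[OF assms(1,3), of "inverse c"] assms(2) by simp

context box_config
begin

section \<open>Irreducibility\<close>

definition diag_move :: "sgn \<Rightarrow> int \<Rightarrow> int \<Rightarrow> tensor \<Rightarrow> tensor" where
  "diag_move \<epsilon> i k v = (\<Sum>p | p < N \<and> kap p = k. move \<epsilon> i p v)"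

lemma move_add: "move \<epsilon> i p (u + v) = move \<epsilon> i p u + move \<epsilon> i p v"
  by (simp add: move_def lin_add)

lemma lin_x_basis_diag_move:
  "lin (x_basis \<epsilon> i r) v = (\<Sum>k\<in>kap ` {..<N}. tscale ((a * q powi (2 * k + i)) powi r) (diag_move \<epsilon> i k v))"
proof -
  have "lin (x_basis \<epsilon> i r) v = (\<Sum>k\<in>kap ` {..<N}. \<Sum>p\<in>{p \<in> {..<N}. kap p = k}. tscale (spec i p powi r) (move \<epsilon> i p v))"
    unfolding lin_x_basis by (rule sum.image_gen) simp
  also have "\<dots> = (\<Sum>k\<in>kap ` {..<N}. tscale ((a * q powi (2 * k + i)) powi r) (diag_move \<epsilon> i k v))"
    unfolding diag_move_def tensor.scale_sum_right
    by (intro sum.cong refl) (auto simp: spec_def)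
  finally show ?thesis .
qed

text \<open>The points at which the \<open>\<delta>\<close>-functions of boxes of different contents are supported are distinct, so that Lagrange
  interpolation extracts the single moves from the modes of \<open>x\<^sub>i\<^sup>\<plusminus>(z)\<close>.\<close>

lemma diag_move_closed:
  assumes W: "tensor.subspace W" "\<And>p v. v \<in> W \<Longrightarrow> rho G p v \<in> W" and v: "v \<in> W"
  shows "diag_move \<epsilon> i k v \<in> W"
proof (cases "k \<in> kap ` {..<N}")
  case False
  then have "{p. p < N \<and> kap p = k} = {}" by auto
  then have "diag_move \<epsilon> i k v = 0" by (simp only: diag_move_def sum.empty)
  then show ?thesis using tensor.subspace_0[OF W(1)] by simp
next
  case True
  define K where "K = kap ` {..<N}"
  define c where "c = (\<lambda>k. a * q powi (2 * k + i))"
  define P where "P = (\<Prod>k'\<in>K - {k}. [:- c k', 1:])"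
  have finK: "finite K" by (simp add: K_def)
  have c: "c x = c y \<longleftrightarrow> x = y" for x y
    using a_nonzero by (auto simp: c_def powi_eq_iff)
  have P0: "poly P (c k') = 0" if "k' \<in> K" "k' \<noteq> k" for k'
    unfolding P_def poly_prod using finK that by (intro prod_zero) auto
  have P1: "poly P (c k) \<noteq> 0"
    unfolding P_def poly_prod using finK by (auto simp: c)
  have "(\<Sum>n\<le>degree P. tscale (poly.coeff P n) (lin (x_basis \<epsilon> i (int n)) v))
      = (\<Sum>n\<le>degree P. \<Sum>k\<in>K. tscale (poly.coeff P n * c k ^ n) (diag_move \<epsilon> i k v))"
    unfolding lin_x_basis_diag_move K_def c_def by (simp add: tensor.scale_sum_right)
  also have "\<dots> = (\<Sum>k\<in>K. tscale (poly P (c k)) (diag_move \<epsilon> i k v))"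
    by (subst sum.swap) (simp add: poly_altdef tensor.scale_sum_left)
  also have "\<dots> = (\<Sum>k'\<in>K. if k' = k then tscale (poly P (c k)) (diag_move \<epsilon> i k v) else 0)"
    by (rule sum.cong) (auto simp: P0)
  also have "\<dots> = tscale (poly P (c k)) (diag_move \<epsilon> i k v)"
    using finK True by (simp add: K_def)
  finally have eq: "(\<Sum>n\<le>degree P. tscale (poly.coeff P n) (lin (x_basis \<epsilon> i (int n)) v)) = tscale (poly P (c k)) (diag_move \<epsilon> i k v)" .
  have "lin (x_basis \<epsilon> i r) v \<in> W" for r
    using W(2)[OF v, of "gn (X \<epsilon> i r)"] by (simp add: G_X_fun del: G.simps)
  then have "tscale (poly P (c k)) (diag_move \<epsilon> i k v) \<in> W"
    unfolding eq[symmetric] by (intro tensor.subspace_sum[OF W(1)] tensor.subspace_scale[OF W(1)])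
  then show ?thesis by (rule subspace_scaleD[OF W(1) P1])
qed

text \<open>Entries on a diagonal are distinct, so at most one of its boxes can move.\<close>

lemma diag_move_boxes:
  assumes "js \<in> B" "p < N" "js ! p = src \<epsilon> i"
  shows "diag_move \<epsilon> i (kap p) (boxes js) = move_basis \<epsilon> i p js"
proof -
  have "diag_move \<epsilon> i (kap p) (boxes js) = (\<Sum>r\<in>{p}. move_basis \<epsilon> i r js)"
    unfolding diag_move_def move_boxes
    by (rule sum.mono_neutral_right)
      (use assms same_diag_same_entry[OF assms(1)] in \<open>auto simp: move_basis_def\<close>)
  then show ?thesis by simp
qed

lemma keys_diag_move:
  assumes "js' \<in> Poly_Mapping.keys (diag_move \<epsilon> i k v)"
  shows "\<exists>js\<in>Poly_Mapping.keys v. \<exists>p<N. kap p = k \<and> js ! p = src \<epsilon> i \<and> js' = js[p := tgt \<epsilon> i]"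
proof -
  have "(\<Sum>p | p < N \<and> kap p = k. Poly_Mapping.lookup (move \<epsilon> i p v) js') \<noteq> 0"
    using assms by (simp add: diag_move_def in_keys_iff lookup_sum)
  then obtain p where "p \<in> {p. p < N \<and> kap p = k}" "Poly_Mapping.lookup (move \<epsilon> i p v) js' \<noteq> 0"
    by (rule sum.not_neutral_contains_not_neutral)
  then have p: "p < N" "kap p = k" "js' \<in> Poly_Mapping.keys (move \<epsilon> i p v)"
    by (auto simp: in_keys_iff)
  then obtain js where "js \<in> Poly_Mapping.keys v" "js' \<in> Poly_Mapping.keys (move_basis \<epsilon> i p js)"
    using keys_lin[of "move_basis \<epsilon> i p" v] by (auto simp: move_def)
  then show ?thesis using p keys_move_basis by blast
qed

definition diag_moves :: "(int \<times> int) list \<Rightarrow> tensor \<Rightarrow> tensor" where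
  "diag_moves w = fold (\<lambda>(i, k). diag_move Pos i k) w"

lemma diag_moves_Nil [simp]: "diag_moves [] v = v"
  and diag_moves_Cons [simp]: "diag_moves ((i, k) # w) v = diag_moves w (diag_move Pos i k v)"
  by (simp_all add: diag_moves_def)

lemma diag_move_scale: "diag_move \<epsilon> i k (tscale c v) = tscale c (diag_move \<epsilon> i k v)"
  by (simp add: diag_move_def tensor.scale_sum_right)

lemma diag_moves_scale: "diag_moves w (tscale c v) = tscale c (diag_moves w v)"
  by (induction w arbitrary: v) (auto simp: diag_move_scale)

lemma diag_move_add: "diag_move \<epsilon> i k (u + v) = diag_move \<epsilon> i k u + diag_move \<epsilon> i k v"
  by (simp add: diag_move_def move_add sum.distrib)

lemma diag_moves_add: "diag_moves w (u + v) = diag_moves w u + diag_moves w v"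
  by (induction w arbitrary: u v) (auto simp: diag_move_add)

lemma diag_moves_zero: "diag_moves w 0 = 0"
  using diag_moves_scale[of w 0 0] by simp

lemma diag_moves_sum: "diag_moves w (sum f A) = (\<Sum>x\<in>A. diag_moves w (f x))"
  by (induction A rule: infinite_finite_induct) (auto simp: diag_moves_add diag_moves_zero)

lemma diag_moves_closed:
  assumes "tensor.subspace W" "\<And>p v. v \<in> W \<Longrightarrow> rho G p v \<in> W" "v \<in> W"
  shows "diag_moves w v \<in> W"
  using assms(3) by (induction w arbitrary: v) (auto simp: diag_move_closed[OF assms(1,2)])

text \<open>A lowering move of colour \<open>i\<close> on the diagonal \<open>k\<close>
  changes \<open>n_above js k m\<close> only for \<open>m = i\<close>, so that it is determined by the letters of a word of moves.\<close>

definition n_above :: "int list \<Rightarrow> int \<Rightarrow> int \<Rightarrow> nat" where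
  "n_above js k m = card {p. p < N \<and> kap p = k \<and> m < js ! p}"

lemma n_above_move:
  assumes "length js = N" "p < N" "js ! p = i + 1"
  shows "n_above js k m = n_above (js[p := i]) k m + (if kap p = k \<and> m = i then 1 else 0)"
proof (cases "kap p = k \<and> m = i")
  case True
  have "{r. r < N \<and> kap r = k \<and> m < js[p := i] ! r} = {r. r < N \<and> kap r = k \<and> m < js ! r} - {p}"
    using assms True by (auto simp: nth_list_update)
  moreover have "p \<in> {r. r < N \<and> kap r = k \<and> m < js ! r}" using assms True by auto
  ultimately show ?thesis
    unfolding n_above_def using True card_Suc_Diff1[of "{r. r < N \<and> kap r = k \<and> m < js ! r}" p] by simp
next
  case False
  have "{r. r < N \<and> kap r = k \<and> m < js[p := i] ! r} = {r. r < N \<and> kap r = k \<and> m < js ! r}"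
    using assms False by (auto simp: nth_list_update)
  then show ?thesis unfolding n_above_def using False by simp
qed

lemma n_above_diag_moves:
  assumes "js' \<in> Poly_Mapping.keys (diag_moves w v)" "\<And>js. js \<in> Poly_Mapping.keys v \<Longrightarrow> length js = N"
  shows "\<exists>js\<in>Poly_Mapping.keys v. \<forall>k m. n_above js k m = n_above js' k m + count_list w (m, k)"
  using assms
proof (induction w arbitrary: v)
  case Nil
  then show ?case by auto
next
  case (Cons x w)
  obtain i k0 where x: "x = (i, k0)" by (cases x)
  have l: "length js = N" if "js \<in> Poly_Mapping.keys (diag_move Pos i k0 v)" for js
    using keys_diag_move[OF that] Cons.prems(2) by auto
  obtain js1 where js1: "js1 \<in> Poly_Mapping.keys (diag_move Pos i k0 v)"
    "\<forall>k m. n_above js1 k m = n_above js' k m + count_list w (m, k)"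
    using Cons.IH[of "diag_move Pos i k0 v"] Cons.prems(1) l x by auto
  obtain js p where js: "js \<in> Poly_Mapping.keys v" "p < N" "kap p = k0" "js ! p = i + 1" "js1 = js[p := i]"
    using keys_diag_move[OF js1(1)] by auto
  have "n_above js k m = n_above js' k m + count_list (x # w) (m, k)" for k m
    using n_above_move[OF Cons.prems(2)[OF js(1)] js(2,4), of k m] js1(2) js x by auto
  then show ?case using js(1) by blast
qed

text \<open>\<open>n_above\<close> jumps precisely at the entries of a diagonal, and these occur in
  increasing order; so it determines the set of entries and thereby each of them.\<close>

lemma n_above_inj:
  assumes "js \<in> B" "js' \<in> B" "n_above js = n_above js'"
  shows "js = js'"
proof (rule nth_equalityI)
  show l: "length js = length js'" using assms B_length by metis
  fix p0 assume p0: "p0 < length js"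
  then have p0N: "p0 < N" using assms B_length by metis
  define k where "k = kap p0"
  have entries: "x \<in> (!) js ` {p. p < N \<and> kap p = k} \<longleftrightarrow> n_above js k (x - 1) \<noteq> n_above js k x" for x js
  proof -
    have "{p. p < N \<and> kap p = k \<and> x - 1 < js ! p} = {p. p < N \<and> kap p = k \<and> x < js ! p} \<union> {p. p < N \<and> kap p = k \<and> js ! p = x}"
      by auto
    then have "n_above js k (x - 1) = n_above js k x + card {p. p < N \<and> kap p = k \<and> js ! p = x}"
      unfolding n_above_def by (simp add: card_Un_disjoint disjoint_iff)
    then have "n_above js k (x - 1) \<noteq> n_above js k x \<longleftrightarrow> {p. p < N \<and> kap p = k \<and> js ! p = x} \<noteq> {}"
      by (simp add: card_gt_0_iff)
    then show ?thesis by auto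
  qed
  define ps where "ps = filter (\<lambda>p. kap p = k) [0..<N]"
  have ps: "set ps = {p. p < N \<and> kap p = k}" by (auto simp: ps_def)
  have sorted: "sorted_wrt (<) (map ((!) js) ps)" if "js \<in> B" for js
  proof -
    have "sorted_wrt (\<lambda>p r. p < r) ps" unfolding ps_def by (rule sorted_wrt_filter) simp
    then show ?thesis
      unfolding sorted_wrt_map
      by (rule sorted_wrt_mono_rel[rotated]) (use ps B_diag[OF that] in auto)
  qed
  have "set (map ((!) js) ps) = set (map ((!) js') ps)"
    using entries[of _ js] entries[of _ js'] assms(3) by (auto simp: ps set_eq_iff)
  then have "map ((!) js) ps = map ((!) js') ps"
    using sorted assms by (intro strict_sorted_equal) auto
  then show "js ! p0 = js' ! p0"
    using ps p0N by (auto simp: k_def)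
qed

text \<open>\<open>B_down\<close> supplies one lowering move at a time that stays in
  \<open>B\<close>, so by \<open>coef_eq_0_iff\<close> no scalar along the way is zero.\<close>

lemma lower_word:
  assumes "js \<in> B" "js' \<in> B" "\<forall>p<N. js' ! p \<le> js ! p"
  shows "\<exists>w c. c \<noteq> 0 \<and> diag_moves w (boxes js) = tscale c (boxes js')"
  using assms
proof (induction "\<Sum>p<N. nat (js ! p - js' ! p)" arbitrary: js rule: less_induct)
  case less
  show ?case
  proof (cases "js' = js")
    case True
    then show ?thesis by (intro exI[of _ "[]"] exI[of _ 1]) simp
  next
    case False
    obtain p where p: "p < N" "js' ! p < js ! p" "js[p := js ! p - 1] \<in> B"
      using B_down[OF less.prems False] by blast
    define js1 where "js1 = js[p := js ! p - 1]"
    have l: "length js = N" using less.prems B_length by blast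
    have js1: "js1 ! r = (if r = p then js ! p - 1 else js ! r)" for r
      using p l by (auto simp: js1_def nth_list_update)
    have le: "\<forall>r<N. js' ! r \<le> js1 ! r" using less.prems(3) p by (auto simp: js1)
    have "(\<Sum>r<N. nat (js1 ! r - js' ! r)) < (\<Sum>r<N. nat (js ! r - js' ! r))"
      by (rule sum_strict_mono_ex1) (use p in \<open>auto simp: js1\<close>)
    then obtain w c where w: "c \<noteq> 0" "diag_moves w (boxes js1) = tscale c (boxes js')"
      using less.hyps[of js1] p(3) le less.prems(2) by (auto simp: js1_def)
    let ?i = "js ! p - 1"
    have src: "js ! p = src Pos ?i" by simp
    have "diag_move Pos ?i (kap p) (boxes js) = tscale (coef Pos ?i js p) (boxes js1)"
      using diag_move_boxes[OF less.prems(1) p(1) src] src by (simp add: move_basis_def js1_def)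
    moreover have "coef Pos ?i js p \<noteq> 0"
      using coef_eq_0_iff[OF less.prems(1) p(1) src] p(3) by simp
    ultimately show ?thesis
      using w by (intro exI[of _ "(?i, kap p) # w"] exI[of _ "coef Pos ?i js p * c"])
        (simp add: diag_moves_scale)
  qed
qed

lemma raise_closed:
  assumes W: "tensor.subspace W" "\<And>p v. v \<in> W \<Longrightarrow> rho G p v \<in> W"
    and "js \<in> B" "js' \<in> B" "\<forall>p<N. js' ! p \<le> js ! p" "boxes js' \<in> W"
  shows "boxes js \<in> W"
  using assms(3-)
proof (induction "\<Sum>p<N. nat (js ! p - js' ! p)" arbitrary: js' rule: less_induct)
  case less
  show ?case
  proof (cases "js' = js")
    case True
    then show ?thesis using less.prems by simp
  next
    case False
    obtain p where p: "p < N" "js' ! p < js ! p" "js'[p := js' ! p + 1] \<in> B"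
      using B_up[OF less.prems(1-3) False] by blast
    define js1 where "js1 = js'[p := js' ! p + 1]"
    have l: "length js' = N" using less.prems B_length by blast
    have js1: "js1 ! r = (if r = p then js' ! p + 1 else js' ! r)" for r
      using p l by (auto simp: js1_def nth_list_update)
    have le: "\<forall>r<N. js1 ! r \<le> js ! r" using less.prems(3) p by (auto simp: js1)
    have lt: "(\<Sum>r<N. nat (js ! r - js1 ! r)) < (\<Sum>r<N. nat (js ! r - js' ! r))"
      by (rule sum_strict_mono_ex1) (use p in \<open>auto simp: js1\<close>)
    let ?i = "js' ! p"
    have src: "js' ! p = src Neg ?i" by simp
    have "diag_move Neg ?i (kap p) (boxes js') = tscale (coef Neg ?i js' p) (boxes js1)"
      using diag_move_boxes[OF less.prems(2) p(1) src] by (simp add: move_basis_def js1_def)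
    then have "tscale (coef Neg ?i js' p) (boxes js1) \<in> W"
      using diag_move_closed[OF W less.prems(4)] by metis
    moreover have "coef Neg ?i js' p \<noteq> 0"
      using coef_eq_0_iff[OF less.prems(2) p(1) src] p(3) by simp
    ultimately have "boxes js1 \<in> W" using subspace_scaleD[OF W(1)] by blast
    then show ?thesis using less.hyps[OF lt less.prems(1)] p(3) le by (simp add: js1_def)
  qed
qed

lemma invariant_subspace:
  assumes W: "tensor.subspace W" "W \<subseteq> V" "\<And>p v. v \<in> W \<Longrightarrow> rho G p v \<in> W"
    and v: "v \<in> W" "v \<noteq> 0"
  shows "W = V"
proof -
  let ?K = "Poly_Mapping.keys v"
  have KB: "?K \<subseteq> B" using v W(2) by (auto simp: V_def)
  have "?K \<noteq> {}" using nonzero_keys[OF v(2)] by blast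
  \<comment> \<open>Tableaux of the support are compared by the pointwise order of their functions
    \<open>n_above\<close>, which is only partial; hence a maximal one instead of a largest
    one.\<close>
  then have "\<exists>m\<in>n_above ` ?K. \<forall>b\<in>n_above ` ?K. m \<le> b \<longrightarrow> m = b"
    by (intro finite_has_maximal) auto
  then obtain js where js: "js \<in> ?K" "\<And>js'. js' \<in> ?K \<Longrightarrow> n_above js \<le> n_above js' \<Longrightarrow> n_above js = n_above js'"
    by blast
  define m0 where "m0 = Min (insert 0 (\<Union>js\<in>?K. set js))"
  have m0: "m0 \<le> js ! p" if "js \<in> ?K" "p < N" for js p
  proof -
    have "js ! p \<in> set js" using that KB B_length[of js] by (intro nth_mem) auto
    then show ?thesis unfolding m0_def using that(1) by (intro Min_le) auto
  qed
  obtain o' where o': "o' \<in> B" "\<forall>p<N. o' ! p < m0" using B_low by blast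
  have "\<forall>p<N. o' ! p \<le> js ! p" using o'(2) m0[OF js(1)] by fastforce
  then obtain w c where w: "c \<noteq> 0" "diag_moves w (boxes js) = tscale c (boxes o')"
    using lower_word[of js o'] js(1) KB o'(1) by auto
  have cjs: "n_above js k m = n_above o' k m + count_list w (m, k)" for k m
  proof -
    have "o' \<in> Poly_Mapping.keys (diag_moves w (boxes js))"
      unfolding w(2) using w(1) by (simp add: in_keys_iff lookup_boxes)
    from n_above_diag_moves[OF this] show ?thesis
      using js(1) KB B_length by (auto simp: boxes_def)
  qed
  have kill: "diag_moves w (boxes js') = 0" if js': "js' \<in> ?K" "js' \<noteq> js" for js'
  proof (rule ccontr)
    assume "diag_moves w (boxes js') \<noteq> 0"
    from nonzero_keys[OF this] obtain js'' where "js'' \<in> Poly_Mapping.keys (diag_moves w (boxes js'))"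
      by blast
    from n_above_diag_moves[OF this] have c': "n_above js' k m = n_above js'' k m + count_list w (m, k)" for k m
      using js'(1) KB B_length by (auto simp: boxes_def)
    \<comment> \<open>Survival of \<open>js'\<close> would contradict maximality. Above
      \<open>m0\<close> the tableau \<open>o'\<close> has no entries, so the word records
      \<open>n_above js\<close> in full and \<open>js'\<close> must have at least as many; below
      \<open>m0\<close> both count all boxes of the diagonal.\<close>
    have "n_above js k m \<le> n_above js' k m" for k m
    proof (cases "m \<ge> m0")
      case True
      then have "{p. p < N \<and> kap p = k \<and> m < o' ! p} = {}" using o'(2) by fastforce
      then have "n_above o' k m = 0" by (simp only: n_above_def card.empty)
      then show ?thesis using cjs[of k m] c'[of k m] by simp
    next
      case False
      have "{p. p < N \<and> kap p = k \<and> m < x ! p} = {p. p < N \<and> kap p = k}" if "x \<in> ?K" for x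
        using m0[OF that] False by fastforce
      then have "n_above js k m = n_above js' k m" using js(1) js'(1) by (simp only: n_above_def)
      then show ?thesis by simp
    qed
    then have "n_above js = n_above js'" using js(2)[OF js'(1)] by (simp add: le_fun_def)
    then show False using n_above_inj[of js js'] js(1) js' KB by auto
  qed
  have "v = (\<Sum>js'\<in>?K. tscale (Poly_Mapping.lookup v js') (boxes js'))"
    using lin_boxes_id[of v] by (simp add: lin_def)
  then have "diag_moves w v = (\<Sum>js'\<in>?K. tscale (Poly_Mapping.lookup v js') (diag_moves w (boxes js')))"
    by (metis (no_types, lifting) diag_moves_scale diag_moves_sum sum.cong)
  also have "\<dots> = (\<Sum>js'\<in>{js}. tscale (Poly_Mapping.lookup v js') (diag_moves w (boxes js')))"
    by (rule sum.mono_neutral_right) (use js kill in auto)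
  finally have "diag_moves w v = tscale (Poly_Mapping.lookup v js * c) (boxes o')"
    using w by simp
  then have "tscale (Poly_Mapping.lookup v js * c) (boxes o') \<in> W"
    using diag_moves_closed[OF W(1,3) v(1)] by metis
  moreover have "Poly_Mapping.lookup v js * c \<noteq> 0" using js(1) w(1) by (simp add: in_keys_iff)
  ultimately have oW: "boxes o' \<in> W" using subspace_scaleD[OF W(1)] by blast
  have "boxes js' \<in> W" if js': "js' \<in> B" for js'
  proof -
    \<comment> \<open>\<open>o'\<close> and \<open>js'\<close> need not be comparable entrywise. The
      path therefore descends to a tableau \<open>u\<close> below both and climbs up again.\<close>
    define m1 where "m1 = Min (insert 0 (set o' \<union> set js'))"
    have m1: "m1 \<le> o' ! p" "m1 \<le> js' ! p" if "p < N" for p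
    proof -
      have "o' ! p \<in> set o'" "js' ! p \<in> set js'"
        using that B_length[OF o'(1)] B_length[OF js'] by (auto intro: nth_mem)
      then show "m1 \<le> o' ! p" "m1 \<le> js' ! p" unfolding m1_def by (auto intro!: Min_le)
    qed
    obtain u where u: "u \<in> B" "\<forall>p<N. u ! p < m1" using B_low by blast
    have le: "\<forall>p<N. u ! p \<le> o' ! p" "\<forall>p<N. u ! p \<le> js' ! p" using u(2) m1 by fastforce+
    obtain w c where w: "c \<noteq> 0" "diag_moves w (boxes o') = tscale c (boxes u)"
      using lower_word[OF o'(1) u(1) le(1)] by blast
    then have "tscale c (boxes u) \<in> W"
      using diag_moves_closed[OF W(1,3) oW] by metis
    then have "boxes u \<in> W" by (rule subspace_scaleD[OF W(1) w(1)])
    from raise_closed[OF W(1,3) js' u(1) le(2) this] show ?thesis .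
  qed
  then have "V \<subseteq> W"
    unfolding V_eq_span by (intro tensor.span_minimal W(1)) auto
  then show ?thesis using W(2) by blast
qed

lemma rho_closed:
  assumes "uq_module t tscale W act" "W \<subseteq> V" "v \<in> W"
  shows "rho G p v \<in> W"
proof -
  have "cls t p \<in> carrier (Uq t)" by (simp add: Uq_simps)
  then have "act (cls t p) v \<in> W" using assms by (auto simp: uq_module_def)
  then show ?thesis using assms by (auto simp: act_cls)
qed

lemma irreducible: "irreducible_module t tscale V act"
  unfolding irreducible_module_def
proof (intro conjI allI impI uq_module_V)
  obtain js where "js \<in> B" using B_low by blast
  then show "V \<noteq> {0}" by (metis boxes_V boxes_nonzero singletonD)
next
  fix W assume W: "W \<subseteq> V \<and> uq_module t tscale W act"
  then have sub: "tensor.subspace W" by (simp add: uq_module_def)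
  show "W = {0} \<or> W = V"
  proof (cases "\<exists>v\<in>W. v \<noteq> 0")
    case True
    then show ?thesis
      using invariant_subspace[OF sub _ rho_closed] W by blast
  next
    case False
    then show ?thesis using tensor.subspace_0[OF sub] by blast
  qed
qed

lemma cyclic:
  assumes v: "v \<in> V" "v \<noteq> 0"
  shows "(\<lambda>u. act u v) ` carrier (Uq t) = V"
proof -
  have eq: "(\<lambda>u. act u v) ` carrier (Uq t) = range (\<lambda>p. rho G p v)"
    using v by (auto simp: Uq_simps act_cls image_iff)
  have "range (\<lambda>p. rho G p v) = V"
  proof (rule invariant_subspace)
    show "tensor.subspace (range (\<lambda>p. rho G p v))"
      unfolding tensor.subspace_def
    proof (intro conjI ballI allI)
      show "0 \<in> range (\<lambda>p. rho G p v)" by (rule range_eqI[of _ _ 0]) simp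
      fix x y assume "x \<in> range (\<lambda>p. rho G p v)" "y \<in> range (\<lambda>p. rho G p v)"
      then obtain p p' where "x = rho G p v" "y = rho G p' v" by blast
      then show "x + y \<in> range (\<lambda>p. rho G p v)" by (metis rho_add rangeI)
    next
      fix c x assume "x \<in> range (\<lambda>p. rho G p v)"
      then obtain p where "x = rho G p v" by blast
      then have "tscale c x = rho G (scal c * p) v" by (simp add: rho_mult)
      then show "tscale c x \<in> range (\<lambda>p. rho G p v)" by blast
    qed
    show "range (\<lambda>p. rho G p v) \<subseteq> V" using rho_V v by auto
    show "rho G p x \<in> range (\<lambda>p. rho G p v)" if "x \<in> range (\<lambda>p. rho G p v)" for p x
      using that by (auto simp flip: rho_mult)
    show "v \<in> range (\<lambda>p. rho G p v)" by (rule range_eqI[of _ _ 1]) simp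
  qed (rule v)
  then show ?thesis using eq by simp
qed

end

section \<open>Readings of tableaux\<close>

lemma length_reading [simp]: "length (reading l k T) = k * l"
  by (induction k) (auto simp: reading_def)

lemma nth_reading:
  "p < k * l \<Longrightarrow> reading l k T ! p = T (p mod l + 1) (p div l + 1)"
proof (induction k)
  case (Suc k)
  have step: "reading l (Suc k) T = reading l k T @ map (\<lambda>i. T i (Suc k)) [1..<Suc l]"
    by (simp add: reading_def)
  show ?case
  proof (cases "p < k * l")
    case True
    then show ?thesis using Suc.IH by (simp add: step nth_append)
  next
    case False
    define r where "r = p - k * l"
    have r: "p = k * l + r" "r < l" using False Suc.prems by (auto simp: r_def)
    then have "p div l = k" "p mod l = r" by auto
    then show ?thesis using r by (simp add: step nth_append del: upt_Suc)
  qed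
qed simp

text \<open>Columns of length \<open>l\<close> are read one after the other, so
  \<open>p div l\<close> is the column and \<open>p mod l\<close> the row, both counted from 0. The
  box parameter is \<open>a\<close> times \<open>q\<close> to twice this content.\<close>

definition box_content :: "nat \<Rightarrow> nat \<Rightarrow> int" where
  "box_content l p = int (p div l) - int (p mod l)"

text \<open>In the reading, \<open>p + l\<close> is the right neighbour of \<open>p\<close>, and
  \<open>Suc p\<close> the box below it unless a new column begins there.\<close>

definition tab_word :: "nat \<Rightarrow> nat \<Rightarrow> int list \<Rightarrow> bool" where
  "tab_word l N js \<longleftrightarrow> length js = N \<and> (\<forall>p. p + l < N \<longrightarrow> js ! p \<le> js ! (p + l)) \<and>
     (\<forall>p. Suc p < N \<longrightarrow> Suc p mod l \<noteq> 0 \<longrightarrow> js ! p < js ! Suc p)"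

lemma Suc_mod_div:
  assumes "Suc p mod l \<noteq> 0"
  shows "Suc p mod l = Suc (p mod l)" "Suc p div l = p div l"
  using assms by (auto simp: mod_Suc div_Suc split: if_splits)

lemma content_neighbours:
  assumes "l \<ge> 1"
  shows "box_content l (p + l) = box_content l p + 1" "Suc p mod l \<noteq> 0 \<Longrightarrow> box_content l (Suc p) = box_content l p - 1"
  using assms Suc_mod_div[of p l] by (auto simp: box_content_def)

lemma tab_word_rowD: "tab_word l N js \<Longrightarrow> p + l < N \<Longrightarrow> js ! p \<le> js ! (p + l)"
  and tab_word_columnD: "tab_word l N js \<Longrightarrow> Suc p < N \<Longrightarrow> Suc p mod l \<noteq> 0 \<Longrightarrow> js ! p < js ! Suc p"
  by (simp_all add: tab_word_def)

lemma tab_word_row: "tab_word l N js \<Longrightarrow> p + n * l < N \<Longrightarrow> js ! p \<le> js ! (p + n * l)"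
proof (induction n)
  case (Suc n)
  then have "js ! p \<le> js ! (p + n * l)" by simp
  also have "\<dots> \<le> js ! (p + n * l + l)" using Suc.prems by (auto simp: tab_word_def algebra_simps)
  finally show ?case by (simp add: algebra_simps)
qed simp

lemma tab_word_column: "tab_word l N js \<Longrightarrow> p mod l + n < l \<Longrightarrow> p + n < N \<Longrightarrow> js ! p + int n \<le> js ! (p + n)"
proof (induction n)
  case (Suc n)
  have "(p + n) mod l = p mod l + n" using Suc.prems(2)
    by (metis add_lessD1 add_Suc_right mod_add_left_eq mod_less Suc_lessD)
  then have "Suc (p + n) mod l \<noteq> 0" using Suc.prems(2) by (auto simp: mod_Suc)
  then have "js ! (p + n) < js ! (Suc (p + n))" using Suc.prems by (auto simp: tab_word_def)
  moreover have "js ! p + int n \<le> js ! (p + n)" using Suc by simp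
  ultimately show ?case by simp
qed simp

text \<open>Walk down the column to the row of \<open>r\<close>, where every step gains at least
  one, then along this row.\<close>

lemma tab_word_le:
  assumes tab_word: "tab_word l N js" and r: "r < N"
    and le: "p mod l \<le> r mod l" "p div l \<le> r div l" and l: "l \<ge> 1"
  shows "js ! p + (int (r mod l) - int (p mod l)) \<le> js ! r"
proof -
  define n m where "n = r mod l - p mod l" and "m = r div l - p div l"
  have r': "r = r div l * l + r mod l" by simp
  have m: "r div l = p div l + m" and n: "r mod l = p mod l + n" using le by (simp_all add: m_def n_def)
  have "r = (p div l + m) * l + (p mod l + n)" using r' m n by simp
  also have "\<dots> = p div l * l + p mod l + n + m * l" by (simp add: algebra_simps)
  finally have eq: "r = p + n + m * l" by simp
  have nl: "p mod l + n < l" using n l by (metis mod_less_divisor less_le_trans zero_less_one)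
  have "js ! p + int n \<le> js ! (p + n)"
    using tab_word_column[OF tab_word nl] r eq by simp
  also have "\<dots> \<le> js ! (p + n + m * l)"
    using tab_word_row[OF tab_word, of "p + n" m] r eq by simp
  finally show ?thesis using eq n by simp
qed

lemma tab_word_iff:
  assumes l: "l \<ge> 1"
  shows "js \<in> reading l k ` tableaux l k \<longleftrightarrow> tab_word l (k * l) js"
proof
  assume "js \<in> reading l k ` tableaux l k"
  then obtain T where T: "js = reading l k T"
    "\<And>i j j'. i \<in> {1..l} \<Longrightarrow> j \<in> {1..k} \<Longrightarrow> j' \<in> {1..k} \<Longrightarrow> j \<le> j' \<Longrightarrow> T i j \<le> T i j'"
    "\<And>i i' j. i \<in> {1..l} \<Longrightarrow> i' \<in> {1..l} \<Longrightarrow> j \<in> {1..k} \<Longrightarrow> i < i' \<Longrightarrow> T i j < T i' j"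
    by (auto simp: tableaux_def)
  have row: "p mod l + 1 \<in> {1..l}" for p using l by (simp add: Suc_leI)
  have col: "p div l + 1 \<in> {1..k}" if "p < k * l" for p
    using that l by (simp add: Suc_leI less_mult_imp_div_less)
  show "tab_word l (k * l) js"
    unfolding tab_word_def
  proof (intro conjI allI impI)
    fix p assume "p + l < k * l"
    then show "js ! p \<le> js ! (p + l)"
      using T(2)[OF row[of p] col[of p] col[of "p + l"]] l by (simp add: T(1) nth_reading)
  next
    fix p assume p: "Suc p < k * l" "Suc p mod l \<noteq> 0"
    then show "js ! p < js ! Suc p"
      using T(3)[OF row[of p] row[of "Suc p"] col[of p]] Suc_mod_div[OF p(2)]
      by (simp add: T(1) nth_reading)
  qed (simp add: T(1))
next
  assume tab_word: "tab_word l (k * l) js"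
  define T where "T = (\<lambda>i j. js ! ((j - 1) * l + (i - 1)))"
  have idx: "((j - 1) * l + (i - 1)) mod l = i - 1" "((j - 1) * l + (i - 1)) div l = j - 1"
    "(j - 1) * l + (i - 1) < k * l" if "i \<in> {1..l}" "j \<in> {1..k}" for i j
  proof -
    have "i - 1 < l" using that by auto
    then show "((j - 1) * l + (i - 1)) mod l = i - 1" "((j - 1) * l + (i - 1)) div l = j - 1" by auto
    have "(j - 1) * l + (i - 1) < (j - 1) * l + l" using \<open>i - 1 < l\<close> by simp
    also have "\<dots> = j * l" using that by (cases j) auto
    also have "\<dots> \<le> k * l" using that by simp
    finally show "(j - 1) * l + (i - 1) < k * l" .
  qed
  have "T \<in> tableaux l k"
    unfolding tableaux_def
  proof (intro CollectI conjI ballI impI)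
    fix i j j' assume *: "i \<in> {1..l}" "j \<in> {1..k}" "j' \<in> {1..k}" "j \<le> j'"
    note a = idx[OF *(1,2)] and b = idx[OF *(1,3)]
    have "j - 1 \<le> j' - 1" using * by auto
    then have "T i j + (int (i - 1) - int (i - 1)) \<le> T i j'"
      using tab_word_le[OF tab_word b(3) _ _ l, of "(j - 1) * l + (i - 1)"] unfolding a b T_def by blast
    then show "T i j \<le> T i j'" by simp
  next
    fix i i' j assume *: "i \<in> {1..l}" "i' \<in> {1..l}" "j \<in> {1..k}" "i < i'"
    note a = idx[OF *(1,3)] and b = idx[OF *(2,3)]
    have "i - 1 \<le> i' - 1" using * by auto
    then have "T i j + (int (i' - 1) - int (i - 1)) \<le> T i' j"
      using tab_word_le[OF tab_word b(3) _ _ l, of "(j - 1) * l + (i - 1)"] unfolding a b T_def by blast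
    then show "T i j < T i' j" using * by auto
  qed
  moreover have "js = reading l k T"
    by (rule nth_equalityI) (use tab_word in \<open>auto simp: tab_word_def nth_reading T_def\<close>)
  ultimately show "js \<in> reading l k ` tableaux l k" by blast
qed

lemma tab_word_update:
  assumes tab_word: "tab_word l N js" and p: "p < N" and l: "l \<ge> 1"
  shows "tab_word l N (js[p := x]) \<longleftrightarrow>
    (l \<le> p \<longrightarrow> js ! (p - l) \<le> x) \<and> (p + l < N \<longrightarrow> x \<le> js ! (p + l)) \<and>
    (p mod l \<noteq> 0 \<longrightarrow> js ! (p - 1) < x) \<and> (Suc p < N \<longrightarrow> Suc p mod l \<noteq> 0 \<longrightarrow> x < js ! Suc p)"
    (is "_ \<longleftrightarrow> ?R")
proof
  have len: "length js = N" using tab_word by (simp add: tab_word_def)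
  have upd: "js[p := x] ! r = (if r = p then x else js ! r)" for r
    using p len by (simp add: nth_list_update)
  assume t: "tab_word l N (js[p := x])"
  have row: "js[p := x] ! r \<le> js[p := x] ! (r + l)" if "r + l < N" for r
    using t that by (simp add: tab_word_def)
  have col: "js[p := x] ! r < js[p := x] ! Suc r" if "Suc r < N" "Suc r mod l \<noteq> 0" for r
    using t that by (simp add: tab_word_def)
  show ?R
  proof (intro conjI impI)
    assume "l \<le> p" then show "js ! (p - l) \<le> x" using row[of "p - l"] p l by (simp add: upd split: if_splits)
  next
    assume "p + l < N" then show "x \<le> js ! (p + l)" using row[of p] l by (simp add: upd split: if_splits)
  next
    assume "p mod l \<noteq> 0"
    moreover from this have "Suc (p - 1) = p" by (cases p) auto
    ultimately show "js ! (p - 1) < x"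
      using col[of "p - 1"] p by (auto simp: upd split: if_splits)
  next
    assume "Suc p < N" "Suc p mod l \<noteq> 0" then show "x < js ! Suc p"
      using col[of p] by (simp add: upd)
  qed
next
  have len: "length js = N" using tab_word by (simp add: tab_word_def)
  have upd: "js[p := x] ! r = (if r = p then x else js ! r)" for r
    using p len by (simp add: nth_list_update)
  assume R: ?R
  show "tab_word l N (js[p := x])"
    unfolding tab_word_def
  proof (intro conjI allI impI)
    fix r assume "r + l < N"
    then show "js[p := x] ! r \<le> js[p := x] ! (r + l)"
      using R tab_word l unfolding upd by (auto simp: tab_word_def)
  next
    fix r assume "Suc r < N" "Suc r mod l \<noteq> 0"
    then show "js[p := x] ! r < js[p := x] ! Suc r"
      using R tab_word unfolding upd by (auto simp: tab_word_def)
  qed (simp add: len)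
qed

text \<open>In the second alternative \<open>r\<close> is at least two rows further down, so
  \<open>tab_word_le\<close> separates the entries by at least 2 and \<open>r\<close> cannot
  obstruct a move of \<open>p\<close>. Thus the non-local condition of \<open>B_move\<close>
  concerns true neighbours only.\<close>

lemma content_bef:
  assumes l: "l \<ge> 1" and "p < r" "box_content l r = box_content l p - 1"
  shows "r = Suc p \<and> Suc p mod l \<noteq> 0 \<or> p div l \<le> r div l \<and> p mod l + 2 \<le> r mod l"
proof -
  have d: "p div l \<le> r div l" using assms(2) by (simp add: div_le_mono)
  show ?thesis
  proof (cases "p div l = r div l")
    case True
    then have "r mod l = Suc (p mod l)" using assms(3) by (auto simp: box_content_def)
    moreover from this have "r = Suc p"
      using True by (metis add_Suc_right div_mult_mod_eq)
    ultimately show ?thesis by auto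
  next
    case False
    then show ?thesis using d assms(3) by (auto simp: box_content_def)
  qed
qed

text \<open>If \<open>r\<close> is not the right neighbour, it lies in a lower row and its entry is
  strictly larger, whereas this kind of obstruction needs equal entries.\<close>

lemma content_bef':
  assumes l: "l \<ge> 1" and "p < r" "box_content l r = box_content l p + 1"
  shows "r = p + l \<or> p div l \<le> r div l \<and> p mod l + 1 \<le> r mod l"
proof -
  have d: "p div l \<le> r div l" using assms(2) by (simp add: div_le_mono)
  show ?thesis
  proof (cases "p mod l = r mod l")
    case True
    then have "r div l = Suc (p div l)" using assms(3) by (auto simp: box_content_def)
    then have "r = p + l"
      using True by (metis add.commute add.left_commute div_mult_mod_eq mult_Suc)
    then show ?thesis by simp
  next
    case False
    moreover have "p div l \<noteq> r div l"
    proof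
      assume e: "p div l = r div l"
      then have "p mod l < r mod l" using assms(2)
        by (metis add_less_cancel_left div_mult_mod_eq)
      then show False using e assms(3) by (auto simp: box_content_def)
    qed
    ultimately show ?thesis using d assms(3) by (auto simp: box_content_def)
  qed
qed

text \<open>Lowering an entry by one endangers only the inequalities with the left and the upper
  neighbour, and each fails in exactly one way.\<close>

lemma tab_word_move_Pos:
  assumes tab_word: "tab_word l N js" and p: "p < N" and l: "l \<ge> 1" and src: "js ! p = i + 1"
  shows "tab_word l N (js[p := i]) \<longleftrightarrow>
    \<not> (\<exists>r<N. r < p \<and> (js ! r = i \<and> box_content l r - box_content l p = 1 \<or>
                      js ! r = i + 1 \<and> box_content l r - box_content l p = -1))"
proof -
  have right: "p + l < N \<longrightarrow> i \<le> js ! (p + l)" and below: "Suc p < N \<longrightarrow> Suc p mod l \<noteq> 0 \<longrightarrow> i < js ! Suc p"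
    using tab_word src by (fastforce simp: tab_word_def)+
  have left: "js ! (p - l) \<le> i + 1" if "l \<le> p"
    using tab_word that p src by (auto simp: tab_word_def dest!: spec[of _ "p - l"])
  have above: "js ! (p - 1) \<le> i" if "p mod l \<noteq> 0"
  proof -
    have "Suc (p - 1) = p" using that by (cases p) auto
    then show ?thesis using tab_word that p src by (auto simp: tab_word_def dest!: spec[of _ "p - 1"])
  qed
  have e0: "(\<exists>r<N. r < p \<and> (js ! r = i \<and> box_content l r - box_content l p = 1 \<or>
                      js ! r = i + 1 \<and> box_content l r - box_content l p = -1))
    \<longleftrightarrow> l \<le> p \<and> js ! (p - l) = i + 1 \<or> p mod l \<noteq> 0 \<and> js ! (p - 1) = i" (is "?L \<longleftrightarrow> ?R")
  proof
    assume ?L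
    then obtain r where r: "r < p" "js ! r = i \<and> box_content l p = box_content l r - 1 \<or>
      js ! r = i + 1 \<and> box_content l p = box_content l r + 1" by auto
    from r(2) show ?R
    proof
      assume a: "js ! r = i \<and> box_content l p = box_content l r - 1"
      then show ?R
        using content_bef[OF l r(1)] tab_word_le[OF tab_word p, of r] src l by auto
    next
      assume a: "js ! r = i + 1 \<and> box_content l p = box_content l r + 1"
      then show ?R
        using content_bef'[OF l r(1)] tab_word_le[OF tab_word p, of r] src l by auto
    qed
  next
    assume ?R
    then show ?L
    proof
      assume "l \<le> p \<and> js ! (p - l) = i + 1"
      then show ?L using content_neighbours(1)[OF l, of "p - l"] p l
        by (intro exI[of _ "p - l"]) auto
    next
      assume *: "p mod l \<noteq> 0 \<and> js ! (p - 1) = i"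
      then have "Suc (p - 1) = p" by (cases p) auto
      then show ?L using * content_neighbours(2)[OF l, of "p - 1"] p
        by (intro exI[of _ "p - 1"]) auto
    qed
  qed
  have e1: "(l \<le> p \<longrightarrow> js ! (p - l) \<le> i) \<longleftrightarrow> \<not> (l \<le> p \<and> js ! (p - l) = i + 1)"
    using left by auto
  have e2: "(p mod l \<noteq> 0 \<longrightarrow> js ! (p - 1) < i) \<longleftrightarrow> \<not> (p mod l \<noteq> 0 \<and> js ! (p - 1) = i)"
    using above by auto
  have e3: "(A \<and> B \<and> C \<and> D) = (\<not> (A' \<or> C'))" if B D "A = (\<not> A')" "C = (\<not> C')" for A B C D A' C'
    using that by blast
  show ?thesis
    unfolding tab_word_update[OF tab_word p l] e0 by (rule e3[OF right below e1 e2])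
qed

text \<open>Raising an entry by one endangers only the inequalities with the right and the lower
  neighbour.\<close>

lemma tab_word_move_Neg:
  assumes tab_word: "tab_word l N js" and p: "p < N" and l: "l \<ge> 1" and src: "js ! p = i"
  shows "tab_word l N (js[p := i + 1]) \<longleftrightarrow>
    \<not> (\<exists>r<N. p < r \<and> (js ! r = i + 1 \<and> box_content l p - box_content l r = 1 \<or>
                      js ! r = i \<and> box_content l p - box_content l r = -1))"
proof -
  have left: "l \<le> p \<longrightarrow> js ! (p - l) \<le> i + 1"
    using tab_word p src by (auto simp: tab_word_def dest!: spec[of _ "p - l"])
  have above: "p mod l \<noteq> 0 \<longrightarrow> js ! (p - 1) < i + 1"
  proof
    assume m: "p mod l \<noteq> 0"
    then have "Suc (p - 1) = p" by (cases p) auto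
    then show "js ! (p - 1) < i + 1" using tab_word m p src by (auto simp: tab_word_def dest!: spec[of _ "p - 1"])
  qed
  have right: "i \<le> js ! (p + l)" if "p + l < N"
    using tab_word that src by (auto simp: tab_word_def)
  have below: "i + 1 \<le> js ! Suc p" if "Suc p < N" "Suc p mod l \<noteq> 0"
    using tab_word that src by (auto simp: tab_word_def)
  have e0: "(\<exists>r<N. p < r \<and> (js ! r = i + 1 \<and> box_content l p - box_content l r = 1 \<or>
                      js ! r = i \<and> box_content l p - box_content l r = -1))
    \<longleftrightarrow> p + l < N \<and> js ! (p + l) = i \<or> Suc p < N \<and> Suc p mod l \<noteq> 0 \<and> js ! Suc p = i + 1" (is "?L \<longleftrightarrow> ?R")
  proof
    assume ?L
    then obtain r where r: "r < N" "p < r" "js ! r = i + 1 \<and> box_content l r = box_content l p - 1 \<or>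
      js ! r = i \<and> box_content l r = box_content l p + 1" by auto
    from r(3) show ?R
    proof
      assume a: "js ! r = i + 1 \<and> box_content l r = box_content l p - 1"
      then show ?R
        using content_bef[OF l r(2)] tab_word_le[OF tab_word r(1), of p] r(1) src l by auto
    next
      assume a: "js ! r = i \<and> box_content l r = box_content l p + 1"
      then show ?R
        using content_bef'[OF l r(2)] tab_word_le[OF tab_word r(1), of p] r(1) src l by auto
    qed
  next
    assume ?R
    then show ?L
    proof
      assume "p + l < N \<and> js ! (p + l) = i"
      then show ?L using content_neighbours(1)[OF l, of p] l
        by (intro exI[of _ "p + l"]) auto
    next
      assume *: "Suc p < N \<and> Suc p mod l \<noteq> 0 \<and> js ! Suc p = i + 1"
      then show ?L using content_neighbours(2)[OF l, of p]
        by (intro exI[of _ "Suc p"]) auto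
    qed
  qed
  have e1: "(p + l < N \<longrightarrow> i + 1 \<le> js ! (p + l)) \<longleftrightarrow> \<not> (p + l < N \<and> js ! (p + l) = i)"
    using right by auto
  have e2: "(Suc p < N \<longrightarrow> Suc p mod l \<noteq> 0 \<longrightarrow> i + 1 < js ! Suc p)
      \<longleftrightarrow> \<not> (Suc p < N \<and> Suc p mod l \<noteq> 0 \<and> js ! Suc p = i + 1)"
    using below by auto
  have e3: "(A \<and> B \<and> C \<and> D) = (\<not> (B' \<or> D'))" if A C "B = (\<not> B')" "D = (\<not> D')" for A B C D B' D'
    using that by blast
  show ?thesis
    unfolding tab_word_update[OF tab_word p l] e0 by (rule e3[OF left above e1 e2])
qed

lemma tab_word_diag:
  assumes tab_word: "tab_word l N js" and pr: "p < r" "r < N" and c: "box_content l p = box_content l r" and l: "l \<ge> 1"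
  shows "p mod l < r mod l" "p div l < r div l" "js ! p + (int (r mod l) - int (p mod l)) \<le> js ! r"
proof -
  have d: "p div l \<le> r div l" using pr by (simp add: div_le_mono)
  have "p div l \<noteq> r div l"
  proof
    assume e: "p div l = r div l"
    then have "p mod l = r mod l" using c by (auto simp: box_content_def)
    then show False using e pr by (metis div_mult_mod_eq less_irrefl)
  qed
  then show dd: "p div l < r div l" using d by simp
  then show mm: "p mod l < r mod l" using c by (auto simp: box_content_def)
  show "js ! p + (int (r mod l) - int (p mod l)) \<le> js ! r"
    using tab_word_le[OF tab_word pr(2), of p] dd mm l by simp
qed

text \<open>Entries grow by at least one per row, so a difference of one puts \<open>r\<close> one
  row and one column further, at \<open>p + l + 1\<close>. The other two corners are squeezed: the
  right neighbour to the smaller entry, the lower one to the larger.\<close>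

lemma tab_word_square:
  assumes tab_word: "tab_word l N js" and pr: "p < r" "r < N" and c: "box_content l p = box_content l r" and l: "l \<ge> 1"
    and e: "js ! r = js ! p + 1"
  shows "(\<exists>s. p < s \<and> s < r \<and> js ! s = js ! p \<and> box_content l s = box_content l p + 1) \<and>
      (\<exists>s. p < s \<and> s < r \<and> js ! s = js ! r \<and> box_content l s = box_content l p - 1)"
proof -
  note d = tab_word_diag[OF tab_word pr c l]
  have m: "r mod l = Suc (p mod l)" using d e by simp
  then have dv: "r div l = Suc (p div l)" using c by (auto simp: box_content_def)
  have "r = r div l * l + r mod l" by simp
  also have "\<dots> = p div l * l + p mod l + l + 1" unfolding m dv by (simp add: algebra_simps)
  finally have r: "r = Suc p + l" by simp
  have "r mod l = Suc p mod l" by (simp only: r mod_add_self2)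
  then have sm: "Suc p mod l \<noteq> 0" using m by simp
  have "js ! p \<le> js ! (p + l)" "js ! p < js ! Suc p" "js ! Suc p \<le> js ! r"
    using tab_word_rowD[OF tab_word, of p] tab_word_columnD[OF tab_word _ sm] tab_word_rowD[OF tab_word, of "Suc p"] pr r by simp_all
  moreover have "js ! (p + l) < js ! r"
    using tab_word_columnD[OF tab_word, of "p + l"] pr(2) m r by simp
  ultimately have "js ! (p + l) = js ! p" "js ! Suc p = js ! r" using e by auto
  then show ?thesis
    using r l content_neighbours(1)[OF l, of p] content_neighbours(2)[OF l sm]
    by (intro conjI exI[of _ "p + l"] exI[of _ "Suc p"]) auto
qed

text \<open>Take the first position where the two words differ. Its left and upper neighbours come
  earlier in the reading, hence already agree with \<open>js'\<close>, which leaves room for the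
  lower entry.\<close>

lemma tab_word_down:
  assumes js: "tab_word l N js" "tab_word l N js'" and le: "\<forall>p<N. js' ! p \<le> js ! p" and neq: "js' \<noteq> js" and l: "l \<ge> 1"
  shows "\<exists>p<N. js' ! p < js ! p \<and> tab_word l N (js[p := js ! p - 1])"
proof -
  have "\<exists>p<N. js' ! p \<noteq> js ! p"
    using neq js by (auto simp: tab_word_def intro: nth_equalityI)
  then have ex: "\<exists>p. p < N \<and> js' ! p < js ! p" using le by fastforce
  define p where "p = (LEAST p. p < N \<and> js' ! p < js ! p)"
  have p: "p < N" "js' ! p < js ! p" using LeastI_ex[OF ex] by (auto simp: p_def)
  have min: "js' ! r = js ! r" if "r < p" for r
  proof -
    have "\<not> (r < N \<and> js' ! r < js ! r)" using that unfolding p_def by (rule not_less_Least)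
    moreover have "r < N" using that p by simp
    ultimately show ?thesis using le by fastforce
  qed
  have "tab_word l N (js[p := js ! p - 1])"
    unfolding tab_word_update[OF js(1) p(1) l]
  proof (intro conjI impI)
    assume lp: "l \<le> p"
    then have "js' ! (p - l) \<le> js' ! p" using js(2) p by (auto simp: tab_word_def dest!: spec[of _ "p - l"])
    then show "js ! (p - l) \<le> js ! p - 1" using min[of "p - l"] lp l p by simp
  next
    assume m: "p mod l \<noteq> 0"
    then have "Suc (p - 1) = p" by (cases p) auto
    then have "js' ! (p - 1) < js' ! p" using js(2) p m by (auto simp: tab_word_def dest!: spec[of _ "p - 1"])
    then show "js ! (p - 1) < js ! p - 1" using min[of "p - 1"] \<open>Suc (p - 1) = p\<close> p by simp
  next
    assume "p + l < N"
    then have "js ! p \<le> js ! (p + l)" using js(1) by (auto simp: tab_word_def)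
    then show "js ! p - 1 \<le> js ! (p + l)" by simp
  next
    assume "Suc p < N" "Suc p mod l \<noteq> 0"
    then have "js ! p < js ! Suc p" using js(1) by (auto simp: tab_word_def)
    then show "js ! p - 1 < js ! Suc p" by simp
  qed
  then show ?thesis using p by blast
qed

text \<open>Dually, at the last position of difference the right and lower neighbours of
  \<open>js'\<close> agree with those of \<open>js\<close>.\<close>

lemma tab_word_up:
  assumes js: "tab_word l N js" "tab_word l N js'" and le: "\<forall>p<N. js' ! p \<le> js ! p" and neq: "js' \<noteq> js" and l: "l \<ge> 1"
  shows "\<exists>p<N. js' ! p < js ! p \<and> tab_word l N (js'[p := js' ! p + 1])"
proof -
  have "\<exists>p<N. js' ! p \<noteq> js ! p"
    using neq js by (auto simp: tab_word_def intro: nth_equalityI)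
  then have ex: "\<exists>p. p < N \<and> js' ! p < js ! p" using le by fastforce
  define p where "p = (GREATEST p. p < N \<and> js' ! p < js ! p)"
  have bd: "\<forall>y. y < N \<and> js' ! y < js ! y \<longrightarrow> y \<le> N" by simp
  have p: "p < N" "js' ! p < js ! p"
    using GreatestI_ex_nat[OF ex, of N] bd by (auto simp: p_def)
  have max: "js' ! r = js ! r" if "p < r" "r < N" for r
  proof -
    have "\<not> js' ! r < js ! r"
      using Greatest_le_nat[of "\<lambda>p. p < N \<and> js' ! p < js ! p" r N] that by (auto simp: p_def)
    then show ?thesis using le that by fastforce
  qed
  have "tab_word l N (js'[p := js' ! p + 1])"
    unfolding tab_word_update[OF js(2) p(1) l]
  proof (intro conjI impI)
    assume lp: "l \<le> p"
    then have "js' ! (p - l) \<le> js' ! p" using js(2) p by (auto simp: tab_word_def dest!: spec[of _ "p - l"])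
    then show "js' ! (p - l) \<le> js' ! p + 1" by simp
  next
    assume m: "p mod l \<noteq> 0"
    then have "Suc (p - 1) = p" by (cases p) auto
    then have "js' ! (p - 1) < js' ! p" using js(2) p m by (auto simp: tab_word_def dest!: spec[of _ "p - 1"])
    then show "js' ! (p - 1) < js' ! p + 1" by simp
  next
    assume "p + l < N"
    then have "js ! p \<le> js ! (p + l)" "js' ! (p + l) = js ! (p + l)"
      using js(1) max[of "p + l"] l by (auto simp: tab_word_def)
    then show "js' ! p + 1 \<le> js' ! (p + l)" using p by simp
  next
    assume "Suc p < N" "Suc p mod l \<noteq> 0"
    then have "js ! p < js ! Suc p" "js' ! Suc p = js ! Suc p"
      using js(1) max[of "Suc p"] by (auto simp: tab_word_def)
    then show "js' ! p + 1 < js' ! Suc p" using p by simp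
  qed
  then show ?thesis using p by blast
qed

lemma box_config_tableaux:
  assumes q: "\<And>n :: nat. n \<ge> 1 \<Longrightarrow> exp t ^ n \<noteq> 1" and a: "a \<noteq> 0" and l: "l \<ge> 1"
  shows "box_config t a (k * l) (box_content l) (reading l k ` tableaux l k)"
proof (unfold_locales, unfold tab_word_iff[OF l])
  show "exp t ^ n \<noteq> 1" if "n \<ge> 1" for n :: nat using q that .
  show "a \<noteq> 0" by (rule a)
  show "length js = k * l" if "tab_word l (k * l) js" for js using that by (simp add: tab_word_def)
  show "js ! p < js ! r" if "tab_word l (k * l) js" "p < r" "r < k * l" "box_content l p = box_content l r" for js p r
    using tab_word_diag[OF that l] by simp
  show "(\<exists>s>p. s < r \<and> js ! s = js ! p \<and> box_content l s = box_content l p + 1) \<and>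
      (\<exists>s>p. s < r \<and> js ! s = js ! r \<and> box_content l s = box_content l p - 1)"
    if "tab_word l (k * l) js" "p < r" "r < k * l" "box_content l p = box_content l r" "js ! r = js ! p + 1" for js p r
    using tab_word_square[OF that(1-4) l that(5)] by blast
  show "tab_word l (k * l) (js[p := tgt \<epsilon> i]) \<longleftrightarrow>
      \<not> (\<exists>r<k * l. bef \<epsilon> r p \<and> (js ! r = tgt \<epsilon> i \<and> sg \<epsilon> * (box_content l r - box_content l p) = 1 \<or>
                            js ! r = src \<epsilon> i \<and> sg \<epsilon> * (box_content l r - box_content l p) = -1))"
    if "tab_word l (k * l) js" "p < k * l" "js ! p = src \<epsilon> i" for js p \<epsilon> i
    using that tab_word_move_Pos[OF that(1,2) l, of i] tab_word_move_Neg[OF that(1,2) l, of i]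
    by (cases \<epsilon>) (simp_all add: minus_diff_eq)
  show "\<exists>js\<in>reading l k ` tableaux l k. \<forall>p<k * l. js ! p < m" for m
  proof (rule bexI)
    let ?js = "map (\<lambda>p. m - int l - 1 + int (p mod l)) [0..<k * l]"
    have "p mod l < l" for p using l by simp
    then have "int (p mod l) < int l" for p by (simp only: of_nat_less_iff)
    then have *: "m - int l - 1 + int (p mod l) < m" for p by (smt (verit))
    then show "\<forall>p<k * l. ?js ! p < m" by simp
    show "?js \<in> reading l k ` tableaux l k"
      unfolding tab_word_iff[OF l] by (auto simp: tab_word_def Suc_mod_div)
  qed
qed (use tab_word_down tab_word_up l in blast)+

lemma keys_boxes: "Poly_Mapping.keys (boxes x) = {x}"
  by (simp add: boxes_def)

context box_config
begin

section \<open>Extremality\<close>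

lemma lookup_weight:
  assumes "length js = N"
  shows "Poly_Mapping.lookup (weight js) i = int (card (sources Neg i js)) - int (card (sources Pos i js))"
proof -
  have ind: "(\<Sum>p<N. if js ! p = x then 1 else 0) = int (card {p. p < N \<and> js ! p = x})" for x
  proof -
    have "{..<N} \<inter> {p. js ! p = x} = {p. p < N \<and> js ! p = x}" by auto
    then show ?thesis by (simp add: sum.If_cases)
  qed
  have "Poly_Mapping.lookup (weight js) i = (\<Sum>j\<leftarrow>js. (if j = i then 1 else 0) - (if j = i + 1 then 1 else 0))"
    by (induction js) (auto simp: weight_def lookup_add lookup_minus lookup_single when_def)
  also have "\<dots> = (\<Sum>p<N. if js ! p = i then 1 else 0) - (\<Sum>p<N. if js ! p = i + 1 then 1 else 0)"
    unfolding sum_list_nth[OF assms] sum_subtractf ..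
  finally show ?thesis by (simp add: sources_def ind)
qed

definition moved :: "sgn \<Rightarrow> int \<Rightarrow> nat set \<Rightarrow> int list \<Rightarrow> int list" where
  "moved \<epsilon> i A js = map (\<lambda>p. if p \<in> A then tgt \<epsilon> i else js ! p) [0..<N]"

lemma keys_x_basis_pow:
  assumes "js' \<in> Poly_Mapping.keys ((lin (x_basis \<epsilon> i r) ^^ n) (boxes js))" "length js = N"
  shows "\<exists>A\<subseteq>sources \<epsilon> i js. card A = n \<and> js' = moved \<epsilon> i A js"
  using assms(1)
proof (induction n arbitrary: js')
  case 0
  then have "js' = moved \<epsilon> i {} js"
    using assms(2) by (auto simp: boxes_def moved_def intro: nth_equalityI)
  then show ?case by (intro exI[of _ "{}"]) simp
next
  case (Suc n)
  then obtain js1 p where js1: "js1 \<in> Poly_Mapping.keys ((lin (x_basis \<epsilon> i r) ^^ n) (boxes js))"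
    "p < N" "js1 ! p = src \<epsilon> i" "js' = js1[p := tgt \<epsilon> i]"
    using keys_lin[of "x_basis \<epsilon> i r"] keys_x_basis by (auto, blast)
  obtain A where A: "A \<subseteq> sources \<epsilon> i js" "card A = n" "js1 = moved \<epsilon> i A js"
    using Suc.IH[OF js1(1)] by blast
  have p: "p \<notin> A" "p \<in> sources \<epsilon> i js"
    using js1(2,3) A(3) by (auto simp: moved_def sources_def split: if_splits)
  have "js' = moved \<epsilon> i (insert p A) js"
    unfolding js1(4) A(3) by (rule nth_equalityI) (use js1(2) in \<open>auto simp: moved_def nth_list_update\<close>)
  moreover have "finite A" using A(1) finite_subset[of A "{..<N}"] by (auto simp: sources_def)
  ultimately show ?case using A p by (intro exI[of _ "insert p A"]) auto
qed

text \<open>The only set of that many sources is the set of all of them, so a single list can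
  occur.\<close>

lemma x_basis_pow_full:
  assumes "length js = N"
  shows "\<exists>c. (lin (x_basis \<epsilon> i r) ^^ card (sources \<epsilon> i js)) (boxes js) = tscale c (boxes (moved \<epsilon> i (sources \<epsilon> i js) js))"
proof -
  let ?v = "(lin (x_basis \<epsilon> i r) ^^ card (sources \<epsilon> i js)) (boxes js)"
  let ?x = "moved \<epsilon> i (sources \<epsilon> i js) js"
  have fin: "finite (sources \<epsilon> i js)" by (simp add: sources_def)
  have "js' = ?x" if "js' \<in> Poly_Mapping.keys ?v" for js'
    using keys_x_basis_pow[OF that assms] card_subset_eq[OF fin] by blast
  then have "?v = tscale (Poly_Mapping.lookup ?v ?x) (boxes ?x)"
    by (intro poly_mapping_eqI) (auto simp: lookup_boxes in_keys_iff)
  then show ?thesis by blast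
qed

lemma lin_pow_scale: "(lin F ^^ n) (tscale c v) = tscale c ((lin F ^^ n) v)"
  by (induction n) (auto simp: lin_scale)

end

section \<open>Rectangular arrays with constant rows\<close>

locale rectangle =
  fixes t a :: complex and l k :: nat
  assumes q_not_root: "\<And>n :: nat. n \<ge> 1 \<Longrightarrow> exp t ^ n \<noteq> 1"
    and a_neq_0: "a \<noteq> 0" and l: "l \<ge> 1" and k: "k \<ge> 1"

sublocale rectangle \<subseteq> box_config t a "k * l" "box_content l" "reading l k ` tableaux l k"
  by (rule box_config_tableaux[OF q_not_root a_neq_0 l])

context rectangle
begin

definition incr :: "(nat \<Rightarrow> int) \<Rightarrow> bool" where
  "incr s \<longleftrightarrow> (\<forall>r. Suc r < l \<longrightarrow> s r < s (Suc r))"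

definition rows :: "(nat \<Rightarrow> int) \<Rightarrow> int list" where
  "rows s = map (\<lambda>p. s (p mod l)) [0..<k * l]"

lemma length_rows [simp]: "length (rows s) = k * l"
  by (simp add: rows_def)

lemma nth_rows [simp]: "p < k * l \<Longrightarrow> rows s ! p = s (p mod l)"
  by (simp add: rows_def)

lemma mod_l [simp]: "p mod l < l"
  using l by simp

lemma rows_B: "incr s \<Longrightarrow> rows s \<in> reading l k ` tableaux l k"
  unfolding tab_word_iff[OF l] tab_word_def
proof (intro conjI allI impI)
  fix p assume s: "incr s" and p: "Suc p < k * l" "Suc p mod l \<noteq> 0"
  have "Suc (p mod l) < l" using mod_l[of "Suc p"] Suc_mod_div(1)[OF p(2)] by simp
  then show "rows s ! p < rows s ! Suc p"
    using s p Suc_mod_div(1)[OF p(2)] by (simp add: incr_def)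
qed auto

lemma incr_less:
  assumes "incr s" "r < r'" "r' < l"
  shows "s r < s r'"
  using assms(2,3)
proof (induction r')
  case (Suc r')
  then show ?case using assms(1) by (cases "r = r'") (force simp: incr_def)+
qed simp

lemma incr_inj: "incr s \<Longrightarrow> r < l \<Longrightarrow> r' < l \<Longrightarrow> s r = s r' \<Longrightarrow> r = r'"
  using incr_less[of s r r'] incr_less[of s r' r] by (cases r r' rule: linorder_cases) auto

lemma row_position: "r < l \<Longrightarrow> r < k * l" "r < l \<Longrightarrow> r mod l = r"
  using k l by (auto intro: less_le_trans)

lemma consecutive_rows:
  assumes s: "incr s" and r: "r < l" "r' < l" "s r' = s r + 1"
  shows "r' = Suc r"
proof (rule ccontr)
  assume neq: "r' \<noteq> Suc r"
  have "r \<noteq> r'" using r(3) by auto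
  moreover have "\<not> r' < r"
  proof
    assume "r' < r"
    from incr_less[OF s this r(1)] r(3) show False by linarith
  qed
  ultimately have "Suc r < r'" using neq by simp
  then have "s r < s (Suc r)" "s (Suc r) < s r'"
    using incr_less[OF s] r(2) by auto
  then show False using r(3) by linarith
qed

text \<open>If \<open>i\<close> does not occur, nothing can be raised with colour \<open>i\<close>.
  If it does, the entries \<open>i + 1\<close> can only fill the next row, and each of them is
  blocked from being lowered by the \<open>i\<close> directly above.\<close>

lemma rows_extremal:
  assumes s: "incr s"
  shows "x_basis Pos i 0 (rows s) = 0 \<or> x_basis Neg i 0 (rows s) = 0"
proof (cases "\<exists>r<l. s r = i")
  case False
  then have "move_basis Neg i p (rows s) = 0" if "p < k * l" for p
    using that by (auto simp: move_basis_def)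
  then show ?thesis by (simp add: x_basis_def)
next
  case True
  then obtain r where r: "r < l" "s r = i" by blast
  have "move_basis Pos i p (rows s) = 0" if p: "p < k * l" for p
  proof (cases "s (p mod l) = i + 1")
    case True
    then have m: "p mod l = Suc r" using consecutive_rows[OF s r(1) mod_l] r by simp
    then have Sp: "Suc (p - 1) = p" by (cases p) auto
    then have pm: "(p - 1) mod l = r"
      using Suc_mod_div(1)[of "p - 1" l] m by simp
    have "box_content l (p - 1) - box_content l p = 1"
      using content_neighbours(2)[OF l, of "p - 1"] Sp m by simp
    then have "(rows s)[p := tgt Pos i] \<notin> reading l k ` tableaux l k"
      using B_move[OF rows_B[OF s] p, of Pos i] True p r pm Sp
      by (auto intro!: exI[of _ "p - 1"])
    then have "coef Pos i (rows s) p = 0"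
      using coef_eq_0_iff[OF rows_B[OF s] p, of Pos i] True p by simp
    then show ?thesis by (simp add: move_basis_def)
  qed (use p in \<open>auto simp: move_basis_def\<close>)
  then show ?thesis by (simp add: x_basis_def)
qed

definition extremal_line :: "tensor set" where
  "extremal_line = {tscale c (boxes (rows s)) | c s. incr s}"

lemma extremal_lineI: "incr s \<Longrightarrow> tscale c (boxes (rows s)) \<in> extremal_line"
  unfolding extremal_line_def by blast

lemma boxes_extremal_line: "incr s \<Longrightarrow> boxes (rows s) \<in> extremal_line"
  using extremal_lineI[of s 1] by simp

lemma extremal_line_scale: "w \<in> extremal_line \<Longrightarrow> tscale c w \<in> extremal_line"
  unfolding extremal_line_def by force

text \<open>If the target entry is absent, the power moves a whole row, or nothing, and the rows
  stay strictly ordered because source and target are adjacent integers. If it is present, it fills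
  a row and is at least as frequent as the source, so \<open>nat\<close> makes the exponent
  0.\<close>

lemma x_basis_pow_extremal_line:
  assumes s: "incr s"
    and n: "n = nat (int (card {p. p < k * l \<and> rows s ! p = src \<epsilon> i}) - int (card {p. p < k * l \<and> rows s ! p = tgt \<epsilon> i}))"
  shows "(lin (x_basis \<epsilon> i 0) ^^ n) (boxes (rows s)) \<in> extremal_line"
proof -
  let ?S = "{p. p < k * l \<and> rows s ! p = src \<epsilon> i}" and ?T = "{p. p < k * l \<and> rows s ! p = tgt \<epsilon> i}"
  have n0: ?thesis if "n = 0"
    using that boxes_extremal_line[OF s] by simp
  show ?thesis
  proof (cases "?T = {}")
    case True
    define s' where "s' = (\<lambda>r. if s r = src \<epsilon> i then tgt \<epsilon> i else s r)"
    have no: "s r \<noteq> tgt \<epsilon> i" if "r < l" for r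
    proof -
      have "r \<notin> ?T" using True by blast
      then show ?thesis using row_position[OF that] by simp
    qed
    have s': "incr s'"
      unfolding incr_def
    proof (intro allI impI)
      fix r assume r: "Suc r < l"
      then have "s r < s (Suc r)" "s r \<noteq> tgt \<epsilon> i" "s (Suc r) \<noteq> tgt \<epsilon> i"
        using s no by (auto simp: incr_def)
      then show "s' r < s' (Suc r)" by (cases \<epsilon>) (auto simp: s'_def)
    qed
    have "moved \<epsilon> i (sources \<epsilon> i (rows s)) (rows s) = rows s'"
      by (rule nth_equalityI) (auto simp: moved_def sources_def s'_def)
    moreover have "n = card (sources \<epsilon> i (rows s))"
      unfolding n sources_def True by (simp only: card.empty of_nat_0 diff_0_right nat_int)
    ultimately obtain c where "(lin (x_basis \<epsilon> i 0) ^^ n) (boxes (rows s)) = tscale c (boxes (rows s'))"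
      using x_basis_pow_full[of "rows s" \<epsilon> i 0] by auto
    then show ?thesis using extremal_lineI[OF s'] by simp
  next
    case False
    then obtain p0 where "p0 \<in> ?T" by blast
    then have r0: "p0 mod l < l" "s (p0 mod l) = tgt \<epsilon> i" by auto
    \<comment> \<open>Sends a box to the box of the same column in the row of \<open>p0\<close>, all
      of whose entries are the target.\<close>
    define f where "f = (\<lambda>p. p div l * l + p0 mod l)"
    have fm: "f p mod l = p0 mod l" "f p div l = p div l" for p
      using l by (auto simp: f_def)
    have "card ?S \<le> card ?T"
    proof (rule card_inj_on_le)
      show "inj_on f ?S"
      proof (rule inj_onI)
        fix p p' assume p: "p \<in> ?S" "p' \<in> ?S" "f p = f p'"
        then have "p div l = p' div l" using fm(2) by metis
        moreover have "p mod l = p' mod l" using p incr_inj[OF s mod_l mod_l] by auto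
        ultimately show "p = p'" by (metis div_mult_mod_eq)
      qed
      show "f ` ?S \<subseteq> ?T"
      proof (rule image_subsetI)
        fix p assume p: "p \<in> ?S"
        have "p div l < k" using p by (simp add: less_mult_imp_div_less)
        then have "Suc (p div l) * l \<le> k * l" by (intro mult_le_mono1) simp
        then have "f p < k * l" using r0(1) unfolding f_def mult_Suc by linarith
        then show "f p \<in> ?T" using fm r0 by simp
      qed
    qed simp
    then show ?thesis using n0 n by simp
  qed
qed

lemma extremal_line_V: "w \<in> extremal_line \<Longrightarrow> w \<in> V"
  unfolding extremal_line_def using rows_B tensor.subspace_scale[OF subspace_V] by auto

lemma divided_power_extremal_line:
  assumes w: "w \<in> extremal_line" "w \<in> weight_space t tscale V act \<nu>"
    and n: "n = (case \<epsilon> of Neg \<Rightarrow> nat (Poly_Mapping.lookup \<nu> i) | Pos \<Rightarrow> nat (- Poly_Mapping.lookup \<nu> i))"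
  shows "divided_power t tscale act \<epsilon> i n w \<in> extremal_line"
proof -
  obtain c s where s: "w = tscale c (boxes (rows s))" "incr s"
    using w(1) by (auto simp: extremal_line_def)
  have pow: "(act (cls t (gn (X \<epsilon> i 0))) ^^ n) w = tscale c ((lin (x_basis \<epsilon> i 0) ^^ n) (boxes (rows s)))"
    using act_X_pow[OF extremal_line_V[OF w(1)]] by (simp add: s(1) lin_pow_scale)
  show ?thesis
  proof (cases "c = 0")
    \<comment> \<open>The zero vector lies in every weight space, so \<open>\<nu>\<close> carries no
      information about \<open>s\<close> and the exponent is arbitrary.\<close>
    case True
    then have "divided_power t tscale act \<epsilon> i n w = tscale 0 (boxes (rows s))"
      unfolding divided_power_def pow by simp
    then show ?thesis using extremal_lineI[OF s(2), of 0] by simp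
  next
    case False
    then have "weight (rows s) = \<nu>"
      using w(2) by (simp add: weight_space_iff s(1) in_keys_iff lookup_boxes)
    then have "n = nat (int (card {p. p < k * l \<and> rows s ! p = src \<epsilon> i}) - int (card {p. p < k * l \<and> rows s ! p = tgt \<epsilon> i}))"
      using lookup_weight[of "rows s" i] unfolding n by (cases \<epsilon>) (simp_all add: sources_def)
    then show ?thesis
      unfolding divided_power_def pow
      by (intro extremal_line_scale x_basis_pow_extremal_line s(2))
  qed
qed

lemma extremal_rows:
  assumes s: "incr s"
  shows "extremal t tscale V act (boxes (rows s))"
  unfolding extremal_def
proof (intro conjI ballI allI)
  show "\<exists>\<nu>. boxes (rows s) \<in> weight_space t tscale V act \<nu>"
    using rows_B[OF s] by (intro exI[of _ "weight (rows s)"]) (simp add: weight_space_iff keys_boxes)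
next
  fix w i assume "w \<in> S_orbit t tscale V act (boxes (rows s))"
  then have "w \<in> extremal_line"
  proof (induction rule: S_orbit.induct)
    case base
    show ?case by (rule boxes_extremal_line[OF s])
  next
    case (S_highest w \<nu> i)
    then show ?case by (intro divided_power_extremal_line) auto
  next
    case (S_lowest w \<nu> i)
    then show ?case by (intro divided_power_extremal_line) auto
  qed
  moreover from this have "w \<in> V" by (rule extremal_line_V)
  ultimately obtain c s' where s': "w = tscale c (boxes (rows s'))" "incr s'" "w \<in> V"
    unfolding extremal_line_def by blast
  have "act (cls t (gn (X \<epsilon> i 0))) w = tscale c (x_basis \<epsilon> i 0 (rows s'))" for \<epsilon>
    using s'(3) by (simp add: act_cls) (simp add: s'(1) G_X_fun lin_scale del: G.simps)
  then show "i_extremal t act i w"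
    using rows_extremal[OF s'(2), of i] unfolding i_extremal_def by auto
qed

section \<open>The l-weight of the generating vector\<close>

lemma params_box_params: "box_params t l k a = params"
proof (rule nth_equalityI)
  fix p assume "p < length (box_params t l k a)"
  then have p: "p < k * l" by (simp add: box_params_def)
  then show "box_params t l k a ! p = params ! p"
    by (simp add: box_params_def nth_reading params_nth box_content_def)
qed (simp add: box_params_def)

lemma psi_nonzero [simp]: "psi t c \<noteq> 0"
  by (simp add: psi_def Zero_fract_def eq_fract)

definition Te :: "nat \<Rightarrow> int" where
  "Te r = int r + 1"

lemma incr_Te: "incr Te"
  by (simp add: incr_def Te_def)

text \<open>In every column the entries \<open>i\<close> and \<open>i + 1\<close> contribute psi and
  its inverse with the same argument, so they cancel for \<open>i\<close> from 1 to
  \<open>l - 1\<close>. The last entry survives for \<open>i = l\<close>, the first one for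
  \<open>i = 0\<close>.\<close>

lemma tensor_phi_Te:
  "tensor_phi t params i (rows Te) =
    (if i = int l then \<Prod>j<k. psi t (a * q powi (2 * int j - i + 2))
     else if i = 0 then \<Prod>j<k. inverse (psi t (a * q powi (2 * int j - i + 2))) else 1)"
proof -
  let ?c = "\<lambda>j. psi t (a * q powi (2 * int j - i + 2))"
  have box: "box_phi t i (params ! (j * l + r), rows Te ! (j * l + r))
    = (if r = nat (i - 1) then if 1 \<le> i then ?c j else 1 else 1) * (if r = nat i then if 0 \<le> i then inverse (?c j) else 1 else 1)"
    if "j < k" "r < l" for j r
  proof -
    have "j * l + r < Suc j * l" using that by simp
    also have "\<dots> \<le> k * l" using that by (intro mult_le_mono1) simp
    finally have p: "j * l + r < k * l" .
    have dm: "(j * l + r) mod l = r" "(j * l + r) div l = j" using that by auto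
    have b: "params ! (j * l + r) = a * q powi (2 * (int j - int r))"
      using p dm by (simp add: params_nth box_content_def)
    have Tr: "rows Te ! (j * l + r) = int r + 1" using p dm by (simp add: Te_def)
    consider "i = int r + 1" | "i = int r" | "i \<noteq> int r + 1" "i \<noteq> int r" by blast
    then show ?thesis
    proof cases
      case 1
      then show ?thesis
        unfolding b Tr by (simp add: box_phi_def mult.assoc flip: power_int_add) (simp add: algebra_simps)
    next
      case 2
      have "(if r = nat (i - 1) then if 1 \<le> i then ?c j else 1 else 1) = 1"
        using 2 by auto
      then show ?thesis
        unfolding b Tr using 2
        by (simp add: box_phi_def mult.assoc flip: power_int_add) (simp add: algebra_simps)
    next
      case 3
      then have "\<not> (r = nat (i - 1) \<and> 1 \<le> i)" "\<not> (r = nat i \<and> 0 \<le> i)" by auto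
      then show ?thesis unfolding b Tr using 3 by (auto simp: box_phi_def)
    qed
  qed
  have "tensor_phi t params i (rows Te) = (\<Prod>p<k * l. box_phi t i (params ! p, rows Te ! p))"
    by (rule tensor_phi_prod(1)) simp
  also have "\<dots> = (\<Prod>j<k. \<Prod>p\<in>{j * l..<j * l + l}. box_phi t i (params ! p, rows Te ! p))"
    by (rule prod.nat_group[symmetric])
  also have "\<dots> = (\<Prod>j<k. \<Prod>r<l. box_phi t i (params ! (j * l + r), rows Te ! (j * l + r)))"
  proof (rule prod.cong)
    fix j
    show "(\<Prod>p\<in>{j * l..<j * l + l}. box_phi t i (params ! p, rows Te ! p)) = (\<Prod>r<l. box_phi t i (params ! (j * l + r), rows Te ! (j * l + r)))"
      by (rule prod.reindex_bij_witness[of _ "\<lambda>r. j * l + r" "\<lambda>p. p - j * l"]) auto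
  qed simp
  also have "\<dots> = (\<Prod>j<k. (if nat (i - 1) < l then if 1 \<le> i then ?c j else 1 else 1)
      * (if nat i < l then if 0 \<le> i then inverse (?c j) else 1 else 1))"
    by (rule prod.cong) (simp_all add: box prod.distrib)
  also have "\<dots> = (if i = int l then \<Prod>j<k. ?c j else if i = 0 then \<Prod>j<k. inverse (?c j) else 1)"
  proof -
    consider "i = int l" | "i = 0" | "1 \<le> i" "i < int l" | "i < 0 \<or> i > int l" by linarith
    then show ?thesis
    proof cases
      case 1
      then have "(nat (i - 1) < l) = True" "(1 \<le> i) = True" "(nat i < l) = False" "(i = int l) = True"
        using l by auto
      then show ?thesis by (simp only: if_True if_False mult_1_right)
    next
      case 2
      then have "(1 \<le> i) = False" "(nat i < l) = True" "(0 \<le> i) = True" "(i = int l) = False" "(i = 0) = True"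
        using l by auto
      then show ?thesis by (simp only: if_True if_False mult_1_left if_cancel)
    next
      case 3
      then have "(nat (i - 1) < l) = True" "(nat i < l) = True" "(0 \<le> i) = True" "(i = int l) = False" "(i = 0) = False"
        by auto
      then show ?thesis using 3(1) by simp
    next
      case 4
      then consider "(0 \<le> i) = False" "(1 \<le> i) = False"
        | "(nat i < l) = False" "(nat (i - 1) < l) = False" "i > int l" by fastforce
      then show ?thesis
      proof cases
        case 1
        then have "(i = int l) = False" "(i = 0) = False" by auto
        with 1 show ?thesis by (simp only: if_False if_cancel mult_1_left prod.neutral_const)
      next
        case 2
        then have "(i = int l) = False" "(i = 0) = False" using l by auto
        with 2 show ?thesis by (simp only: if_False mult_1_left prod.neutral_const)
      qed
    qed
  qed
  finally show ?thesis .
qed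

lemma powi_Suc: "q powi m * q = q powi (m + 1)"
  by (simp add: power_int_add)

lemma lookup_sum_Y:
  assumes inj: "inj_on f {..<k}"
  shows "Poly_Mapping.lookup (\<Sum>s<k. Y i (f s)) (j, b) = (if j = i \<and> b \<in> f ` {..<k} then 1 else 0)"
proof (cases "j = i \<and> b \<in> f ` {..<k}")
  case True
  then obtain s where s: "s < k" "b = f s" "j = i" by auto
  have "Poly_Mapping.lookup (\<Sum>s<k. Y i (f s)) (j, b) = (\<Sum>s'<k. if s' = s then 1 else 0)"
    unfolding lookup_sum by (rule sum.cong) (use s inj in \<open>auto simp: Y_def lookup_single when_def inj_on_def\<close>)
  then show ?thesis using True s by simp
next
  case False
  then show ?thesis
    by (auto simp: lookup_sum Y_def lookup_single when_def intro!: sum.neutral)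
qed

text \<open>The factor \<open>exp t\<close> in \<open>monomial_ratfun\<close> raises the exponents
  of the monomial by one, to those of \<open>tensor_phi_Te\<close>. The variables are pairwise
  distinct, as \<open>q\<close> is not a root of unity and \<open>l\<close> is not 0, so all
  exponents are 1 or -1.\<close>

lemma monomial_ratfun_m_Te:
  "monomial_ratfun t (m_Te t l k a) i = tensor_phi t params i (rows Te)"
proof -
  define f g where "f = (\<lambda>s :: nat. a * q powi (- int l + 1 + 2 * int s))" and "g = (\<lambda>s :: nat. a * q powi (1 + 2 * int s))"
  have inj: "inj_on f {..<k}" "inj_on g {..<k}"
    using a_neq_0 by (auto simp: inj_on_def f_def g_def powi_eq_iff)
  have l0: "int l \<noteq> 0" using l by simp
  have lk: "Poly_Mapping.lookup (m_Te t l k a) (j, b)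
    = (if j = int l \<and> b \<in> f ` {..<k} then 1 else 0) - (if j = 0 \<and> b \<in> g ` {..<k} then 1 else 0)" for j b
  proof -
    have "m_Te t l k a = (\<Sum>s<k. Y (int l) (f s)) - (\<Sum>s<k. Y 0 (g s))"
      by (simp only: m_Te_def f_def g_def)
    then show ?thesis
      by (simp only: lookup_minus lookup_sum_Y[OF inj(1)] lookup_sum_Y[OF inj(2)])
  qed
  consider "i = int l" | "i = 0" | "i \<noteq> int l" "i \<noteq> 0" by blast
  then show ?thesis
  proof cases
    case 1
    have "{b. (i, b) \<in> Poly_Mapping.keys (m_Te t l k a)} = f ` {..<k}"
      using 1 l0 by (auto simp: in_keys_iff lk)
    then have "monomial_ratfun t (m_Te t l k a) i = (\<Prod>b\<in>f ` {..<k}. psi t (b * q))"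
      unfolding monomial_ratfun_def using 1 l0 by (intro prod.cong) (auto simp: lk)
    also have "\<dots> = (\<Prod>j<k. psi t (a * q powi (2 * int j - i + 2)))"
      unfolding prod.reindex[OF inj(1)] comp_def
    proof (rule prod.cong[OF refl])
      fix j
      have "f j * q = a * q powi (- int l + 1 + 2 * int j + 1)"
        unfolding f_def by (simp only: mult.assoc powi_Suc)
      also have "- int l + 1 + 2 * int j + 1 = 2 * int j - i + 2" using 1 by simp
      finally show "psi t (f j * q) = psi t (a * q powi (2 * int j - i + 2))" by simp
    qed
    finally show ?thesis using 1 by (simp add: tensor_phi_Te)
  next
    case 2
    have "{b. (i, b) \<in> Poly_Mapping.keys (m_Te t l k a)} = g ` {..<k}"
      using 2 l0 by (auto simp: in_keys_iff lk)
    then have "monomial_ratfun t (m_Te t l k a) i = (\<Prod>b\<in>g ` {..<k}. inverse (psi t (b * q)))"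
      unfolding monomial_ratfun_def using 2 l0 by (intro prod.cong) (auto simp: lk power_int_minus)
    also have "\<dots> = (\<Prod>j<k. inverse (psi t (a * q powi (2 * int j - i + 2))))"
      unfolding prod.reindex[OF inj(2)] comp_def
    proof (rule prod.cong[OF refl])
      fix j
      have "g j * q = a * q powi (1 + 2 * int j + 1)"
        unfolding g_def by (simp only: mult.assoc powi_Suc)
      also have "1 + 2 * int j + 1 = 2 * int j - i + 2" using 2 by simp
      finally show "inverse (psi t (g j * q)) = inverse (psi t (a * q powi (2 * int j - i + 2)))" by simp
    qed
    finally show ?thesis using 2 l0 by (simp add: tensor_phi_Te)
  next
    case 3
    have "{b. (i, b) \<in> Poly_Mapping.keys (m_Te t l k a)} = {}"
      using 3 by (auto simp: in_keys_iff lk)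
    then show ?thesis unfolding monomial_ratfun_def using 3 by (simp add: tensor_phi_Te)
  qed
qed

lemma l_weight_Te: "boxes (rows Te) \<in> l_weight_space t tscale V act (m_Te t l k a)"
proof -
  have B: "rows Te \<in> reading l k ` tableaux l k" by (rule rows_B[OF incr_Te])
  then have "act (cls t (phi t \<epsilon> i (sg \<epsilon> * int n))) (boxes (rows Te))
      = tscale (fps_nth (expansion \<epsilon> (monomial_ratfun t (m_Te t l k a) i)) n) (boxes (rows Te))" for \<epsilon> i n
    using acts_by_coproduct unfolding acts_by_coproduct_def monomial_ratfun_m_Te by blast
  then show ?thesis
    unfolding l_weight_space_def using B by (auto intro!: exI[of _ 1])
qed

lemma extremal_loop_weight_V: "extremal_loop_weight_module t tscale V act (m_Te t l k a)"
  unfolding extremal_loop_weight_module_def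
proof (intro conjI integrable_V bexI[OF _ l_weight_Te])
  show "(\<lambda>u. act u (boxes (rows Te))) ` carrier (Uq t) = V"
    by (rule cyclic) (use rows_B[OF incr_Te] in auto)
  show "extremal t tscale V act (boxes (rows Te))"
    by (rule extremal_rows[OF incr_Te])
qed (use finite_dimensional_Uq_J in blast)

lemma V_Te_eq: "V_Te l k = V"
  unfolding V_Te_def V_eq_span image_image ..

end

theorem theorem4p9:
  fixes t a :: complex and l k :: nat
  assumes q_not_root_of_unity: "\<And>n :: nat. n \<ge> 1 \<Longrightarrow> exp t ^ n \<noteq> 1"
    and "l \<ge> 1" and "k \<ge> 1" and "a \<noteq> 0"
  shows "\<exists>act :: falg set \<Rightarrow> tensor \<Rightarrow> tensor.
           uq_module t tscale (V_Te l k) act \<and>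
           acts_by_coproduct t (box_params t l k a) (reading l k ` tableaux l k) act \<and>
           irreducible_module t tscale (V_Te l k) act \<and>
           extremal_loop_weight_module t tscale (V_Te l k) act (m_Te t l k a)"
proof -
  interpret rectangle t a l k
    using assms by unfold_locales
  show ?thesis
    unfolding V_Te_eq params_box_params
    using uq_module_V acts_by_coproduct irreducible extremal_loop_weight_V by blast
qed

end
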